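(* Up to isomorphism, there are exactly three noncommutative integral Drinfeld rings of rank $7$; their invariants are: (1) $\mathrm{FPdim}$ $24$, type $[1,1,1,2,2,2,3]$, duality $[0,2,1,3,4,5,6]$, formal codegrees $[3_2,4,24,24]$; (2) $\mathrm{FPdim}$ $42$, type $[1,1,1,1,1,1,6]$, duality $[0,1,2,3,5,4,6]$, formal codegrees $[3_2,6,7,42]$; (3) $\mathrm{FPdim}$ $60$, type $[1,1,1,3,4,4,4]$, duality $[0,2,1,3,4,5,6]$, formal codegrees $[3_2,4,15,60]$.
   Context: A fusion ring $\mathcal{R}$ is a ring that is a free $\mathbb{Z}$-module with finite basis $b_1=1,b_2,\dots,b_r$ ($r$ is the rank), products $b_ib_j=\sum_k N_{i,j}^k b_k$ with $N_{i,j}^k\in\mathbb{Z}_{\ge 0}$, and an involution $i\mapsto i^*$ of the index set such that $b_i\mapsto b_i^*:=b_{i^*}$ extends to an anti-automorphism and the coefficient of $b_1$ in $b_ib_j^*$ is $\delta_{i,j}$. Isomorphisms of fusion rings are ring isomorphisms mapping basis to basis. $\mathrm{FPdim}:\mathcal{R}\to\mathbb{R}$ is the unique ring homomorphism with $d_i:=\mathrm{FPdim}(b_i)>0$ for all $i$; $\mathrm{FPdim}(\mathcal{R})=\sum_i d_i^2$. $\mathcal{R}$ is integral if all $d_i\in\mathbb{Z}$. The type is the list $[d_1,\dots,d_r]$ with $d_1\le\dots\le d_r$, and the duality is the list $[i^*-1 : i=1,\dots,r]$ (well defined up to permuting basis elements of equal dimension). Formal codegrees: $\mathcal{R}_{\mathbb{C}}=\mathcal{R}\otimes_{\mathbb{Z}}\mathbb{C}$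 is semisimple and $Z=\sum_i b_ib_i^*$ is central. For an irreducible representation $V$ of $\mathcal{R}_{\mathbb{C}}$ of dimension $n_V$, $Z$ acts on $V$ by a scalar $\alpha_V$, and $f_V=\alpha_V/n_V$ is the formal codegree of $V$. In lists of formal codegrees (one entry per $V$), $f_n$ denotes a codegree $f$ coming from $V$ with $n_V=n$, the subscript being omitted if $n_V=1$. An integral fusion ring is a Drinfeld ring if all its formal codegrees are integers dividing $\mathrm{FPdim}(\mathcal{R})$. *)

theory Defs
  imports "Jordan_Normal_Form.VS_Connect" "HOL-Algebra.QuotRing"
begin

text \<open>A fusion ring here carries its distinguished basis as a set, so that the basis elements serve as
  their own indices; \<open>invol\<close> is the involution on these indices, and its values off the basis are
  irrelevant.\<close>

record 'a based_ring = "'a ring" +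
  basis :: "'a set"
  invol :: "'a \<Rightarrow> 'a"

definition lin_comb :: "'a based_ring \<Rightarrow> ('a \<Rightarrow> int) \<Rightarrow> 'a" where
  "lin_comb R c = (\<Oplus>\<^bsub>R\<^esub>b\<in>basis R. [c b] \<cdot>\<^bsub>R\<^esub> b)"

definition is_coord :: "'a based_ring \<Rightarrow> 'a \<Rightarrow> ('a \<Rightarrow> int) \<Rightarrow> bool" where
  "is_coord R x c \<longleftrightarrow> (\<forall>a. a \<notin> basis R \<longrightarrow> c a = 0) \<and> x = lin_comb R c"

definition free_basis :: "'a based_ring \<Rightarrow> bool" where
  "free_basis R \<longleftrightarrow> finite (basis R) \<and> basis R \<subseteq> carrier R \<and> (\<forall>x\<in>carrier R. \<exists>!c. is_coord R x c)"

definition coord :: "'a based_ring \<Rightarrow> 'a \<Rightarrow> 'a \<Rightarrow> int" where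
  "coord R x = (THE c. is_coord R x c)"

definition fusion_coeff :: "'a based_ring \<Rightarrow> 'a \<Rightarrow> 'a \<Rightarrow> 'a \<Rightarrow> int" where
  "fusion_coeff R x y z = coord R (x \<otimes>\<^bsub>R\<^esub> y) z"

definition anti_automorphism :: "'a based_ring \<Rightarrow> ('a \<Rightarrow> 'a) \<Rightarrow> bool" where
  "anti_automorphism R f \<longleftrightarrow>
     bij_betw f (carrier R) (carrier R) \<and> f \<one>\<^bsub>R\<^esub> = \<one>\<^bsub>R\<^esub> \<and>
     (\<forall>x\<in>carrier R. \<forall>y\<in>carrier R.
        f (x \<oplus>\<^bsub>R\<^esub> y) = f x \<oplus>\<^bsub>R\<^esub> f y \<and> f (x \<otimes>\<^bsub>R\<^esub> y) = f y \<otimes>\<^bsub>R\<^esub> f x)"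

definition fusion_ring :: "'a based_ring \<Rightarrow> bool" where
  "fusion_ring R \<longleftrightarrow>
     ring R \<and> free_basis R \<and> \<one>\<^bsub>R\<^esub> \<in> basis R \<and>
     (\<forall>x\<in>basis R. \<forall>y\<in>basis R. \<forall>z\<in>basis R. 0 \<le> fusion_coeff R x y z) \<and>
     (\<forall>x\<in>basis R. invol R x \<in> basis R \<and> invol R (invol R x) = x) \<and>
     (\<exists>f. anti_automorphism R f \<and> (\<forall>x\<in>basis R. f x = invol R x)) \<and>
     (\<forall>x\<in>basis R. \<forall>y\<in>basis R.
        fusion_coeff R x (invol R y) \<one>\<^bsub>R\<^esub> = (if x = y then 1 else 0))"

definition rank :: "'a based_ring \<Rightarrow> nat" where
  "rank R = card (basis R)"

definition fusion_iso :: "'a based_ring \<Rightarrow> 'b based_ring \<Rightarrow> bool" where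
  "fusion_iso R S \<longleftrightarrow> (\<exists>f\<in>ring_iso R S. f ` basis R = basis S)"

text \<open>Frobenius-Perron dimension. \<open>class_ring\<close> is the ring of all elements of a type, here the field
  of real numbers. Extensionality only makes the homomorphism unique as a HOL function.\<close>

definition is_FPdim :: "'a based_ring \<Rightarrow> ('a \<Rightarrow> real) \<Rightarrow> bool" where
  "is_FPdim R d \<longleftrightarrow>
     d \<in> Ring.ring_hom R class_ring \<and> d \<in> extensional (carrier R) \<and> (\<forall>b\<in>basis R. 0 < d b)"

definition FPdim :: "'a based_ring \<Rightarrow> 'a \<Rightarrow> real" where
  "FPdim R = (THE d. is_FPdim R d)"

definition FPdim_ring :: "'a based_ring \<Rightarrow> real" where
  "FPdim_ring R = (\<Sum>b\<in>basis R. (FPdim R b)\<^sup>2)"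

text \<open>The function \<open>d\<close> below is unique, hence equal to \<open>FPdim R\<close>; with the existential, no separate
  argument is needed that \<open>FPdim R\<close> is well defined for an integral fusion ring.\<close>

definition integral_fusion_ring :: "'a based_ring \<Rightarrow> bool" where
  "integral_fusion_ring R \<longleftrightarrow>
     fusion_ring R \<and> (\<exists>d. is_FPdim R d \<and> (\<forall>b\<in>basis R. d b \<in> \<int>))"

definition fusion_type :: "'a based_ring \<Rightarrow> real list" where
  "fusion_type R = sorted_list_of_multiset (image_mset (FPdim R) (mset_set (basis R)))"

text \<open>The duality depends on the enumeration of the basis by nondecreasing dimension; \<open>L\<close> is a
  duality of \<open>R\<close> if some such enumeration, starting with the unit, realizes it. Indices start
  at 0.\<close>

definition has_duality :: "'a based_ring \<Rightarrow> nat list \<Rightarrow> bool" where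
  "has_duality R L \<longleftrightarrow>
     (\<exists>bs. distinct bs \<and> set bs = basis R \<and> bs ! 0 = \<one>\<^bsub>R\<^esub> \<and> sorted (map (FPdim R) bs) \<and>
        length L = length bs \<and>
        (\<forall>i<length bs. L ! i < length bs \<and> invol R (bs ! i) = bs ! (L ! i)))"

text \<open>The algebra obtained by extending scalars to the complex numbers, in coordinates with respect
  to the basis.\<close>

definition complexification :: "'a based_ring \<Rightarrow> ('a \<Rightarrow> complex) ring" where
  "complexification R =
     \<lparr>carrier = {x. \<forall>a. a \<notin> basis R \<longrightarrow> x a = 0},
      mult = (\<lambda>x y c. if c \<in> basis R
        then \<Sum>a\<in>basis R. \<Sum>b\<in>basis R. x a * y b * of_int (fusion_coeff R a b c) else 0),
      one = (\<lambda>a. if a = \<one>\<^bsub>R\<^esub> then 1 else 0),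
      zero = (\<lambda>a. 0),
      add = (\<lambda>x y a. x a + y a)\<rparr>"

definition complexify :: "'a based_ring \<Rightarrow> 'a \<Rightarrow> 'a \<Rightarrow> complex" where
  "complexify R x = (\<lambda>a. of_int (coord R x a))"

definition is_rep :: "'a based_ring \<Rightarrow> nat \<Rightarrow> (('a \<Rightarrow> complex) \<Rightarrow> complex mat) \<Rightarrow> bool" where
  "is_rep R n \<rho> \<longleftrightarrow>
     \<rho> \<in> Ring.ring_hom (complexification R) (ring_mat TYPE(complex) n ()) \<and>
     (\<forall>c. \<forall>x\<in>carrier (complexification R). \<rho> (\<lambda>a. c * x a) = c \<cdot>\<^sub>m \<rho> x)"

definition irreducible_rep :: "'a based_ring \<Rightarrow> nat \<Rightarrow> (('a \<Rightarrow> complex) \<Rightarrow> complex mat) \<Rightarrow> bool" where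
  "irreducible_rep R n \<rho> \<longleftrightarrow> is_rep R n \<rho> \<and> 0 < n \<and>
     (\<forall>W. subspace class_ring W (module_vec TYPE(complex) n) \<and>
          (\<forall>x\<in>carrier (complexification R). \<forall>w\<in>W. \<rho> x *\<^sub>v w \<in> W)
        \<longrightarrow> W = {0\<^sub>v n} \<or> W = carrier_vec n)"

definition equivalent_reps :: "'a based_ring \<Rightarrow> nat \<Rightarrow> (('a \<Rightarrow> complex) \<Rightarrow> complex mat) \<Rightarrow>
    nat \<Rightarrow> (('a \<Rightarrow> complex) \<Rightarrow> complex mat) \<Rightarrow> bool" where
  "equivalent_reps R n \<rho> m \<sigma> \<longleftrightarrow> n = m \<and>
     (\<exists>P\<in>carrier_mat n n. invertible_mat P \<and>
        (\<forall>x\<in>carrier (complexification R). P * \<rho> x = \<sigma> x * P))"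

definition central_element :: "'a based_ring \<Rightarrow> 'a" where
  "central_element R = (\<Oplus>\<^bsub>R\<^esub>b\<in>basis R. b \<otimes>\<^bsub>R\<^esub> invol R b)"

definition formal_codegree ::
    "'a based_ring \<Rightarrow> nat \<Rightarrow> (('a \<Rightarrow> complex) \<Rightarrow> complex mat) \<Rightarrow> complex" where
  "formal_codegree R n \<rho> =
     (THE \<alpha>. \<rho> (complexify R (central_element R)) = \<alpha> \<cdot>\<^sub>m 1\<^sub>m n) / of_nat n"

text \<open>An entry \<open>(f, n)\<close> stands for a formal codegree \<open>f\<close> of an irreducible representation of
  dimension \<open>n\<close>; the list has one entry for each equivalence class.\<close>

definition has_formal_codegrees :: "'a based_ring \<Rightarrow> (complex \<times> nat) list \<Rightarrow> bool" where
  "has_formal_codegrees R L \<longleftrightarrow>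
     (\<exists>\<rho>. (\<forall>k<length L. irreducible_rep R (snd (L ! k)) (\<rho> k) \<and>
                         formal_codegree R (snd (L ! k)) (\<rho> k) = fst (L ! k)) \<and>
          (\<forall>k<length L. \<forall>l<length L. k \<noteq> l \<longrightarrow>
             \<not> equivalent_reps R (snd (L ! k)) (\<rho> k) (snd (L ! l)) (\<rho> l)) \<and>
          (\<forall>n \<sigma>. irreducible_rep R n \<sigma> \<longrightarrow>
             (\<exists>k<length L. equivalent_reps R n \<sigma> (snd (L ! k)) (\<rho> k))))"

definition Drinfeld_ring :: "'a based_ring \<Rightarrow> bool" where
  "Drinfeld_ring R \<longleftrightarrow> integral_fusion_ring R \<and>
     (\<forall>n \<rho>. irreducible_rep R n \<rho> \<longrightarrow>
        (\<exists>f D :: int. formal_codegree R n \<rho> = of_int f \<and> FPdim_ring R = of_int D \<and> f dvd D))"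

definition noncommutative :: "'a based_ring \<Rightarrow> bool" where
  "noncommutative R \<longleftrightarrow> (\<exists>x\<in>carrier R. \<exists>y\<in>carrier R. x \<otimes>\<^bsub>R\<^esub> y \<noteq> y \<otimes>\<^bsub>R\<^esub> x)"

end

theory Submission
  imports Defs "HOL-Library.Function_Algebras" "HOL-Library.Numeral_Type" "HOL-Library.Multiset"
    "Jordan_Normal_Form.Spectral_Radius"
begin

text \<open>The positive element \<open>Z = \<Sum>b b\<^sup>*\<close> makes the regular module split into orthogonal irreducible pieces,
  so a noncommutative ring of rank 7 has irreducible representations of dimensions 1, 2, 1, 1, with codegrees
  \<open>D = FPdim\<close>, \<open>f\<close>, \<open>a\<close>, \<open>b\<close>. The coefficient of the unit gives \<open>1/D + 2/f + 1/a + 1/b = 1\<close>, and since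
  \<open>f\<close>, \<open>a\<close>, \<open>b\<close> divide \<open>D\<close>, only finitely many quadruples occur. The case \<open>a = b\<close> is excluded by norm
  estimates. If \<open>a \<noteq> b\<close>, the integral traces of the maps \<open>x \<mapsto> b x c\<close> force all character values to
  be integers, so the columns of the character table are integral solutions of the orthogonality
  relations. A finite search leaves five tables; two of them contradict the traces. In the other three
  an invertible element \<open>g\<close> of order 3 fixes one basis element and permutes cyclically both its own powers
  and the other three, which determines the structure constants.\<close>

section \<open>Biorthogonal systems\<close>

text \<open>The search needs integral columns, while a priori \<psi> and \<phi> could be conjugate
  irrational characters. The trace of left multiplication yields \<psi> + \<phi>, and the expansion
  of the coefficient of the unit yields \<psi>/a + \<phi>/b, both up to \<chi>. The value \<chi> is
  rational because commutators vanish under every character and so isolate it. The two combinations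
  separate \<psi> from \<phi> exactly when a \<noteq> b, which is why equality needs its own
  argument. Rational values are integral since all powers of a value lie in one finitely generated
  group. The degrees come from counting: the matrix entries of pairwise orthogonal irreducibles are
  linearly independent in a space of dimension 7. A constituent inside the common annihilator of all
  characters has degree at least 2, hence exactly 2 by 1 + n^2 \<le> 7, and the two dimensions left
  over only have room for two characters. A family that fills the space exhausts the irreducibles,
  and this also yields the complete codegree lists of the three models.\<close>

lemma sum_fun_apply: "(\<Sum>i\<in>A. f i) x = (\<Sum>i\<in>A. f i x)"
  by (induction A rule: infinite_finite_induct) auto

definition fscale :: "complex \<Rightarrow> ('n \<Rightarrow> complex) \<Rightarrow> 'n \<Rightarrow> complex" where
  "fscale c x = (\<lambda>i. c * x i)"

definition delta :: "'n \<Rightarrow> 'n \<Rightarrow> complex" where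
  "delta i = (\<lambda>j. of_bool (i = j))"

lemma fscale_apply [simp]: "fscale c x i = c * x i"
  by (simp add: fscale_def)

lemma delta_apply: "delta i j = of_bool (i = j)"
  by (simp add: delta_def)

interpretation fv: vector_space "fscale :: complex \<Rightarrow> ('n \<Rightarrow> complex) \<Rightarrow> _"
  by unfold_locales (auto simp: fun_eq_iff algebra_simps)

lemma inj_delta: "inj delta"
  by (rule injI) (metis delta_apply of_bool_eq_iff)

lemma sum_delta_expand: "x = (\<Sum>i\<in>UNIV. fscale (x i) (delta (i :: 'n::finite)))"
  by (rule ext) (simp add: sum_fun_apply delta_apply of_bool_def if_distrib[of "(*) _"] cong: if_cong)

interpretation fv: finite_dimensional_vector_space
  "fscale :: complex \<Rightarrow> ('n::finite \<Rightarrow> complex) \<Rightarrow> _" "range delta"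
proof unfold_locales
  show "finite (range (delta :: 'n \<Rightarrow> _))" by simp
  show "fv.independent (range (delta :: 'n \<Rightarrow> _))"
  proof (rule fv.independent_if_scalars_zero)
    fix c :: "('n \<Rightarrow> complex) \<Rightarrow> complex" and x :: "'n \<Rightarrow> complex"
    assume s: "(\<Sum>x\<in>range delta. fscale (c x) x) = 0" and x: "x \<in> range delta"
    obtain k where k: "x = delta k" using x by auto
    have "0 = (\<Sum>i\<in>UNIV. fscale (c (delta i)) (delta i)) k"
      using s by (simp add: sum.reindex[OF inj_delta] o_def)
    also have "\<dots> = c (delta k)"
      by (simp add: sum_fun_apply delta_apply of_bool_def if_distrib[of "(*) _"] cong: if_cong)
    finally show "c x = 0" by (simp add: k)
  qed simp
  show "fv.span (range (delta :: 'n \<Rightarrow> _)) = UNIV"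
  proof (intro equalityI subsetI UNIV_I)
    fix x :: "'n \<Rightarrow> complex"
    have "(\<Sum>i\<in>UNIV. fscale (x i) (delta i)) \<in> fv.span (range delta)"
      by (intro fv.span_sum fv.span_scale fv.span_base) auto
    then show "x \<in> fv.span (range delta)" by (metis sum_delta_expand)
  qed
qed

text \<open>Pairing a linear relation with \<open>f' k\<close> leaves only its coefficient at
  \<open>f k\<close>, multiplied by the nonzero \<open>g k\<close>.\<close>

lemma biorthogonal_independent:
  fixes f f' :: "'i \<Rightarrow> 'n::finite \<Rightarrow> complex"
  assumes fin: "finite I"
    and bi: "\<And>k l. k \<in> I \<Longrightarrow> l \<in> I \<Longrightarrow> (\<Sum>b\<in>UNIV. f k b * f' l b) = (if k = l then g k else 0)"
    and g: "\<And>k. k \<in> I \<Longrightarrow> g k \<noteq> 0"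
  shows "fv.independent (f ` I)" "inj_on f I"
proof -
  show inj: "inj_on f I"
  proof (rule inj_onI, rule ccontr)
    fix k l assume kl: "k \<in> I" "l \<in> I" "f k = f l" "k \<noteq> l"
    then show False using bi[of k k] bi[of l k] g[of k] by auto
  qed
  show "fv.independent (f ` I)"
  proof (rule fv.independent_if_scalars_zero)
    fix c x assume s: "(\<Sum>x\<in>f ` I. fscale (c x) x) = 0" and x: "x \<in> f ` I"
    obtain k where k: "x = f k" "k \<in> I" using x by auto
    have "0 = (\<Sum>b\<in>UNIV. (\<Sum>x\<in>f ` I. fscale (c x) x) b * f' k b)" by (simp add: s)
    also have "\<dots> = (\<Sum>b\<in>UNIV. \<Sum>l\<in>I. c (f l) * (f l b * f' k b))"
      by (simp add: sum.reindex[OF inj] o_def sum_fun_apply sum_distrib_right mult.assoc)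
    also have "\<dots> = (\<Sum>l\<in>I. c (f l) * (\<Sum>b\<in>UNIV. f l b * f' k b))"
      by (subst sum.swap) (simp add: sum_distrib_left)
    also have "\<dots> = (\<Sum>l\<in>I. if l = k then c (f k) * g k else 0)"
      by (rule sum.cong) (auto simp: bi k)
    also have "\<dots> = c (f k) * g k" using k fin by simp
    finally show "c x = 0" using g k by auto
  qed (use fin in simp)
qed

text \<open>For matrix entries of irreducibles this becomes the bound of the sum of squared degrees
  by the rank.\<close>

lemma biorthogonal_card_le:
  fixes f f' :: "'i \<Rightarrow> 'n::finite \<Rightarrow> complex"
  assumes fin: "finite I"
    and bi: "\<And>k l. k \<in> I \<Longrightarrow> l \<in> I \<Longrightarrow> (\<Sum>b\<in>UNIV. f k b * f' l b) = (if k = l then g k else 0)"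
    and g: "\<And>k. k \<in> I \<Longrightarrow> g k \<noteq> 0"
  shows "card I \<le> CARD('n)"
proof -
  have "card (f ` I) \<le> fv.dim (UNIV :: ('n \<Rightarrow> complex) set)"
    by (rule fv.independent_card_le_dim[OF subset_UNIV biorthogonal_independent(1)[OF assms]])
  then show ?thesis
    using biorthogonal_independent(2)[OF assms] by (simp add: card_image inj_delta)
qed

text \<open>With as many members as dimensions, the \<open>f k\<close> span the space; the pairings
  with the \<open>f' k\<close> then recover every coefficient of \<open>x\<close>.\<close>

lemma biorthogonal_complete:
  fixes f f' :: "'i \<Rightarrow> 'n::finite \<Rightarrow> complex"
  assumes fin: "finite I"
    and bi: "\<And>k l. k \<in> I \<Longrightarrow> l \<in> I \<Longrightarrow> (\<Sum>b\<in>UNIV. f k b * f' l b) = (if k = l then g k else 0)"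
    and g: "\<And>k. k \<in> I \<Longrightarrow> g k \<noteq> 0"
    and c: "card I = CARD('n)"
    and x: "\<And>k. k \<in> I \<Longrightarrow> (\<Sum>b\<in>UNIV. x b * f' k b) = 0"
  shows "x = 0"
proof (rule ccontr)
  assume "x \<noteq> 0"
  then obtain b0 where b0: "x b0 \<noteq> 0" by (auto simp: fun_eq_iff)
  note ind = biorthogonal_independent[OF fin bi g]
  have "x \<in> fv.span (f ` I)"
  proof -
    have "UNIV \<subseteq> fv.span (f ` I)"
      using ind c by (subst fv.card_eq_dim[symmetric]) (auto simp: card_image inj_delta fin)
    then show ?thesis by auto
  qed
  then obtain c where c: "x = (\<Sum>v\<in>f ` I. fscale (c v) v)"
    using fv.span_finite[of "f ` I"] fin by auto
  have ck: "c (f k) = 0" if k: "k \<in> I" for k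
  proof -
    have "0 = (\<Sum>b\<in>UNIV. x b * f' k b)" by (simp add: x k)
    also have "\<dots> = (\<Sum>b\<in>UNIV. \<Sum>l\<in>I. c (f l) * (f l b * f' k b))"
      by (subst c) (simp add: sum.reindex[OF ind(2)] o_def sum_fun_apply sum_distrib_right mult.assoc)
    also have "\<dots> = (\<Sum>l\<in>I. c (f l) * (\<Sum>b\<in>UNIV. f l b * f' k b))"
      by (subst sum.swap) (simp add: sum_distrib_left)
    also have "\<dots> = (\<Sum>l\<in>I. if l = k then c (f k) * g k else 0)"
      by (rule sum.cong) (auto simp: bi k)
    also have "\<dots> = c (f k) * g k" using k fin by simp
    finally show ?thesis using g k by auto
  qed
  have "x = 0" by (rule ext, subst c) (auto intro!: sum.neutral simp: ck sum_fun_apply)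
  then show False using b0 by simp
qed

lemma kernel_nonzero:
  fixes l :: "'i \<Rightarrow> 'n::finite \<Rightarrow> complex"
  assumes fin: "finite I" and card: "card I < CARD('n)"
  obtains x where "x \<noteq> 0" "\<And>k. k \<in> I \<Longrightarrow> (\<Sum>b\<in>UNIV. x b * l k b) = 0"
proof -
  obtain e :: "'i \<Rightarrow> 'n" where e: "inj_on e I"
    using card_le_inj[of I "UNIV :: 'n set"] fin card by auto
  have "e ` I \<noteq> UNIV" using card by (metis card_image e less_irrefl)
  then obtain j0 where j0: "j0 \<notin> e ` I" by auto
  \<comment> \<open>The functionals are placed on the coordinates in the image of \<open>e\<close>,
    which turns them into an endomorphism. The free coordinate \<open>j0\<close> shows that it is
    not surjective, hence not injective.\<close>
  define T where "T = (\<lambda>(x::'n \<Rightarrow> complex) j. if j \<in> e ` I then \<Sum>b\<in>UNIV. x b * l (inv_into I e j) b else 0)"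
  have lin: "Vector_Spaces.linear fscale fscale T"
  proof unfold_locales
    show "T (a + b) = T a + T b" for a b
      by (auto simp: T_def fun_eq_iff algebra_simps sum.distrib)
    show "T (fscale r b) = fscale r (T b)" for r b
      by (auto simp: T_def fun_eq_iff algebra_simps sum_distrib_left)
  qed
  have "\<not> surj T"
  proof
    assume "surj T"
    then obtain x where "delta j0 = T x" by (metis surjD)
    then have "delta j0 j0 = T x j0" by simp
    then show False using j0 by (simp add: T_def delta_apply)
  qed
  then have "\<not> inj T" using fv.linear_inj_imp_surj[OF lin] by blast
  then obtain a b where ab: "a \<noteq> b" "T a = T b" by (auto simp: inj_def)
  define x where "x = a - b"
  have Tx: "T x = 0"
  proof -
    have "T x = T a - T b"
      by (auto simp: T_def x_def fun_eq_iff algebra_simps sum_subtractf)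
    then show ?thesis by (simp add: ab)
  qed
  show ?thesis
  proof (rule that)
    show "x \<noteq> 0" using ab by (simp add: x_def)
    fix k assume k: "k \<in> I"
    have "T x (e k) = 0" by (simp add: Tx)
    then show "(\<Sum>b\<in>UNIV. x b * l k b) = 0" using k e by (simp add: T_def)
  qed
qed

section \<open>Fusion data\<close>

text \<open>A fusion ring reduced to its structure constants, with \<open>N i j k\<close> the
  coefficient of the k-th basis element in the product of the i-th and the j-th. Indexing by a
  finite type lets all sums range over \<open>UNIV\<close>. \<open>N_dual\<close> expresses that
  duality is an anti-automorphism.\<close>

locale fusion_data =
  fixes N :: "'n::finite \<Rightarrow> 'n \<Rightarrow> 'n \<Rightarrow> int" and dual :: "'n \<Rightarrow> 'n" and u :: 'n
  assumes N_nonneg: "0 \<le> N i j k"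
    and N_unit_left: "N u j k = of_bool (j = k)"
    and N_unit_right: "N j u k = of_bool (j = k)"
    and N_assoc: "(\<Sum>m\<in>UNIV. N i j m * N m k l) = (\<Sum>m\<in>UNIV. N j k m * N i m l)"
    and dual_dual [simp]: "dual (dual i) = i"
    and N_dual: "N (dual j) (dual i) (dual k) = N i j k"
    and N_unit: "N i (dual j) u = of_bool (i = j)"
begin

lemma dual_eq_iff [simp]: "dual i = dual j \<longleftrightarrow> i = j"
  by (metis dual_dual)

lemma bij_dual: "bij dual"
  by (rule involuntory_imp_bij) simp

lemma sum_dual: "(\<Sum>b\<in>UNIV. f (dual b)) = (\<Sum>b\<in>UNIV. f b)"
  by (rule sum.reindex_bij_betw[OF bij_dual])

lemma dual_unit [simp]: "dual u = u"
  using N_unit[of u u] N_unit_left[of "dual u" u] by (simp split: if_splits)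

lemma N_unit': "N i j u = of_bool (i = dual j)"
  using N_unit[of i "dual j"] by simp

text \<open>Frobenius reciprocity: compare the coefficients of the unit in the two bracketings of
  \<open>i\<close>, \<open>j\<close>, \<open>dual k\<close>.\<close>

lemma N_rotate: "N i j k = N j (dual k) (dual i)"
proof -
  have "(\<Sum>m\<in>UNIV. N i j m * N m (dual k) u) = N i j k"
    by (simp add: N_unit of_bool_def if_distrib[of "(*) _"] cong: if_cong)
  moreover have "(\<Sum>m\<in>UNIV. N j (dual k) m * N i m u) = (\<Sum>m\<in>UNIV. if m = dual i then N j (dual k) m else 0)"
    by (rule sum.cong) (auto simp: N_unit')
  ultimately show ?thesis using N_assoc[of i j "dual k" u] by simp
qed

lemma N_rotate2: "N i j k = N (dual k) i (dual j)"
  using N_rotate[of i j k] N_rotate[of j "dual k" "dual i"] by simp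

lemma N_frob_left: "N i j k = N (dual i) k j"
  using N_rotate2[of i j k] N_dual[of i "dual k" "dual j"] by simp

lemma N_frob_right: "N i j k = N k (dual j) i"
  using N_rotate[of i j k] N_dual[of "dual j" k i] by simp

section \<open>The regular module and its inner product\<close>

definition act :: "'n \<Rightarrow> ('n \<Rightarrow> complex) \<Rightarrow> 'n \<Rightarrow> complex" where
  "act b x = (\<lambda>k. \<Sum>j\<in>UNIV. of_int (N b j k) * x j)"

lemma act_unit: "act u x = x"
  by (simp add: act_def N_unit_left fun_eq_iff of_bool_def if_distrib[of "\<lambda>x. x * _"] if_distrib[of of_int] cong: if_cong)

lemma act_comb:
  "act b (\<lambda>k. \<Sum>i\<in>I. c i * w i k) = (\<lambda>k. \<Sum>i\<in>I. c i * act b (w i) k)"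
proof
  fix k
  have "act b (\<lambda>k. \<Sum>i\<in>I. c i * w i k) k = (\<Sum>j\<in>UNIV. \<Sum>i\<in>I. c i * (of_int (N b j k) * w i j))"
    by (simp add: act_def sum_distrib_left algebra_simps)
  also have "\<dots> = (\<Sum>i\<in>I. c i * act b (w i) k)"
    by (subst sum.swap) (simp add: act_def sum_distrib_left)
  finally show "act b (\<lambda>k. \<Sum>i\<in>I. c i * w i k) k = (\<Sum>i\<in>I. c i * act b (w i) k)" .
qed

lemma act_act: "act a (act b x) = (\<lambda>k. \<Sum>m\<in>UNIV. of_int (N a b m) * act m x k)"
proof
  fix k
  have "act a (act b x) k = (\<Sum>l\<in>UNIV. \<Sum>j\<in>UNIV. of_int (N b j l * N a l k) * x j)"
    by (simp add: act_def sum_distrib_left algebra_simps)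
  also have "\<dots> = (\<Sum>j\<in>UNIV. of_int (\<Sum>l\<in>UNIV. N b j l * N a l k) * x j)"
    by (subst sum.swap) (simp add: sum_distrib_right)
  also have "\<dots> = (\<Sum>j\<in>UNIV. of_int (\<Sum>m\<in>UNIV. N a b m * N m j k) * x j)"
    by (simp only: N_assoc)
  also have "\<dots> = (\<Sum>j\<in>UNIV. \<Sum>m\<in>UNIV. of_int (N a b m) * (of_int (N m j k) * x j))"
    by (simp add: sum_distrib_right sum_distrib_left algebra_simps)
  also have "\<dots> = (\<Sum>m\<in>UNIV. of_int (N a b m) * act m x k)"
    by (subst sum.swap) (simp add: act_def sum_distrib_left)
  finally show "act a (act b x) k = (\<Sum>m\<in>UNIV. of_int (N a b m) * act m x k)" .
qed

definition ip :: "('n \<Rightarrow> complex) \<Rightarrow> ('n \<Rightarrow> complex) \<Rightarrow> complex" where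
  "ip x y = (\<Sum>k\<in>UNIV. x k * cnj (y k))"

text \<open>By reciprocity the matrix of \<open>dual b\<close> is the transpose of the integral
  matrix of \<open>b\<close>, so the two are adjoint.\<close>

lemma ip_act: "ip (act b x) y = ip x (act (dual b) y)"
proof -
  have "ip (act b x) y = (\<Sum>k\<in>UNIV. \<Sum>j\<in>UNIV. of_int (N b j k) * (x j * cnj (y k)))"
    by (simp add: ip_def act_def sum_distrib_right mult.assoc)
  also have "\<dots> = (\<Sum>j\<in>UNIV. \<Sum>k\<in>UNIV. of_int (N (dual b) k j) * (x j * cnj (y k)))"
    by (subst sum.swap) (simp only: N_frob_left[of b])
  also have "\<dots> = ip x (act (dual b) y)"
    by (simp add: ip_def act_def sum_distrib_left algebra_simps)
  finally show ?thesis .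
qed

lemma ip_self: "ip x x = of_real (\<Sum>k\<in>UNIV. (cmod (x k))\<^sup>2)"
  by (simp add: ip_def complex_norm_square flip: of_real_power)

text \<open>Matrices are functions of two natural numbers, read only below the degree
  \<open>n\<close>; this keeps the degree out of the types.\<close>

definition rep :: "nat \<Rightarrow> ('n \<Rightarrow> nat \<Rightarrow> nat \<Rightarrow> complex) \<Rightarrow> bool" where
  "rep n \<rho> \<longleftrightarrow> (\<forall>i<n. \<forall>j<n. \<rho> u i j = of_bool (i = j)) \<and>
     (\<forall>a b. \<forall>i<n. \<forall>j<n. (\<Sum>m<n. \<rho> a i m * \<rho> b m j) = (\<Sum>c\<in>UNIV. of_int (N a b c) * \<rho> c i j))"

text \<open>Schur relations within one irreducible. The constant \<open>g\<close> is its formal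
  codegree: putting \<open>j = k\<close> and summing over \<open>j\<close> shows that Z acts as n
  times \<open>g\<close>.\<close>

definition biorth :: "nat \<Rightarrow> ('n \<Rightarrow> nat \<Rightarrow> nat \<Rightarrow> complex) \<Rightarrow> complex \<Rightarrow> bool" where
  "biorth n \<rho> g \<longleftrightarrow> (\<forall>i<n. \<forall>j<n. \<forall>k<n. \<forall>l<n.
     (\<Sum>b\<in>UNIV. \<rho> b i j * \<rho> (dual b) k l) = (if i = l \<and> j = k then g else 0))"

definition orth :: "nat \<Rightarrow> ('n \<Rightarrow> nat \<Rightarrow> nat \<Rightarrow> complex) \<Rightarrow> nat \<Rightarrow> ('n \<Rightarrow> nat \<Rightarrow> nat \<Rightarrow> complex) \<Rightarrow> bool" where
  "orth n \<rho> m \<sigma> \<longleftrightarrow> (\<forall>i<n. \<forall>j<n. \<forall>k<m. \<forall>l<m. (\<Sum>b\<in>UNIV. \<rho> b i j * \<sigma> (dual b) k l) = 0)"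

lemma rep_unit: "rep n \<rho> \<Longrightarrow> i < n \<Longrightarrow> j < n \<Longrightarrow> \<rho> u i j = of_bool (i = j)"
  by (simp add: rep_def)

lemma rep_mult: "rep n \<rho> \<Longrightarrow> i < n \<Longrightarrow> j < n \<Longrightarrow>
    (\<Sum>m<n. \<rho> a i m * \<rho> b m j) = (\<Sum>c\<in>UNIV. of_int (N a b c) * \<rho> c i j)"
  by (simp add: rep_def)

lemma orth_sym: "orth n \<rho> m \<sigma> \<Longrightarrow> orth m \<sigma> n \<rho>"
  unfolding orth_def
proof (intro allI impI)
  fix i j k l assume o: "\<forall>i<n. \<forall>j<n. \<forall>k<m. \<forall>l<m. (\<Sum>b\<in>UNIV. \<rho> b i j * \<sigma> (dual b) k l) = 0"
    and "i < m" "j < m" "k < n" "l < n"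
  then have "(\<Sum>b\<in>UNIV. \<rho> b k l * \<sigma> (dual b) i j) = 0" by blast
  then show "(\<Sum>b\<in>UNIV. \<sigma> b i j * \<rho> (dual b) k l) = 0"
    by (subst sum_dual[symmetric]) (simp add: mult.commute)
qed

text \<open>\<open>T\<close> is the average of a matrix unit: the sum over \<open>b\<close> of
  \<rho>(b) E \<sigma>(dual b), with E the unit at position (j, k). It intertwines because
  multiplying by \<open>a\<close> can be shifted from \<open>b\<close> to \<open>dual b\<close>,
  which is \<open>N_rotate2\<close>.\<close>

lemma intertwine:
  assumes \<rho>: "rep n \<rho>" and \<sigma>: "rep m \<sigma>" and ij: "i < n" "j < n" and kl: "k < m" "l < m"
  defines "T \<equiv> \<lambda>p q. \<Sum>b\<in>UNIV. \<rho> b p j * \<sigma> (dual b) k q"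
  shows "(\<Sum>p<n. \<rho> a i p * T p l) = (\<Sum>p<m. T i p * \<sigma> a p l)"
proof -
  have "(\<Sum>p<n. \<rho> a i p * T p l) = (\<Sum>p<n. \<Sum>b\<in>UNIV. \<rho> a i p * \<rho> b p j * \<sigma> (dual b) k l)"
    by (simp add: T_def sum_distrib_left mult.assoc)
  also have "\<dots> = (\<Sum>b\<in>UNIV. (\<Sum>p<n. \<rho> a i p * \<rho> b p j) * \<sigma> (dual b) k l)"
    by (subst sum.swap) (simp add: sum_distrib_right)
  also have "\<dots> = (\<Sum>b\<in>UNIV. \<Sum>c\<in>UNIV. of_int (N a b c) * \<rho> c i j * \<sigma> (dual b) k l)"
    using rep_mult[OF \<rho> ij] by (simp add: sum_distrib_right)
  also have "\<dots> = (\<Sum>c\<in>UNIV. \<Sum>b\<in>UNIV. \<rho> c i j * (of_int (N (dual c) a (dual b)) * \<sigma> (dual b) k l))"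
    by (subst sum.swap) (simp add: N_rotate2[of a] algebra_simps)
  also have "\<dots> = (\<Sum>c\<in>UNIV. \<rho> c i j * (\<Sum>e\<in>UNIV. of_int (N (dual c) a e) * \<sigma> e k l))"
    using sum_dual[of "\<lambda>e. of_int (N (dual _) a e) * \<sigma> e k l"] by (simp flip: sum_distrib_left)
  also have "\<dots> = (\<Sum>c\<in>UNIV. \<Sum>p<m. \<rho> c i j * \<sigma> (dual c) k p * \<sigma> a p l)"
    using rep_mult[OF \<sigma> kl, symmetric] by (simp add: sum_distrib_left mult.assoc)
  also have "\<dots> = (\<Sum>p<m. T i p * \<sigma> a p l)"
    by (subst sum.swap) (simp add: T_def sum_distrib_right)
  finally show ?thesis .
qed

text \<open>\<open>Z = \<Sum>b b\<^sup>*\<close> is positive definite on the regular module, which replaces the usual appeal to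
  semisimplicity.\<close>

lemma casimir_positive:
  assumes "x \<noteq> 0" "(\<lambda>k. \<Sum>b\<in>UNIV. act b (act (dual b) x) k) = fscale c x"
  shows "c \<noteq> 0"
proof
  assume "c = 0"
  then have "0 = ip (\<lambda>k. \<Sum>b\<in>UNIV. act b (act (dual b) x) k) x"
    using assms(2) by (simp add: ip_def)
  also have "\<dots> = (\<Sum>b\<in>UNIV. ip (act b (act (dual b) x)) x)"
    unfolding ip_def sum_distrib_right by (rule sum.swap)
  also have "\<dots> = (\<Sum>b\<in>UNIV. ip (act (dual b) x) (act (dual b) x))"
    by (simp add: ip_act)
  also have "\<dots> = (\<Sum>b\<in>UNIV. ip (act b x) (act b x))"
    by (rule sum_dual)
  also have "\<dots> = of_real (\<Sum>b\<in>UNIV. \<Sum>k\<in>UNIV. (cmod (act b x k))\<^sup>2)"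
    by (simp add: ip_self)
  finally have "complex_of_real (\<Sum>b\<in>UNIV. \<Sum>k\<in>UNIV. (cmod (act b x k))\<^sup>2) = 0"
    by (rule sym)
  then have "(\<Sum>b\<in>UNIV. \<Sum>k\<in>UNIV. (cmod (act b x k))\<^sup>2) = 0"
    by (simp only: of_real_eq_0_iff)
  \<comment> \<open>A vanishing sum of squares has vanishing summands; the one of the unit is the
    squared norm of \<open>x\<close> itself.\<close>
  then have "(\<Sum>k\<in>UNIV. (cmod (act u x k))\<^sup>2) = 0"
    by (subst (asm) sum_nonneg_eq_0_iff) (auto intro: sum_nonneg)
  then have "x = 0" by (subst (asm) sum_nonneg_eq_0_iff) (auto simp: act_unit fun_eq_iff)
  then show False using assms(1) by simp
qed

section \<open>Irreducible constituents of the regular module\<close>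

definition invariant :: "('n \<Rightarrow> complex) set \<Rightarrow> bool" where
  "invariant M \<longleftrightarrow> fv.subspace M \<and> (\<forall>b. \<forall>x\<in>M. act b x \<in> M)"

definition submodule :: "('n \<Rightarrow> complex) set \<Rightarrow> nat \<Rightarrow> ('n \<Rightarrow> nat \<Rightarrow> nat \<Rightarrow> complex) \<Rightarrow>
    (nat \<Rightarrow> 'n \<Rightarrow> complex) \<Rightarrow> bool" where
  "submodule M n \<rho> w \<longleftrightarrow> (\<forall>j<n. w j \<in> M \<and> w j \<noteq> 0) \<and>
     (\<forall>b. \<forall>j<n. act b (w j) = (\<lambda>k. \<Sum>i<n. \<rho> b i j * w i k)) \<and>
     (\<forall>c. (\<lambda>k. \<Sum>i<n. c i * w i k) = 0 \<longrightarrow> (\<forall>i<n. c i = 0))"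

text \<open>A nonzero invariant subspace of least dimension inside \<open>M\<close> is irreducible.
  Schur's lemma then makes every averaged matrix unit a scalar matrix, which gives the relations
  \<open>biorth\<close>, and positivity of Z makes the constant nonzero.\<close>

lemma irreducible_in:
  assumes M: "invariant M" and x0: "x0 \<in> M" "x0 \<noteq> 0"
  obtains n \<rho> w g where "0 < n" "rep n \<rho>" "biorth n \<rho> g" "g \<noteq> 0" "submodule M n \<rho> w"
proof -
  define P where "P W \<longleftrightarrow> invariant W \<and> W \<subseteq> M \<and> W \<noteq> {0}" for W
  have "P M" using M x0 by (auto simp: P_def)
  then obtain W where W: "P W" and least: "\<And>V. P V \<Longrightarrow> fv.dim W \<le> fv.dim V"
    using ex_has_least_nat[of P M fv.dim] by blast
  have subW: "fv.subspace W" and invW: "\<And>b x. x \<in> W \<Longrightarrow> act b x \<in> W" and WM: "W \<subseteq> M" and W0: "W \<noteq> {0}"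
    using W by (auto simp: P_def invariant_def)
  have minimal: "V = W" if V: "invariant V" "V \<subseteq> W" "x \<in> V" "x \<noteq> 0" for V x
  proof -
    have "P V" using V WM by (auto simp: P_def)
    then show ?thesis
      using least[of V] V subW by (intro fv.subspace_dim_equal) (auto simp: invariant_def)
  qed
  obtain B where B: "B \<subseteq> W" "fv.independent B" "W \<subseteq> fv.span B" "card B = fv.dim W"
    using fv.basis_exists[of W] by blast
  have finB: "finite B" using B(2) by (rule fv.finiteI_independent)
  have spanB: "fv.span B = W"
    using B subW by (simp add: fv.span_subspace)
  define n where "n = card B"
  obtain w where "bij_betw w {0..<n} B"
    using ex_bij_betw_nat_finite[OF finB] unfolding n_def by blast
  then have w: "inj_on w {..<n}" "w ` {..<n} = B"
    by (auto simp: bij_betw_def lessThan_atLeast0)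
  have wW: "w j \<in> W" if "j < n" for j using that w(2) B(1) by blast
  have w0: "w j \<noteq> 0" if "j < n" for j
  proof
    assume "w j = 0"
    then have "0 \<in> B" using that w(2) by (metis image_eqI lessThan_iff)
    then show False using fv.dependent_zero B(2) by blast
  qed
  have indep: "\<forall>i<n. c i = 0" if c: "(\<lambda>k. \<Sum>i<n. c i * w i k) = 0" for c
  proof (intro allI impI)
    fix i assume i: "i < n"
    define c' where "c' = c \<circ> the_inv_into {..<n} w"
    have c': "c' (w i) = c i" if "i < n" for i
      using that w(1) by (simp add: c'_def the_inv_into_f_f)
    have "(\<Sum>v\<in>B. fscale (c' v) v) = (\<Sum>i<n. fscale (c i) (w i))"
      unfolding w(2)[symmetric] by (subst sum.reindex[OF w(1)]) (simp add: c')
    also have "\<dots> = 0"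
      using c by (simp add: fun_eq_iff sum_fun_apply)
    finally have "c' (w i) = 0"
      using B(2) finB i w(2) by (intro fv.independentD[of B B c']) auto
    then show "c i = 0" using i by (simp add: c')
  qed
  have comb: "\<exists>c. v = (\<lambda>k. \<Sum>i<n. c i * w i k)" if "v \<in> W" for v
  proof -
    have "v \<in> fv.span B" using that spanB by simp
    then obtain c where "v = (\<Sum>x\<in>B. fscale (c x) x)"
      using fv.span_finite[OF finB] by auto
    then have "v = (\<Sum>i<n. fscale (c (w i)) (w i))"
      unfolding w(2)[symmetric] by (simp add: sum.reindex[OF w(1)])
    then show ?thesis by (intro exI[of _ "\<lambda>i. c (w i)"]) (simp add: fun_eq_iff sum_fun_apply)
  qed
  have combW: "(\<lambda>k. \<Sum>i<n. c i * w i k) \<in> W" for c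
  proof -
    have "(\<Sum>i<n. fscale (c i) (w i)) \<in> W"
      by (intro fv.subspace_sum[OF subW] fv.subspace_scale[OF subW]) (simp add: wW)
    also have "(\<Sum>i<n. fscale (c i) (w i)) = (\<lambda>k. \<Sum>i<n. c i * w i k)"
      by (simp add: fun_eq_iff sum_fun_apply)
    finally show ?thesis .
  qed
  have uniq: "\<forall>i<n. c i = c' i" if "(\<lambda>k. \<Sum>i<n. c i * w i k) = (\<lambda>k. \<Sum>i<n. c' i * w i k)" for c c'
  proof -
    have "(\<lambda>k. \<Sum>i<n. (c i - c' i) * w i k) = 0"
      using that by (simp add: fun_eq_iff algebra_simps sum_subtractf)
    from indep[OF this] show ?thesis by simp
  qed
  have n: "0 < n"
  proof (rule ccontr)
    assume "\<not> 0 < n"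
    then have "B = {}" using finB by (simp add: n_def)
    then have "W = {0}" using spanB by simp
    then show False using W0 by simp
  qed
  define \<rho> where "\<rho> b i j = (SOME c. act b (w j) = (\<lambda>k. \<Sum>i<n. c i * w i k)) i" for b i j
  have \<rho>: "act b (w j) = (\<lambda>k. \<Sum>i<n. \<rho> b i j * w i k)" if "j < n" for b j
    unfolding \<rho>_def by (rule someI_ex[OF comb[OF invW[OF wW[OF that]]]])
  have act_c: "act b (\<lambda>k. \<Sum>j<n. c j * w j k) = (\<lambda>k. \<Sum>i<n. (\<Sum>j<n. \<rho> b i j * c j) * w i k)" for b c
  proof
    fix k
    have "act b (\<lambda>k. \<Sum>j<n. c j * w j k) k = (\<Sum>j<n. \<Sum>i<n. \<rho> b i j * c j * w i k)"
      by (simp add: act_comb \<rho> sum_distrib_left algebra_simps)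
    also have "\<dots> = (\<Sum>i<n. (\<Sum>j<n. \<rho> b i j * c j) * w i k)"
      by (subst sum.swap) (simp add: sum_distrib_right)
    finally show "act b (\<lambda>k. \<Sum>j<n. c j * w j k) k = (\<Sum>i<n. (\<Sum>j<n. \<rho> b i j * c j) * w i k)" .
  qed
  have rep: "rep n \<rho>"
    unfolding rep_def
  proof (intro conjI allI impI)
    fix i j assume ij: "i < n" "j < n"
    have "(\<lambda>k. \<Sum>i<n. \<rho> u i j * w i k) = (\<lambda>k. \<Sum>i<n. of_bool (i = j) * w i k)"
      using \<rho>[OF ij(2), of u, symmetric] ij
      by (simp add: act_unit fun_eq_iff of_bool_def if_distrib[of "\<lambda>x. x * _"] cong: if_cong)
    from uniq[OF this] ij show "\<rho> u i j = of_bool (i = j)" by simp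
  next
    fix a b i j assume ij: "i < n" "j < n"
    have "(\<lambda>k. \<Sum>i<n. (\<Sum>m<n. \<rho> a i m * \<rho> b m j) * w i k) = act a (act b (w j))"
      by (simp add: \<rho>[OF ij(2), of b] act_c)
    also have "\<dots> = (\<lambda>k. \<Sum>i<n. (\<Sum>c\<in>UNIV. of_int (N a b c) * \<rho> c i j) * w i k)"
      unfolding act_act
    proof
      fix k
      have "(\<Sum>m\<in>UNIV. of_int (N a b m) * act m (w j) k) = (\<Sum>m\<in>UNIV. \<Sum>i<n. of_int (N a b m) * \<rho> m i j * w i k)"
        by (simp add: \<rho>[OF ij(2)] sum_distrib_left mult.assoc)
      also have "\<dots> = (\<Sum>i<n. (\<Sum>c\<in>UNIV. of_int (N a b c) * \<rho> c i j) * w i k)"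
        by (subst sum.swap) (simp add: sum_distrib_right)
      finally show "(\<Sum>m\<in>UNIV. of_int (N a b m) * act m (w j) k) = (\<Sum>i<n. (\<Sum>c\<in>UNIV. of_int (N a b c) * \<rho> c i j) * w i k)" .
    qed
    finally have "\<forall>i<n. (\<Sum>m<n. \<rho> a i m * \<rho> b m j) = (\<Sum>c\<in>UNIV. of_int (N a b c) * \<rho> c i j)"
      by (rule uniq)
    then show "(\<Sum>m<n. \<rho> a i m * \<rho> b m j) = (\<Sum>c\<in>UNIV. of_int (N a b c) * \<rho> c i j)"
      using ij by simp
  qed
  \<comment> \<open>Schur's lemma for the averages \<open>T\<close>. The complex field enters here
    through the existence of an eigenvalue.\<close>
  have schur: "\<exists>s. \<forall>i<n. \<forall>l<n. (\<Sum>b\<in>UNIV. \<rho> b i j * \<rho> (dual b) k l) = (if i = l then s else 0)"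
    if jk: "j < n" "k < n" for j k
  proof -
    define T where "T i l = (\<Sum>b\<in>UNIV. \<rho> b i j * \<rho> (dual b) k l)" for i l
    have T: "(\<Sum>p<n. \<rho> a i p * T p l) = (\<Sum>p<n. T i p * \<rho> a p l)" if "i < n" "l < n" for a i l
      using intertwine[OF rep rep that(1) jk that(2)] by (simp add: T_def)
    have "spectrum (mat n n (\<lambda>(i, l). T i l)) \<noteq> {}"
      by (rule spectrum_non_empty[OF _ n]) simp
    then obtain s where "eigenvalue (mat n n (\<lambda>(i, l). T i l)) s" by (auto simp: spectrum_def)
    then obtain v where v: "v \<in> carrier_vec n" "v \<noteq> 0\<^sub>v n" "mat n n (\<lambda>(i, l). T i l) *\<^sub>v v = s \<cdot>\<^sub>v v"
      by (auto simp: eigenvalue_def eigenvector_def)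
    have ev: "(\<Sum>l<n. T i l * v $ l) = s * v $ i" if "i < n" for i
      using arg_cong[OF v(3), of "\<lambda>x. x $ i"] that v(1)
      by (simp add: mult_mat_vec_def scalar_prod_def lessThan_atLeast0)
    \<comment> \<open>The eigenspace of \<open>T\<close>, transported to the regular module along
      \<open>w\<close>. It is invariant since \<open>T\<close> commutes with \<rho>, hence equal to
      \<open>W\<close> by minimality.\<close>
    define V where "V = {x. \<exists>c. x = (\<lambda>k. \<Sum>i<n. c i * w i k) \<and> (\<forall>i<n. (\<Sum>l<n. T i l * c l) = s * c i)}"
    have "V = W"
    proof (rule minimal)
      show "invariant V"
        unfolding invariant_def
      proof (intro conjI allI ballI)
        show "fv.subspace V"
        proof (rule fv.subspaceI)
          show "0 \<in> V" unfolding V_def by (intro CollectI exI[of _ "\<lambda>_. 0"]) (simp add: fun_eq_iff)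
        next
          fix x y assume "x \<in> V" "y \<in> V"
          then obtain c c' where c: "x = (\<lambda>k. \<Sum>i<n. c i * w i k)" "\<forall>i<n. (\<Sum>l<n. T i l * c l) = s * c i"
            and c': "y = (\<lambda>k. \<Sum>i<n. c' i * w i k)" "\<forall>i<n. (\<Sum>l<n. T i l * c' l) = s * c' i"
            by (auto simp: V_def)
          show "x + y \<in> V" unfolding V_def
            by (intro CollectI exI[of _ "\<lambda>i. c i + c' i"])
              (use c c' in \<open>simp add: fun_eq_iff algebra_simps sum.distrib\<close>)
        next
          fix r x assume "x \<in> V"
          then obtain c where c: "x = (\<lambda>k. \<Sum>i<n. c i * w i k)" "\<forall>i<n. (\<Sum>l<n. T i l * c l) = s * c i"
            by (auto simp: V_def)
          have "(\<Sum>l<n. T i l * (r * c l)) = s * (r * c i)" if "i < n" for i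
          proof -
            have "(\<Sum>l<n. T i l * (r * c l)) = r * (\<Sum>l<n. T i l * c l)"
              by (simp add: sum_distrib_left algebra_simps)
            then show ?thesis using c(2) that by simp
          qed
          then show "fscale r x \<in> V" unfolding V_def
            by (intro CollectI exI[of _ "\<lambda>i. r * c i"])
              (use c in \<open>simp add: fun_eq_iff sum_distrib_left algebra_simps\<close>)
        qed
      next
        fix a x assume "x \<in> V"
        then obtain c where c: "x = (\<lambda>k. \<Sum>i<n. c i * w i k)" "\<forall>i<n. (\<Sum>l<n. T i l * c l) = s * c i"
          by (auto simp: V_def)
        have "(\<Sum>l<n. T i l * (\<Sum>j<n. \<rho> a l j * c j)) = s * (\<Sum>j<n. \<rho> a i j * c j)" if i: "i < n" for i
        proof -
          have "(\<Sum>l<n. T i l * (\<Sum>j<n. \<rho> a l j * c j)) = (\<Sum>j<n. (\<Sum>l<n. T i l * \<rho> a l j) * c j)"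
            unfolding sum_distrib_left sum_distrib_right mult.assoc by (rule sum.swap)
          also have "\<dots> = (\<Sum>j<n. (\<Sum>l<n. \<rho> a i l * T l j) * c j)"
            using T[OF i] by (intro sum.cong) auto
          also have "\<dots> = (\<Sum>l<n. \<rho> a i l * (\<Sum>j<n. T l j * c j))"
            unfolding sum_distrib_left sum_distrib_right mult.assoc by (rule sum.swap)
          also have "\<dots> = (\<Sum>l<n. \<rho> a i l * (s * c l))"
            using c(2) by simp
          finally show ?thesis by (simp add: sum_distrib_left algebra_simps)
        qed
        then show "act a x \<in> V"
          unfolding V_def c(1) act_c by (intro CollectI exI[of _ "\<lambda>i. \<Sum>j<n. \<rho> a i j * c j"]) simp
      qed
      show "V \<subseteq> W" by (auto simp: V_def combW)
      show "(\<lambda>k. \<Sum>i<n. v $ i * w i k) \<in> V"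
        unfolding V_def by (intro CollectI exI[of _ "\<lambda>i. v $ i"]) (simp add: ev)
      show "(\<lambda>k. \<Sum>i<n. v $ i * w i k) \<noteq> 0"
      proof
        assume "(\<lambda>k. \<Sum>i<n. v $ i * w i k) = 0"
        from indep[OF this] v(1) have "v = 0\<^sub>v n" by (intro eq_vecI) auto
        then show False using v(2) by simp
      qed
    qed
    have "T i l = (if i = l then s else 0)" if il: "i < n" "l < n" for i l
    proof -
      have "w l \<in> V" using wW[OF il(2)] \<open>V = W\<close> by simp
      then obtain c where c: "w l = (\<lambda>k. \<Sum>i<n. c i * w i k)" "\<forall>i<n. (\<Sum>l<n. T i l * c l) = s * c i"
        by (auto simp: V_def)
      have "w l = (\<lambda>k. \<Sum>i<n. of_bool (i = l) * w i k)"
        using il by (simp add: fun_eq_iff of_bool_def if_distrib[of "\<lambda>x. x * _"] cong: if_cong)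
      from trans[OF c(1)[symmetric] this] have cl: "\<forall>i<n. c i = of_bool (i = l)"
        by (rule uniq)
      have "(\<Sum>l'<n. T i l' * c l') = (\<Sum>l'<n. if l' = l then T i l else 0)"
        using cl by (intro sum.cong) auto
      then show ?thesis using c(2) cl il by auto
    qed
    then show ?thesis unfolding T_def by blast
  qed
  define s where "s j k = (SOME s. \<forall>i<n. \<forall>l<n. (\<Sum>b\<in>UNIV. \<rho> b i j * \<rho> (dual b) k l) = (if i = l then s else 0))" for j k
  have s: "(\<Sum>b\<in>UNIV. \<rho> b i j * \<rho> (dual b) k l) = (if i = l then s j k else 0)"
    if "i < n" "j < n" "k < n" "l < n" for i j k l
  proof -
    have "\<forall>i<n. \<forall>l<n. (\<Sum>b\<in>UNIV. \<rho> b i j * \<rho> (dual b) k l) = (if i = l then s j k else 0)"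
      unfolding s_def by (rule someI_ex[OF schur[OF that(2,3)]])
    then show ?thesis using that(1,4) by blast
  qed
  \<comment> \<open>Replacing \<open>b\<close> by \<open>dual b\<close> exchanges the two index
    pairs. This forces the scalar \<open>s j k\<close> to vanish for distinct indices and to be
    independent of \<open>j\<close> when \<open>j = k\<close>.\<close>
  have swap: "(\<Sum>b\<in>UNIV. \<rho> b i j * \<rho> (dual b) k l) = (\<Sum>b\<in>UNIV. \<rho> b k l * \<rho> (dual b) i j)" for i j k l
    by (subst sum_dual[symmetric]) (simp add: mult.commute)
  define g where "g = s 0 0"
  have s_eq: "s j k = (if j = k then g else 0)" if "j < n" "k < n" for j k
    using s[of 0 j k 0] s[of k 0 0 j] swap[of 0 j k 0] that n by (auto simp: g_def)
  have bi: "biorth n \<rho> g"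
    unfolding biorth_def using s s_eq by auto
  \<comment> \<open>Z multiplies \<open>w 0\<close> by n times \<open>g\<close>, so
    \<open>casimir_positive\<close> excludes \<open>g = 0\<close>.\<close>
  have "(\<lambda>k. \<Sum>b\<in>UNIV. act b (act (dual b) (w 0)) k) = fscale (of_nat n * g) (w 0)"
  proof
    fix k
    have "(\<Sum>b\<in>UNIV. act b (act (dual b) (w 0)) k) = (\<Sum>b\<in>UNIV. \<Sum>i<n. (\<Sum>j<n. \<rho> b i j * \<rho> (dual b) j 0) * w i k)"
      using n by (simp add: \<rho> act_c)
    also have "\<dots> = (\<Sum>i<n. (\<Sum>j<n. \<Sum>b\<in>UNIV. \<rho> b i j * \<rho> (dual b) j 0) * w i k)"
      by (subst sum.swap) (simp add: sum_distrib_right sum.swap[of _ UNIV "{..<n}"])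
    also have "\<dots> = (\<Sum>i<n. if i = 0 then of_nat n * g * w 0 k else 0)"
      using n by (intro sum.cong) (auto simp: s s_eq)
    also have "\<dots> = fscale (of_nat n * g) (w 0) k" using n by simp
    finally show "(\<Sum>b\<in>UNIV. act b (act (dual b) (w 0)) k) = fscale (of_nat n * g) (w 0) k" .
  qed
  from casimir_positive[OF w0[OF n] this] have "g \<noteq> 0" by auto
  moreover have "submodule M n \<rho> w"
    unfolding submodule_def using wW WM w0 \<rho> indep by blast
  ultimately show ?thesis using that n rep bi by blast
qed

section \<open>Orthogonal families of irreducible representations\<close>

lemma orthD: "orth n \<rho> m \<sigma> \<Longrightarrow> i < n \<Longrightarrow> j < n \<Longrightarrow> k < m \<Longrightarrow> l < m \<Longrightarrow>
    (\<Sum>b\<in>UNIV. \<rho> b i j * \<sigma> (dual b) k l) = 0"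
  by (simp add: orth_def)

lemma biorthD: "biorth n \<rho> g \<Longrightarrow> i < n \<Longrightarrow> j < n \<Longrightarrow> k < n \<Longrightarrow> l < n \<Longrightarrow>
    (\<Sum>b\<in>UNIV. \<rho> b i j * \<rho> (dual b) k l) = (if i = l \<and> j = k then g else 0)"
  by (simp add: biorth_def)

definition character :: "('n \<Rightarrow> complex) \<Rightarrow> bool" where
  "character \<psi> \<longleftrightarrow> \<psi> u = 1 \<and> (\<forall>a b. \<psi> a * \<psi> b = (\<Sum>c\<in>UNIV. of_int (N a b c) * \<psi> c))"

text \<open>Characters become representations of degree 1, so that families need only one kind of
  member.\<close>

definition rep_of :: "('n \<Rightarrow> complex) \<Rightarrow> 'n \<Rightarrow> nat \<Rightarrow> nat \<Rightarrow> complex" where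
  "rep_of \<psi> = (\<lambda>b i j. \<psi> b)"

lemma rep_of_iff: "rep 1 (rep_of \<psi>) \<longleftrightarrow> character \<psi>"
  by (simp add: rep_def rep_of_def character_def)

lemmas rep_of_iff' = rep_of_iff[unfolded One_nat_def]

lemma rep_character: "rep 1 \<rho> \<Longrightarrow> character (\<lambda>b. \<rho> b 0 0)"
  by (simp add: rep_def character_def)

lemma submodule_independent:
  assumes "submodule M n \<rho> w" "(\<lambda>k. \<Sum>i<n. c i * w i k) = 0" "i < n"
  shows "c i = 0"
proof -
  have "(\<lambda>k. \<Sum>i<n. c i * w i k) = 0 \<longrightarrow> (\<forall>i<n. c i = 0)"
    using assms(1) unfolding submodule_def by (elim conjE) (erule spec)
  then show ?thesis using assms(2,3) by simp
qed

text \<open>The annihilator of \<rho>: a vector \<open>x\<close> stands for the element with these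
  coordinates, and the displayed sums are the entries of its matrix under \<rho>.\<close>

definition kernel :: "nat \<Rightarrow> ('n \<Rightarrow> nat \<Rightarrow> nat \<Rightarrow> complex) \<Rightarrow> ('n \<Rightarrow> complex) set" where
  "kernel n \<rho> = {x. \<forall>i<n. \<forall>j<n. (\<Sum>b\<in>UNIV. x b * \<rho> b i j) = 0}"

lemma rep_act:
  assumes "rep n \<rho>" "i < n" "l < n"
  shows "(\<Sum>b\<in>UNIV. act a x b * \<rho> b i l) = (\<Sum>p<n. \<rho> a i p * (\<Sum>j\<in>UNIV. x j * \<rho> j p l))"
proof -
  have "(\<Sum>b\<in>UNIV. act a x b * \<rho> b i l) = (\<Sum>b\<in>UNIV. \<Sum>j\<in>UNIV. x j * (of_int (N a j b) * \<rho> b i l))"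
    by (simp add: act_def sum_distrib_right sum_distrib_left algebra_simps)
  also have "\<dots> = (\<Sum>j\<in>UNIV. x j * (\<Sum>b\<in>UNIV. of_int (N a j b) * \<rho> b i l))"
    by (subst sum.swap) (simp add: sum_distrib_left)
  also have "\<dots> = (\<Sum>j\<in>UNIV. \<Sum>p<n. \<rho> a i p * (x j * \<rho> j p l))"
    unfolding rep_mult[OF assms, symmetric] by (simp add: sum_distrib_left algebra_simps)
  also have "\<dots> = (\<Sum>p<n. \<rho> a i p * (\<Sum>j\<in>UNIV. x j * \<rho> j p l))"
    by (subst sum.swap) (simp add: sum_distrib_left)
  finally show ?thesis .
qed

lemma invariant_kernel:
  assumes "rep n \<rho>" shows "invariant (kernel n \<rho>)"
  unfolding invariant_def
proof (intro conjI allI ballI)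
  show "fv.subspace (kernel n \<rho>)"
  proof (rule fv.subspaceI)
    show "0 \<in> kernel n \<rho>" by (simp add: kernel_def)
    show "x + y \<in> kernel n \<rho>" if "x \<in> kernel n \<rho>" "y \<in> kernel n \<rho>" for x y
      using that by (simp add: kernel_def algebra_simps sum.distrib)
    show "fscale c x \<in> kernel n \<rho>" if "x \<in> kernel n \<rho>" for c x
    proof -
      have "(\<Sum>b\<in>UNIV. fscale c x b * \<rho> b i j) = c * (\<Sum>b\<in>UNIV. x b * \<rho> b i j)" for i j
        by (simp add: sum_distrib_left mult.assoc)
      then show ?thesis using that by (simp add: kernel_def)
    qed
  qed
  show "act b x \<in> kernel n \<rho>" if "x \<in> kernel n \<rho>" for b x
    using that by (simp add: kernel_def rep_act[OF assms])
qed

lemma invariant_Inter: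
  assumes "\<And>M. M \<in> \<M> \<Longrightarrow> invariant M" shows "invariant (\<Inter>\<M>)"
  using assms by (auto simp: invariant_def intro!: fv.subspace_Inter)

lemma invariant_Int: "invariant A \<Longrightarrow> invariant B \<Longrightarrow> invariant (A \<inter> B)"
  using invariant_Inter[of "{A, B}"] by auto

text \<open>The element \<open>\<Sum>\<chi>(b\<^sup>*) b\<close> acts on \<open>\<rho>\<close> as a nonzero scalar and annihilates the kernel of \<open>\<rho>\<close>.\<close>

lemma orth_kernel:
  assumes \<rho>: "rep n \<rho>" and bi: "biorth n \<rho> g" and g: "g \<noteq> 0"
    and \<sigma>: "rep m \<sigma>" and w: "submodule M m \<sigma> w" and M: "M \<subseteq> kernel n \<rho>"
  shows "orth n \<rho> m \<sigma>"
  unfolding orth_def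
proof (intro allI impI)
  fix i j k l assume i: "i < n" and j: "j < n" and k: "k < m" and l: "l < m"
  define \<chi> where "\<chi> a = (\<Sum>q<n. \<rho> a q q)" for a
  define T where "T p q = (\<Sum>b\<in>UNIV. \<rho> b p j * \<sigma> (dual b) k q)" for p q
  have \<rho>c: "(\<Sum>a\<in>UNIV. \<chi> (dual a) * \<rho> a i p) = (if i = p then g else 0)" if "p < n" for p
  proof -
    have "(\<Sum>a\<in>UNIV. \<chi> (dual a) * \<rho> a i p) = (\<Sum>q<n. \<Sum>a\<in>UNIV. \<rho> a i p * \<rho> (dual a) q q)"
      by (subst sum.swap) (simp add: \<chi>_def sum_distrib_right sum_distrib_left mult.commute)
    also have "\<dots> = (\<Sum>q<n. if q = p then (if i = p then g else 0) else 0)"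
      using bi i that by (intro sum.cong) (auto simp: biorth_def)
    finally show ?thesis using that by simp
  qed
  \<comment> \<open>The coefficient at \<open>k\<close> turns out to be the trace of \<rho>(x)
    \<rho>(dual k), and \<rho>(x) = 0 on the annihilator.\<close>
  have act0: "(\<lambda>k. \<Sum>a\<in>UNIV. \<chi> (dual a) * act a x k) = 0" if x: "x \<in> M" for x
  proof
    fix k
    have "(\<Sum>a\<in>UNIV. \<chi> (dual a) * act a x k) = (\<Sum>a\<in>UNIV. \<Sum>j\<in>UNIV. x j * (of_int (N j (dual k) (dual a)) * \<chi> (dual a)))"
      by (simp add: act_def sum_distrib_left algebra_simps N_rotate[of _ _ k])
    also have "\<dots> = (\<Sum>j\<in>UNIV. x j * (\<Sum>a\<in>UNIV. of_int (N j (dual k) (dual a)) * \<chi> (dual a)))"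
      by (subst sum.swap) (simp add: sum_distrib_left)
    also have "\<dots> = (\<Sum>j\<in>UNIV. x j * (\<Sum>e\<in>UNIV. of_int (N j (dual k) e) * \<chi> e))"
      using sum_dual[of "\<lambda>e. of_int (N j (dual k) e) * \<chi> e" for j] by simp
    also have "\<dots> = (\<Sum>j\<in>UNIV. x j * (\<Sum>q<n. \<Sum>p<n. \<rho> j q p * \<rho> (dual k) p q))"
    proof (intro sum.cong refl arg_cong2[of _ _ _ _ "(*)"])
      fix j
      show "(\<Sum>e\<in>UNIV. of_int (N j (dual k) e) * \<chi> e) = (\<Sum>q<n. \<Sum>p<n. \<rho> j q p * \<rho> (dual k) p q)"
        by (simp add: \<chi>_def sum_distrib_left rep_mult[OF \<rho>] sum.swap[of _ UNIV "{..<n}"])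
    qed
    also have "\<dots> = (\<Sum>q<n. \<Sum>p<n. \<rho> (dual k) p q * (\<Sum>j\<in>UNIV. x j * \<rho> j q p))"
      by (simp add: sum_distrib_left sum.swap[of _ UNIV "{..<n}"] mult_ac)
    also have "\<dots> = 0" using M x by (auto simp: kernel_def intro!: sum.neutral)
    finally show "(\<Sum>a\<in>UNIV. \<chi> (dual a) * act a x k) = 0 k" by simp
  qed
  have \<sigma>c: "(\<Sum>a\<in>UNIV. \<chi> (dual a) * \<sigma> a p l) = 0" if "p < m" for p
  proof -
    have wl: "w l \<in> M" and al: "\<And>b. act b (w l) = (\<lambda>k. \<Sum>i<m. \<sigma> b i l * w i k)"
      using w l by (auto simp: submodule_def)
    have "(\<lambda>k. \<Sum>i<m. (\<Sum>a\<in>UNIV. \<chi> (dual a) * \<sigma> a i l) * w i k) = (\<lambda>k. \<Sum>a\<in>UNIV. \<chi> (dual a) * act a (w l) k)"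
      by (simp add: al sum_distrib_left sum_distrib_right sum.swap[of _ UNIV "{..<m}"] mult.assoc)
    also have "\<dots> = 0" by (rule act0[OF wl])
    finally show ?thesis by (rule submodule_independent[OF w _ that])
  qed
  \<comment> \<open>The central element acts as \<open>g\<close> through \<rho> and as zero through
    \<sigma>; pushing it across the intertwiner \<open>T\<close> gives g T = 0.\<close>
  have "g * T i l = (\<Sum>p<n. (\<Sum>a\<in>UNIV. \<chi> (dual a) * \<rho> a i p) * T p l)"
    using i by (simp add: \<rho>c if_distrib[of "\<lambda>x. x * _"] cong: if_cong)
  also have "\<dots> = (\<Sum>a\<in>UNIV. \<chi> (dual a) * (\<Sum>p<n. \<rho> a i p * T p l))"
    by (simp add: sum_distrib_left sum_distrib_right sum.swap[of _ UNIV "{..<n}"] mult.assoc)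
  also have "\<dots> = (\<Sum>a\<in>UNIV. \<chi> (dual a) * (\<Sum>p<m. T i p * \<sigma> a p l))"
    using intertwine[OF \<rho> \<sigma> i j k l] by (simp add: T_def)
  also have "\<dots> = (\<Sum>p<m. T i p * (\<Sum>a\<in>UNIV. \<chi> (dual a) * \<sigma> a p l))"
    by (simp add: sum_distrib_left sum_distrib_right sum.swap[of _ UNIV "{..<m}"] mult_ac)
  also have "\<dots> = 0" by (simp add: \<sigma>c)
  finally show "(\<Sum>b\<in>UNIV. \<rho> b i j * \<sigma> (dual b) k l) = 0"
    using g by (simp add: T_def)
qed

section \<open>Families of irreducibles and the coefficient of the unit\<close>

definition family :: "(nat \<times> ('n \<Rightarrow> nat \<Rightarrow> nat \<Rightarrow> complex) \<times> complex) list \<Rightarrow> bool" where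
  "family L \<longleftrightarrow> (\<forall>(n, \<rho>, g)\<in>set L. rep n \<rho> \<and> biorth n \<rho> g \<and> g \<noteq> 0) \<and>
     sorted_wrt (\<lambda>(n, \<rho>, g) (m, \<sigma>, h). orth n \<rho> m \<sigma>) L"

definition index_set :: "(nat \<times> ('n \<Rightarrow> nat \<Rightarrow> nat \<Rightarrow> complex) \<times> complex) list \<Rightarrow> (nat \<times> nat \<times> nat) set" where
  "index_set L = (SIGMA r:{..<length L}. {..<fst (L ! r)} \<times> {..<fst (L ! r)})"

lemma finite_index_set [simp]: "finite (index_set L)"
  by (auto simp: index_set_def)

lemma card_index_set: "card (index_set L) = (\<Sum>(n, \<rho>, g)\<leftarrow>L. n\<^sup>2)"
  by (simp add: index_set_def card_cartesian_product sum_list_sum_nth case_prod_unfold power2_eq_square lessThan_atLeast0)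

text \<open>The dual entry is transposed as well as taken at the dual basis element; in this
  indexing the Schur relations are literally a biorthogonal system.\<close>

definition entry where "entry L = (\<lambda>(r, i, j) b. fst (snd (L ! r)) b i j)"
definition dual_entry where "dual_entry L = (\<lambda>(r, i, j) b. fst (snd (L ! r)) (dual b) j i)"

lemma family_nth:
  assumes "family L" "r < length L"
  shows "rep (fst (L ! r)) (fst (snd (L ! r)))" "biorth (fst (L ! r)) (fst (snd (L ! r))) (snd (snd (L ! r)))"
    "snd (snd (L ! r)) \<noteq> 0"
proof -
  have "case L ! r of (n, \<rho>, g) \<Rightarrow> rep n \<rho> \<and> biorth n \<rho> g \<and> g \<noteq> 0"
    using assms(1) nth_mem[OF assms(2)] unfolding family_def by (elim conjE) (rule bspec)
  then show "rep (fst (L ! r)) (fst (snd (L ! r)))" "biorth (fst (L ! r)) (fst (snd (L ! r))) (snd (snd (L ! r)))"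
    "snd (snd (L ! r)) \<noteq> 0"
    by (simp_all add: case_prod_unfold)
qed

lemma family_orth:
  assumes L: "family L" and rs: "r < length L" "s < length L" "r \<noteq> s"
  shows "orth (fst (L ! r)) (fst (snd (L ! r))) (fst (L ! s)) (fst (snd (L ! s)))"
proof -
  have *: "orth (fst (L ! r)) (fst (snd (L ! r))) (fst (L ! s)) (fst (snd (L ! s)))"
    if "r < s" "s < length L" for r s
    using L sorted_wrt_nth_less[of _ L, OF _ that] by (force simp: family_def case_prod_unfold)
  show ?thesis
    using *[of r s] orth_sym[OF *[of s r]] rs by (cases "r < s") auto
qed

lemma family_biorth:
  assumes L: "family L" and k: "k \<in> index_set L" and l: "l \<in> index_set L"
  shows "(\<Sum>b\<in>UNIV. entry L k b * dual_entry L l b) = (if k = l then snd (snd (L ! fst k)) else 0)"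
proof -
  obtain r i j where k': "k = (r, i, j)" "r < length L" "i < fst (L ! r)" "j < fst (L ! r)"
    using k by (auto simp: index_set_def)
  obtain s p q where l': "l = (s, p, q)" "s < length L" "p < fst (L ! s)" "q < fst (L ! s)"
    using l by (auto simp: index_set_def)
  show ?thesis
  proof (cases "r = s")
    case True
    then show ?thesis using family_nth(2)[OF L k'(2)] k' l'
      by (auto simp: entry_def dual_entry_def biorth_def)
  next
    case False
    then show ?thesis using family_orth[OF L k'(2) l'(2)] k' l'
      by (auto simp: entry_def dual_entry_def orth_def)
  qed
qed

lemma family_nonzero: "family L \<Longrightarrow> k \<in> index_set L \<Longrightarrow> snd (snd (L ! fst k)) \<noteq> 0"
  by (auto simp: index_set_def family_nth)

lemma family_card: "family L \<Longrightarrow> (\<Sum>(n, \<rho>, g)\<leftarrow>L. n\<^sup>2) \<le> CARD('n)"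
  using biorthogonal_card_le[OF finite_index_set, of L "entry L" "dual_entry L" "\<lambda>k. snd (snd (L ! fst k))"]
    family_biorth family_nonzero by (simp add: card_index_set)

text \<open>The functional reading off the coefficient of the unit is the sum of all characters
  divided by their codegrees. Both sides have the same pairings with all dual entries, and a family
  of full size leaves no further room.\<close>

lemma family_unit:
  assumes L: "family L" and card: "(\<Sum>(n, \<rho>, g)\<leftarrow>L. n\<^sup>2) = CARD('n)"
  shows "of_bool (b = u) = (\<Sum>(n, \<rho>, g)\<leftarrow>L. (\<Sum>i<n. \<rho> b i i) / g)"
proof -
  define x where "x b = of_bool (b = u) - (\<Sum>s<length L. (\<Sum>i<fst (L ! s). fst (snd (L ! s)) b i i) / snd (snd (L ! s)))" for b
  have "x = 0"
  proof (rule biorthogonal_complete[OF finite_index_set family_biorth[OF L] family_nonzero[OF L]])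
    show "card (index_set L) = CARD('n)" using card by (simp add: card_index_set)
    fix k assume k: "k \<in> index_set L"
    then obtain r p q where k': "k = (r, p, q)" "r < length L" "p < fst (L ! r)" "q < fst (L ! r)"
      by (auto simp: index_set_def)
    have inner: "(\<Sum>b\<in>UNIV. fst (snd (L ! s)) b i i * dual_entry L k b) = (if s = r \<and> p = i \<and> q = i then snd (snd (L ! r)) else 0)"
      if "s < length L" "i < fst (L ! s)" for s i
      using family_biorth[OF L, of "(s, i, i)" k] k k' that by (auto simp: entry_def index_set_def)
    have "(\<Sum>b\<in>UNIV. (\<Sum>s<length L. (\<Sum>i<fst (L ! s). fst (snd (L ! s)) b i i) / snd (snd (L ! s))) * dual_entry L k b)
       = (\<Sum>b\<in>UNIV. \<Sum>s<length L. \<Sum>i<fst (L ! s). fst (snd (L ! s)) b i i * dual_entry L k b / snd (snd (L ! s)))"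
      by (simp add: sum_distrib_right sum_divide_distrib)
    also have "\<dots> = (\<Sum>s<length L. \<Sum>i<fst (L ! s). (\<Sum>b\<in>UNIV. fst (snd (L ! s)) b i i * dual_entry L k b) / snd (snd (L ! s)))"
      by (subst sum.swap) (simp add: sum_divide_distrib sum.swap[of _ UNIV "{..<fst (L ! s)}" for s])
    also have "\<dots> = (\<Sum>s<length L. \<Sum>i<fst (L ! s). if s = r then (if p = i then of_bool (p = q) else 0) else 0)"
      using family_nth(3)[OF L k'(2)] by (intro sum.cong refl) (auto simp: inner)
    also have "\<dots> = (\<Sum>s<length L. if s = r then of_bool (p = q) else 0)"
      using k' by (intro sum.cong) auto
    also have "\<dots> = of_bool (p = q)" using k' by simp
    finally have 1: "(\<Sum>b\<in>UNIV. (\<Sum>s<length L. (\<Sum>i<fst (L ! s). fst (snd (L ! s)) b i i) / snd (snd (L ! s))) * dual_entry L k b) = of_bool (p = q)" .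
    have "(\<Sum>b\<in>UNIV. of_bool (b = u) * dual_entry L k b) = fst (snd (L ! r)) u q p"
      by (simp add: dual_entry_def k' of_bool_def if_distrib[of "\<lambda>x. x * _"] cong: if_cong)
    also have "\<dots> = of_bool (p = q)"
      using rep_unit[OF family_nth(1)[OF L k'(2)] k'(4,3)] by auto
    finally show "(\<Sum>b\<in>UNIV. x b * dual_entry L k b) = 0"
      using 1 by (simp add: x_def left_diff_distrib sum_subtractf)
  qed
  then have "x b = 0" by simp
  then show ?thesis
    by (simp add: x_def sum_list_sum_nth case_prod_unfold lessThan_atLeast0)
qed

definition common_kernel where
  "common_kernel L = (\<Inter>(n, \<rho>, g)\<in>set L. kernel n \<rho>)"

lemma family_kernel:
  fixes L :: "(nat \<times> ('n \<Rightarrow> nat \<Rightarrow> nat \<Rightarrow> complex) \<times> complex) list"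
  assumes "(\<Sum>(n, \<rho>, g)\<leftarrow>L. n\<^sup>2) < CARD('n)"
  obtains x where "x \<in> common_kernel L" "x \<noteq> 0"
proof -
  obtain x :: "'n \<Rightarrow> complex" where x: "x \<noteq> 0" "\<And>k. k \<in> index_set L \<Longrightarrow> (\<Sum>b\<in>UNIV. x b * entry L k b) = 0"
    using kernel_nonzero[OF finite_index_set, of L "entry L"] assms by (auto simp: card_index_set)
  have "x \<in> common_kernel L"
    unfolding common_kernel_def kernel_def
  proof (clarsimp)
    fix n \<rho> g i j assume "(n, \<rho>, g) \<in> set L" and ij: "i < n" "j < n"
    then obtain r where "r < length L" "L ! r = (n, \<rho>, g)" by (auto simp: in_set_conv_nth)
    then show "(\<Sum>b\<in>UNIV. x b * \<rho> b i j) = 0"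
      using x(2)[of "(r, i, j)"] ij by (simp add: index_set_def entry_def)
  qed
  then show ?thesis using that x(1) by blast
qed

text \<open>The new irreducible is taken inside the common annihilator of the old members, so
  \<open>orth_kernel\<close> supplies all orthogonality relations.\<close>

lemma family_extend:
  assumes L: "family L" and M: "invariant M" and x: "x \<in> M" "x \<in> common_kernel L" "x \<noteq> 0"
  obtains n \<rho> g w where "0 < n" "family (L @ [(n, \<rho>, g)])" "submodule M n \<rho> w"
proof -
  have "invariant (common_kernel L)"
    unfolding common_kernel_def using L
    by (intro invariant_Inter) (auto simp: family_def intro: invariant_kernel)
  then have inv: "invariant (M \<inter> common_kernel L)" by (rule invariant_Int[OF M])
  obtain n \<rho> w g where *: "0 < n" "rep n \<rho>" "biorth n \<rho> g" "g \<noteq> 0" "submodule (M \<inter> common_kernel L) n \<rho> w"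
    by (rule irreducible_in[OF inv, of x]) (use x in auto)
  have "orth m \<sigma> n \<rho>" if "(m, \<sigma>, h) \<in> set L" for m \<sigma> h
    by (rule orth_kernel[OF _ _ _ *(2,5), where g = h])
      (use that L in \<open>force simp: family_def common_kernel_def\<close>)+
  then have "family (L @ [(n, \<rho>, g)])"
    using L * by (auto simp: family_def sorted_wrt_append)
  moreover have "submodule M n \<rho> w" using *(5) by (auto simp: submodule_def)
  ultimately show ?thesis using that *(1) by blast
qed

text \<open>The dimension character comes first. The degree-2 member is found next, inside the
  annihilator of all characters, which contains the nonzero commutator of \<open>p\<close> and
  \<open>q\<close>. The remaining two members are forced by counting.\<close>

lemma irreducible_family:
  assumes card: "CARD('n) = 7" and \<delta>: "character \<delta>" and D: "(\<Sum>b\<in>UNIV. \<delta> b * \<delta> (dual b)) = D" "D \<noteq> 0"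
    and nc: "N p q r \<noteq> N q p r"
  obtains \<rho> f \<psi> a \<phi> b where
    "family [(1, rep_of \<delta>, D), (2, \<rho>, f), (1, rep_of \<psi>, a), (1, rep_of \<phi>, b)]"
proof -
  have fam1: "family [(1, rep_of \<delta>, D)]"
    using \<delta> D by (simp add: family_def rep_of_iff' biorth_def) (simp add: rep_of_def)
  define M where "M = (\<Inter>\<psi>\<in>Collect character. kernel 1 (rep_of \<psi>))"
  have M: "invariant M"
    unfolding M_def by (intro invariant_Inter) (auto intro!: invariant_kernel simp: rep_of_iff')
  define x :: "'n \<Rightarrow> complex" where "x k = of_int (N p q k) - of_int (N q p k)" for k
  have xM: "x \<in> M"
    unfolding M_def kernel_def
  proof (clarsimp simp: rep_of_def)
    fix \<psi> assume "character \<psi>"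
    then have "(\<Sum>b\<in>UNIV. of_int (N p q b) * \<psi> b) = (\<Sum>b\<in>UNIV. of_int (N q p b) * \<psi> b)"
      unfolding character_def by (metis mult.commute)
    then show "(\<Sum>b\<in>UNIV. x b * \<psi> b) = 0"
      by (simp add: x_def left_diff_distrib sum_subtractf)
  qed
  have x0: "x \<noteq> 0" using nc by (auto simp: x_def fun_eq_iff intro!: exI[of _ r])
  have "x \<in> common_kernel [(1, rep_of \<delta>, D)]"
    using xM \<delta> by (auto simp: common_kernel_def M_def)
  then obtain n \<rho> f w where n: "0 < n" and fam2: "family ([(1, rep_of \<delta>, D)] @ [(n, \<rho>, f)])" and w: "submodule M n \<rho> w"
    by (rule family_extend[OF fam1 M xM _ x0])
  have "1 + n\<^sup>2 \<le> 7" using family_card[OF fam2] card by simp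
  then have "n < 3" using power2_nat_le_imp_le[of n 6] by (cases "n \<ge> 3") (auto dest: power_mono[of 3 n 2])
  \<comment> \<open>A one-dimensional piece of \<open>M\<close> would be spanned by an eigenvector
    whose own character \<psi> annihilates it; evaluating \<psi> on it gives the codegree times its
    value at the unit.\<close>
  moreover have "n \<noteq> 1"
  proof
    assume n1: "n = 1"
    have rep: "rep 1 \<rho>" and bi: "biorth 1 \<rho> f" and f: "f \<noteq> 0"
      using fam2 n1 by (auto simp: family_def)
    define \<psi> where "\<psi> b = \<rho> b 0 0" for b
    have \<psi>: "character \<psi>" using rep_character[OF rep] unfolding \<psi>_def .
    have w0: "w 0 \<in> M" "w 0 \<noteq> 0" and aw: "act b (w 0) = (\<lambda>k. \<psi> b * w 0 k)" for b
      using w n1 by (auto simp: submodule_def \<psi>_def)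
    \<comment> \<open>The coefficient of the unit in \<open>dual b\<close> times an element is the
      coefficient of \<open>b\<close>, so an eigenvector is determined by its value at the
      unit.\<close>
    have wb: "w 0 b = \<psi> (dual b) * w 0 u" for b
    proof -
      have "act (dual b) (w 0) u = (\<Sum>j\<in>UNIV. if j = b then w 0 j else 0)"
        unfolding act_def by (intro sum.cong) (auto simp: N_unit')
      then show ?thesis using aw[of "dual b"] by simp
    qed
    have "0 = (\<Sum>b\<in>UNIV. w 0 b * \<psi> b)"
      using w0 \<psi> by (auto simp: M_def kernel_def rep_of_def)
    also have "\<dots> = (\<Sum>b\<in>UNIV. \<psi> b * \<psi> (dual b)) * w 0 u"
      unfolding sum_distrib_right by (rule sum.cong[OF refl], subst wb) simp
    also have "\<dots> = f * w 0 u"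
      using bi by (simp add: biorth_def \<psi>_def)
    finally have "w 0 u = 0" using f by simp
    then have "w 0 b = 0" for b by (subst wb) simp
    then have "w 0 = 0" by (simp add: fun_eq_iff)
    then show False using w0 by simp
  qed
  ultimately have n2: "n = 2" using n by auto
  define L2 where "L2 = [(1 :: nat, rep_of \<delta>, D), (2, \<rho>, f)]"
  have fam2': "family L2" using fam2 n2 by (simp add: L2_def)
  have invU: "invariant UNIV" by (auto simp: invariant_def)
  \<comment> \<open>The members so far use 1 + 4 of the 7 dimensions, so some nonzero vector is
    annihilated by both.\<close>
  obtain x2 where x2: "x2 \<in> common_kernel L2" "x2 \<noteq> 0"
    by (rule family_kernel[of L2]) (simp add: card L2_def)
  obtain m \<sigma> a w' where m: "0 < m" and fam3: "family (L2 @ [(m, \<sigma>, a)])"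
    by (rule family_extend[OF fam2' invU UNIV_I x2])
  have "m\<^sup>2 \<le> 2" using family_card[OF fam3] card by (simp add: L2_def)
  then have m1: "m = 1" using m by (cases "m \<ge> 2") (auto dest: power_mono[of 2 m 2])
  define \<psi> where "\<psi> b = \<sigma> b 0 0" for b
  define L3 where "L3 = L2 @ [(1, rep_of \<psi>, a)]"
  have fam3': "family L3"
    using fam3 m1 by (auto simp: family_def L3_def sorted_wrt_append biorth_def orth_def rep_def rep_of_def \<psi>_def)
  obtain x3 where x3: "x3 \<in> common_kernel L3" "x3 \<noteq> 0"
    by (rule family_kernel[of L3]) (simp add: card L3_def L2_def)
  obtain l \<tau> b w'' where l: "0 < l" and fam4: "family (L3 @ [(l, \<tau>, b)])"
    by (rule family_extend[OF fam3' invU UNIV_I x3])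
  have "l\<^sup>2 \<le> 1" using family_card[OF fam4] card by (simp add: L3_def L2_def)
  then have l1: "l = 1" using l by (cases "l \<ge> 2") (auto dest: power_mono[of 2 l 2])
  define \<phi> where "\<phi> b = \<tau> b 0 0" for b
  have "family (L3 @ [(1, rep_of \<phi>, b)])"
    using fam4 l1 by (auto simp: family_def sorted_wrt_append biorth_def orth_def rep_def rep_of_def \<phi>_def)
  then show ?thesis using that by (simp add: L3_def L2_def)
qed

end

section \<open>Rationality and two-sided traces\<close>

text \<open>In lowest terms every power of the denominator divides \<open>M\<close>, which is
  possible only for denominator 1.\<close>

lemma rational_bounded_powers_int:
  fixes r :: complex
  assumes r: "r \<in> \<rat>" and M: "M \<noteq> 0" "\<And>k. of_int M * r ^ k \<in> \<int>"
  shows "r \<in> \<int>"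
proof -
  obtain p q where pq: "q > 0" "coprime p q" "r = of_int p / of_int q"
    using r by (rule Rats_cases')
  have qM: "q ^ k dvd M" for k
  proof -
    obtain z where "of_int M * r ^ k = of_int z" using M(2)[of k] by (auto elim: Ints_cases)
    then have "(of_int (M * p ^ k) :: complex) = of_int (z * q ^ k)"
      using pq by (simp add: power_divide field_simps)
    then have "M * p ^ k = z * q ^ k" by (simp only: of_int_eq_iff)
    then have "q ^ k dvd M * p ^ k" by simp
    then show ?thesis using pq(2)
      by (metis coprime_commute coprime_dvd_mult_left_iff coprime_power_left_iff coprime_power_right_iff)
  qed
  have "q = 1"
  proof (rule ccontr)
    assume "q \<noteq> 1"
    then have q2: "2 \<le> q" using pq by simp
    \<comment> \<open>With this exponent a denominator of at least 2 has a power exceeding the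
      absolute value of \<open>M\<close>.\<close>
    define k where "k = nat \<bar>M\<bar>"
    have "int k < 2 ^ k" by (rule of_nat_less_two_power)
    also have "(2::int) ^ k \<le> q ^ k" using q2 by (intro power_mono) auto
    also have "q ^ k \<le> \<bar>M\<bar>" using dvd_imp_le_int[OF M(1) qM[of k]] pq by simp
    finally show False by (simp add: k_def)
  qed
  then show ?thesis using pq by simp
qed

lemma rational_common_denominator:
  fixes f :: "'i \<Rightarrow> complex"
  assumes "finite I" "\<And>i. i \<in> I \<Longrightarrow> f i \<in> \<rat>"
  shows "\<exists>M. M \<noteq> 0 \<and> (\<forall>i\<in>I. of_int M * f i \<in> \<int>)"
  using assms
proof (induction I rule: finite_induct)
  case empty
  show ?case by (intro exI[of _ 1]) simp
next
  case (insert i I)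
  then obtain M where M: "M \<noteq> 0" "\<forall>i\<in>I. of_int M * f i \<in> \<int>" by auto
  obtain p q where pq: "q > 0" "f i = of_int p / of_int q"
    using insert.prems[of i] by (auto elim: Rats_cases')
  have "of_int (M * q) * f j \<in> \<int>" if "j \<in> insert i I" for j
  proof (cases "j = i")
    case True
    then have "of_int (M * q) * f j = of_int (M * p)" using pq by simp
    then show ?thesis by (metis Ints_of_int)
  next
    case False
    then have "of_int M * f j \<in> \<int>" using M(2) that by blast
    then have "of_int q * (of_int M * f j) \<in> \<int>" by (rule Ints_mult[OF Ints_of_int])
    then show ?thesis by (simp add: mult_ac)
  qed
  then show ?case using M pq by (intro exI[of _ "M * q"]) auto
qed

context fusion_data
begin

lemma character_unit: "character \<psi> \<Longrightarrow> \<psi> u = 1"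
  by (simp add: character_def)

lemma character_mult: "character \<psi> \<Longrightarrow> \<psi> a * \<psi> b = (\<Sum>c\<in>UNIV. of_int (N a b c) * \<psi> c)"
  by (simp add: character_def)

lemma character_power:
  assumes "character \<psi>"
  shows "\<exists>z :: 'n \<Rightarrow> int. \<psi> c ^ k = (\<Sum>e\<in>UNIV. of_int (z e) * \<psi> e)"
proof (induction k)
  case 0
  have "(\<Sum>e\<in>UNIV. of_int (of_bool (e = u)) * \<psi> e) = (\<Sum>e\<in>UNIV. if e = u then \<psi> u else 0)"
    by (intro sum.cong) auto
  then show ?case
    by (intro exI[of _ "\<lambda>e. of_bool (e = u)"]) (simp add: character_unit[OF assms])
next
  case (Suc k)
  then obtain z :: "'n \<Rightarrow> int" where z: "\<psi> c ^ k = (\<Sum>e\<in>UNIV. of_int (z e) * \<psi> e)" by blast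
  have "\<psi> c ^ Suc k = (\<Sum>e\<in>UNIV. of_int (z e) * (\<psi> c * \<psi> e))"
    by (simp add: z sum_distrib_left mult_ac)
  also have "\<dots> = (\<Sum>e\<in>UNIV. \<Sum>m\<in>UNIV. of_int (z e * N c e m) * \<psi> m)"
    by (simp add: character_mult[OF assms] sum_distrib_left mult.assoc)
  also have "\<dots> = (\<Sum>m\<in>UNIV. of_int (\<Sum>e\<in>UNIV. z e * N c e m) * \<psi> m)"
    by (subst sum.swap) (simp add: sum_distrib_right)
  finally show ?case by (intro exI[of _ "\<lambda>m. \<Sum>e\<in>UNIV. z e * N c e m"])
qed

text \<open>Powers of a value are integral combinations of all values by
  \<open>character_power\<close>, so one common denominator of the values serves every
  power.\<close>

lemma rational_character_integral:
  assumes \<psi>: "character \<psi>" and rat: "\<And>c. \<psi> c \<in> \<rat>"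
  shows "\<psi> c \<in> \<int>"
proof -
  obtain M where M: "M \<noteq> 0" "\<And>c. of_int M * \<psi> c \<in> \<int>"
    using rational_common_denominator[of "UNIV :: 'n set" \<psi>] rat by auto
  show ?thesis
  proof (rule rational_bounded_powers_int[OF rat M(1)])
    fix k
    obtain z :: "'n \<Rightarrow> int" where z: "\<psi> c ^ k = (\<Sum>e\<in>UNIV. of_int (z e) * \<psi> e)"
      using character_power[OF \<psi>] by blast
    have "of_int M * \<psi> c ^ k = (\<Sum>e\<in>UNIV. of_int (z e) * (of_int M * \<psi> e))"
      by (simp add: z sum_distrib_left mult_ac)
    also have "\<dots> \<in> \<int>" by (intro Ints_sum Ints_mult Ints_of_int M(2))
    finally show "of_int M * \<psi> c ^ k \<in> \<int>" .
  qed
qed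

lemma character_orth:
  assumes \<psi>: "character \<psi>" and \<phi>: "character \<phi>" and ne: "\<psi> \<noteq> \<phi>"
  shows "(\<Sum>b\<in>UNIV. \<psi> b * \<phi> (dual b)) = 0"
proof -
  obtain c where c: "\<psi> c \<noteq> \<phi> c" using ne by auto
  have "\<psi> c * (\<Sum>b\<in>UNIV. \<psi> b * \<phi> (dual b)) = (\<Sum>b\<in>UNIV. \<psi> b * \<phi> (dual b)) * \<phi> c"
    using intertwine[of 1 "rep_of \<psi>" 1 "rep_of \<phi>" 0 0 0 0 c] \<psi> \<phi>
    by (simp add: rep_of_iff') (simp add: rep_of_def)
  then show ?thesis using c by (simp add: algebra_simps)
qed

text \<open>The conjugate of \<psi> composed with \<open>dual\<close> is again a character. Were it
  different from \<psi>, orthogonality would make the sum of the squared absolute values of \<psi>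
  zero.\<close>

lemma character_dual:
  assumes \<psi>: "character \<psi>" shows "\<psi> (dual c) = cnj (\<psi> c)"
proof -
  define \<psi>' where "\<psi>' b = cnj (\<psi> (dual b))" for b
  have \<psi>': "character \<psi>'"
    unfolding character_def
  proof (intro conjI allI)
    show "\<psi>' u = 1" using \<psi> by (simp add: \<psi>'_def character_def)
    fix a b
    have "\<psi>' a * \<psi>' b = cnj (\<psi> (dual b) * \<psi> (dual a))"
      by (simp add: \<psi>'_def)
    also have "\<dots> = (\<Sum>c\<in>UNIV. of_int (N (dual b) (dual a) c) * cnj (\<psi> c))"
      by (simp add: character_mult[OF \<psi>])
    also have "\<dots> = (\<Sum>c\<in>UNIV. of_int (N (dual b) (dual a) (dual c)) * cnj (\<psi> (dual c)))"
      by (rule sum_dual[symmetric])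
    finally show "\<psi>' a * \<psi>' b = (\<Sum>c\<in>UNIV. of_int (N a b c) * \<psi>' c)"
      by (simp add: N_dual \<psi>'_def)
  qed
  have "\<psi> = \<psi>'"
  proof (rule ccontr)
    assume "\<psi> \<noteq> \<psi>'"
    then have "0 = (\<Sum>b\<in>UNIV. \<psi> b * cnj (\<psi> b))"
      using character_orth[OF \<psi> \<psi>'] by (simp add: \<psi>'_def)
    also have "\<dots> = of_real (\<Sum>b\<in>UNIV. (cmod (\<psi> b))\<^sup>2)"
      by (simp add: complex_norm_square flip: of_real_power)
    finally have "complex_of_real (\<Sum>b\<in>UNIV. (cmod (\<psi> b))\<^sup>2) = 0" by (rule sym)
    then have "(\<Sum>b\<in>UNIV. (cmod (\<psi> b))\<^sup>2) = 0" by (simp only: of_real_eq_0_iff)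
    then have "\<psi> u = 0" by (subst (asm) sum_nonneg_eq_0_iff) auto
    then show False using \<psi> by (simp add: character_def)
  qed
  then have "\<psi> c = cnj (\<psi> (dual c))" by (metis \<psi>'_def)
  then show ?thesis by simp
qed

text \<open>The trace of the map sending x to \<open>i\<close> x \<open>j\<close> on the fusion
  ring, with \<open>i\<close> and \<open>j\<close> read as basis elements. It is an integer by
  construction, and this is the source of all arithmetic information.\<close>

definition two_sided_trace :: "'n \<Rightarrow> 'n \<Rightarrow> int" where
  "two_sided_trace i j = (\<Sum>k\<in>UNIV. \<Sum>m\<in>UNIV. N i k m * N m j k)"

lemma two_sided_trace_unit: "two_sided_trace i u = (\<Sum>k\<in>UNIV. N i k k)"
  by (simp add: two_sided_trace_def N_unit_right of_bool_def if_distrib[of "(*) _"] cong: if_cong)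

text \<open>The left side is the sum over \<open>k\<close> of the traces of \<rho>(i) \<rho>(k)
  \<rho>(j) \<rho>(dual k); the Schur relations separate the factors \<open>i\<close> and
  \<open>j\<close>.\<close>

lemma trace_sandwich:
  assumes \<rho>: "rep n \<rho>" and bi: "biorth n \<rho> g"
  shows "(\<Sum>k\<in>UNIV. \<Sum>m\<in>UNIV. \<Sum>l\<in>UNIV. \<Sum>e\<in>UNIV.
      of_int (N i k m) * (of_int (N m j l) * (of_int (N l (dual k) e) * (\<Sum>p<n. \<rho> e p p))))
    = g * (\<Sum>p<n. \<rho> i p p) * (\<Sum>p<n. \<rho> j p p)"
proof -
  have swap: "(\<Sum>e\<in>UNIV. of_int (N l b e) * (\<Sum>p<n. h p * \<rho> e p (s p))) = (\<Sum>p<n. h p * (\<Sum>q<n. \<rho> l p q * \<rho> b q (s p)))"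
    if "\<And>p. p < n \<Longrightarrow> s p < n" for l b h s
  proof -
    have "(\<Sum>e\<in>UNIV. of_int (N l b e) * (\<Sum>p<n. h p * \<rho> e p (s p))) = (\<Sum>p<n. \<Sum>e\<in>UNIV. h p * (of_int (N l b e) * \<rho> e p (s p)))"
      by (subst sum.swap) (simp add: sum_distrib_left mult_ac)
    also have "\<dots> = (\<Sum>p<n. h p * (\<Sum>q<n. \<rho> l p q * \<rho> b q (s p)))"
      by (intro sum.cong refl) (simp add: rep_mult[OF \<rho>] that flip: sum_distrib_left)
    finally show ?thesis .
  qed
  have 1: "(\<Sum>e\<in>UNIV. of_int (N l b e) * (\<Sum>p<n. \<rho> e p p)) = (\<Sum>q<n. \<Sum>p<n. \<rho> b q p * \<rho> l p q)" for l b
    using swap[of "\<lambda>p. p" l b "\<lambda>_. 1"] by (subst sum.swap) (simp add: mult.commute)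
  have 2: "(\<Sum>e\<in>UNIV. of_int (N l b e) * (\<Sum>q<n. \<Sum>p<n. h q p * \<rho> e p q)) = (\<Sum>q<n. \<Sum>p<n. h q p * (\<Sum>r<n. \<rho> l p r * \<rho> b r q))" for l b h
  proof -
    have "(\<Sum>e\<in>UNIV. of_int (N l b e) * (\<Sum>q<n. \<Sum>p<n. h q p * \<rho> e p q)) = (\<Sum>q<n. \<Sum>e\<in>UNIV. of_int (N l b e) * (\<Sum>p<n. h q p * \<rho> e p q))"
      by (subst sum.swap) (simp add: sum_distrib_left)
    also have "\<dots> = (\<Sum>q<n. \<Sum>p<n. h q p * (\<Sum>r<n. \<rho> l p r * \<rho> b r q))"
    proof (intro sum.cong refl)
      fix q assume "q \<in> {..<n}"
      then show "(\<Sum>e\<in>UNIV. of_int (N l b e) * (\<Sum>p<n. h q p * \<rho> e p q)) = (\<Sum>p<n. h q p * (\<Sum>r<n. \<rho> l p r * \<rho> b r q))"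
        using swap[of "\<lambda>_. q" l b "h q"] by simp
    qed
    finally show ?thesis .
  qed
  have 3: "(\<Sum>q<n. \<Sum>p<n. \<rho> (dual k) q p * (\<Sum>r<n. \<rho> m p r * \<rho> j r q)) = (\<Sum>r<n. \<Sum>p<n. (\<Sum>q<n. \<rho> (dual k) q p * \<rho> j r q) * \<rho> m p r)" for k m
  proof -
    have "(\<Sum>q<n. \<Sum>p<n. \<rho> (dual k) q p * (\<Sum>r<n. \<rho> m p r * \<rho> j r q)) = (\<Sum>q<n. \<Sum>r<n. \<Sum>p<n. \<rho> (dual k) q p * \<rho> j r q * \<rho> m p r)"
      unfolding sum_distrib_left by (rule sum.cong[OF refl], subst sum.swap) (simp add: mult_ac)
    also have "\<dots> = (\<Sum>r<n. \<Sum>p<n. \<Sum>q<n. \<rho> (dual k) q p * \<rho> j r q * \<rho> m p r)"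
      by (subst sum.swap, rule sum.cong[OF refl], subst sum.swap, rule refl)
    finally show ?thesis
      by (simp add: sum_distrib_right)
  qed
  have "(\<Sum>k\<in>UNIV. \<Sum>m\<in>UNIV. \<Sum>l\<in>UNIV. \<Sum>e\<in>UNIV.
      of_int (N i k m) * (of_int (N m j l) * (of_int (N l (dual k) e) * (\<Sum>p<n. \<rho> e p p))))
    = (\<Sum>k\<in>UNIV. \<Sum>m\<in>UNIV. of_int (N i k m) * (\<Sum>l\<in>UNIV. of_int (N m j l) * (\<Sum>q<n. \<Sum>p<n. \<rho> (dual k) q p * \<rho> l p q)))"
    by (simp add: 1 flip: sum_distrib_left)
  also have "\<dots> = (\<Sum>k\<in>UNIV. \<Sum>m\<in>UNIV. of_int (N i k m) * (\<Sum>q<n. \<Sum>p<n. \<rho> (dual k) q p * (\<Sum>r<n. \<rho> m p r * \<rho> j r q)))"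
    by (simp only: 2)
  also have "\<dots> = (\<Sum>k\<in>UNIV. \<Sum>m\<in>UNIV. of_int (N i k m) * (\<Sum>r<n. \<Sum>p<n. (\<Sum>q<n. \<rho> (dual k) q p * \<rho> j r q) * \<rho> m p r))"
    by (simp only: 3)
  also have "\<dots> = (\<Sum>k\<in>UNIV. \<Sum>r<n. \<Sum>p<n. (\<Sum>q<n. \<rho> (dual k) q p * \<rho> j r q) * (\<Sum>s<n. \<rho> i p s * \<rho> k s r))"
    by (simp only: 2)
  also have "\<dots> = (\<Sum>k\<in>UNIV. \<Sum>r<n. \<Sum>p<n. \<Sum>s<n. \<Sum>q<n. \<rho> j r q * \<rho> i p s * (\<rho> k s r * \<rho> (dual k) q p))"
    by (simp add: sum_product mult_ac)
  also have "\<dots> = (\<Sum>r<n. \<Sum>p<n. \<Sum>s<n. \<Sum>q<n. \<rho> j r q * \<rho> i p s * (\<Sum>k\<in>UNIV. \<rho> k s r * \<rho> (dual k) q p))"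
    by (simp add: sum_distrib_left sum.swap[of _ UNIV "{..<n}"])
  also have "\<dots> = (\<Sum>r<n. \<Sum>p<n. \<Sum>s<n. \<Sum>q<n. if q = r then (if s = p then \<rho> j r r * \<rho> i p p * g else 0) else 0)"
    using bi by (intro sum.cong refl) (auto simp: biorth_def)
  also have "\<dots> = (\<Sum>r<n. \<Sum>p<n. \<rho> j r r * \<rho> i p p * g)"
    by (intro sum.cong refl) simp
  also have "\<dots> = g * (\<Sum>p<n. \<rho> i p p) * (\<Sum>p<n. \<rho> j p p)"
    by (simp add: sum_product sum_distrib_left mult_ac) (subst sum.swap, rule refl)
  finally show ?thesis .
qed

text \<open>Reflects the decomposition of the regular bimodule. The trace is the sum over
  \<open>k\<close> of the coefficient of the unit in \<open>i\<close> \<open>k\<close>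
  \<open>j\<close> \<open>dual k\<close>; \<open>family_unit\<close> splits this into the
  contributions computed in \<open>trace_sandwich\<close>, where the codegrees cancel.\<close>

lemma two_sided_trace_family:
  assumes L: "family L" and card: "(\<Sum>(n, \<rho>, g)\<leftarrow>L. n\<^sup>2) = CARD('n)"
  shows "of_int (two_sided_trace i j) = (\<Sum>(n, \<rho>, g)\<leftarrow>L. (\<Sum>p<n. \<rho> i p p) * (\<Sum>p<n. \<rho> j p p))"
proof -
  have 1: "(\<Sum>l\<in>UNIV. of_int (N m j l) * (\<Sum>e\<in>UNIV. of_int (N l (dual k) e) * of_bool (e = u))) = (of_int (N m j k) :: complex)" for m k
  proof -
    have "(\<Sum>l\<in>UNIV. \<Sum>e\<in>UNIV. of_int (N m j l) * (of_int (N l (dual k) e) * of_bool (e = u)))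
      = (\<Sum>l\<in>UNIV. \<Sum>e\<in>UNIV. if e = u then (if l = k then (of_int (N m j k) :: complex) else 0) else 0)"
      by (intro sum.cong refl) (auto simp: N_unit)
    then show ?thesis unfolding sum_distrib_left by simp
  qed
  have "complex_of_int (two_sided_trace i j) = (\<Sum>k\<in>UNIV. \<Sum>m\<in>UNIV. \<Sum>l\<in>UNIV. \<Sum>e\<in>UNIV.
      of_int (N i k m) * (of_int (N m j l) * (of_int (N l (dual k) e) * of_bool (e = u))))"
    unfolding two_sided_trace_def sum_distrib_left[symmetric] 1 by simp
  also have "\<dots> = (\<Sum>k\<in>UNIV. \<Sum>m\<in>UNIV. \<Sum>l\<in>UNIV. \<Sum>e\<in>UNIV. \<Sum>s<length L.
      of_int (N i k m) * (of_int (N m j l) * (of_int (N l (dual k) e) * (\<Sum>p<fst (L ! s). fst (snd (L ! s)) e p p))) / snd (snd (L ! s)))"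
    unfolding family_unit[OF L card]
    by (simp add: sum_list_sum_nth case_prod_unfold sum_distrib_left lessThan_atLeast0)
  also have "\<dots> = (\<Sum>s<length L. (\<Sum>k\<in>UNIV. \<Sum>m\<in>UNIV. \<Sum>l\<in>UNIV. \<Sum>e\<in>UNIV.
      of_int (N i k m) * (of_int (N m j l) * (of_int (N l (dual k) e) * (\<Sum>p<fst (L ! s). fst (snd (L ! s)) e p p)))) / snd (snd (L ! s)))"
    by (simp only: sum.swap[of _ UNIV "{..<length L}"] sum_divide_distrib)
  also have "\<dots> = (\<Sum>s<length L. (\<Sum>p<fst (L ! s). fst (snd (L ! s)) i p p) * (\<Sum>p<fst (L ! s). fst (snd (L ! s)) j p p))"
  proof (intro sum.cong refl)
    fix s assume "s \<in> {..<length L}"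
    then have s: "s < length L" by simp
    show "(\<Sum>k\<in>UNIV. \<Sum>m\<in>UNIV. \<Sum>l\<in>UNIV. \<Sum>e\<in>UNIV.
      of_int (N i k m) * (of_int (N m j l) * (of_int (N l (dual k) e) * (\<Sum>p<fst (L ! s). fst (snd (L ! s)) e p p)))) / snd (snd (L ! s))
      = (\<Sum>p<fst (L ! s). fst (snd (L ! s)) i p p) * (\<Sum>p<fst (L ! s). fst (snd (L ! s)) j p p)"
      unfolding trace_sandwich[OF family_nth(1,2)[OF L s]] using family_nth(3)[OF L s] by simp
  qed
  finally show ?thesis
    by (simp add: sum_list_sum_nth case_prod_unfold lessThan_atLeast0)
qed

end

section \<open>Formal codegrees in rank 7\<close>

lemma in_concat_map: "y \<in> set l \<Longrightarrow> x \<in> set (g y) \<Longrightarrow> x \<in> set (concat (map g l))"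
  by auto

text \<open>The equation 1/D + 2/f + 1/a + 1/b = 1 reads m D = f a b with m = k b - f a and k = f a
  - 2 a - f, so \<open>D\<close> is determined by the other three. The range of \<open>b\<close>
  comes from b \<le> D, which gives m \<le> f a and hence k b \<le> 2 f a.\<close>

definition codegree_tuples :: "(int \<times> int \<times> int \<times> int) list" where
  "codegree_tuples = concat (map (\<lambda>f. concat (map (\<lambda>a.
     let k = f * a - 2 * a - f in if k \<le> 0 then [] else
     concat (map (\<lambda>b. let m = k * b - f * a; n = f * a * b in
       if m \<le> 0 then [] else if n mod m \<noteq> 0 then [] else
       let D = n div m in
       if D < 7 \<or> D mod f \<noteq> 0 \<or> D mod a \<noteq> 0 \<or> D mod b \<noteq> 0 then [] else [(f, a, b, D)])
     [a..2 * f * a div k])) [2..9])) [3..18])"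

lemma codegree_tuples_eq: "codegree_tuples =
  [(3, 4, 13, 156), (3, 4, 14, 84), (3, 4, 15, 60), (3, 4, 16, 48), (3, 4, 18, 36), (3, 4, 24, 24),
   (3, 5, 8, 120), (3, 5, 9, 45), (3, 5, 10, 30), (3, 5, 15, 15), (3, 6, 7, 42), (3, 6, 8, 24),
   (3, 6, 9, 18), (3, 6, 12, 12), (3, 7, 7, 21), (3, 9, 9, 9), (4, 3, 8, 24), (4, 3, 12, 12),
   (4, 4, 5, 20), (4, 4, 6, 12), (4, 4, 8, 8), (5, 2, 11, 110), (5, 2, 12, 60), (5, 2, 15, 30),
   (5, 2, 20, 20), (5, 3, 4, 60), (5, 3, 5, 15), (6, 2, 7, 42), (6, 2, 8, 24), (6, 2, 9, 18),
   (6, 2, 12, 12), (6, 3, 4, 12), (7, 2, 5, 70), (7, 2, 7, 14), (7, 3, 3, 21), (8, 2, 8, 8),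
   (9, 2, 4, 36), (9, 3, 3, 9), (10, 2, 4, 20), (10, 2, 5, 10), (12, 2, 4, 12), (13, 2, 3, 78),
   (14, 2, 3, 42), (15, 2, 3, 30), (18, 2, 3, 18)]"
  by code_simp

lemma codegree_tuples_complete:
  fixes f a b D :: int
  assumes f: "3 \<le> f" and a: "2 \<le> a" and ab: "a \<le> b" and D: "7 \<le> D"
    and dvd: "f dvd D" "a dvd D" "b dvd D"
    and eq: "f * a * b * D = f * a * b + 2 * a * b * D + f * b * D + f * a * D"
  shows "(f, a, b, D) \<in> set codegree_tuples"
proof -
  have fD: "f \<le> D" and bD: "b \<le> D" using dvd D by (auto intro: zdvd_imp_le)
  have eqr: "1 = 2 / real_of_int f + 1 / real_of_int a + 1 / real_of_int b + 1 / real_of_int D"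
  proof -
    have nz: "real_of_int f \<noteq> 0" "real_of_int a \<noteq> 0" "real_of_int b \<noteq> 0" "real_of_int D \<noteq> 0" using f a ab D by auto
    have "2 / real_of_int f + 1 / real_of_int a + 1 / real_of_int b + 1 / real_of_int D
        = real_of_int (f * a * b + 2 * a * b * D + f * b * D + f * a * D) / real_of_int (f * a * b * D)"
      using nz by (simp add: divide_simps) (simp add: algebra_simps)
    also have "\<dots> = 1" unfolding eq[symmetric] using nz by simp
    finally show ?thesis by simp
  qed
  have le: "1 / real_of_int b \<le> 1 / real_of_int a" "1 / real_of_int D \<le> 1 / real_of_int b" "1 / real_of_int D \<le> 1 / real_of_int f"
    "1 / real_of_int f \<le> 1 / 3" "1 / real_of_int a \<le> 1 / 2"
    using f a ab fD bD by (auto intro!: divide_left_mono)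
  have pos: "0 < 1 / real_of_int f" "0 < 1 / real_of_int D" using f D by auto
  \<comment> \<open>The terms with \<open>a\<close>, \<open>b\<close> and \<open>D\<close> are at
    most 1/a each and 2/f is at most 2/3, so 3/a is at least 1/3.\<close>
  have "1 / 9 \<le> 1 / real_of_int a" using eqr le by simp
  then have a9: "a \<le> 9" using a by (simp add: field_simps)
  have "3 \<le> b"
  proof (rule ccontr)
    assume "\<not> 3 \<le> b"
    then have "b = 2" "a = 2" using a ab by auto
    then show False using eqr pos by simp
  qed
  then have "1 / real_of_int b \<le> 1 / 3" by (simp add: field_simps)
  \<comment> \<open>Now 1/a + 1/b is at most 5/6 and 1/D at most 1/f, so 3/f is at least
    1/6.\<close>
  then have "1 / 18 \<le> 1 / real_of_int f" using eqr le by simp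
  then have f18: "f \<le> 18" using f by (simp add: field_simps)
  define k where "k = f * a - 2 * a - f"
  define m where "m = k * b - f * a"
  have mD: "m * D = f * a * b" using eq by (simp add: m_def k_def algebra_simps)
  have mpos: "0 < m"
  proof -
    have "0 < m * D" unfolding mD using f a ab by (intro mult_pos_pos) auto
    then show ?thesis using D by (simp add: zero_less_mult_iff)
  qed
  have "0 < f * a" using f a by (intro mult_pos_pos) auto
  then have kb: "0 < k * b" using mpos unfolding m_def by linarith
  then have kpos: "0 < k" using a ab by (simp add: zero_less_mult_iff)
  have "b \<le> 2 * f * a div k"
  proof -
    have "m * b \<le> m * D" using bD mpos by simp
    then have "m * b \<le> (f * a) * b" by (simp add: mD)
    then have "m \<le> f * a" by (rule mult_right_le_imp_le) (use a ab in simp)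
    then have "b * k \<le> 2 * f * a" by (simp add: m_def algebra_simps)
    then have "b * k div k \<le> 2 * f * a div k" using kpos by (intro zdiv_mono1)
    then show ?thesis using kpos by simp
  qed
  moreover have "f * a * b mod m = 0" "f * a * b div m = D"
    using mD[symmetric] mpos by auto
  ultimately have "(f, a, b, D) \<in> set (let m = k * b - f * a; n = f * a * b in
       if m \<le> 0 then [] else if n mod m \<noteq> 0 then [] else
       let D = n div m in
       if D < 7 \<or> D mod f \<noteq> 0 \<or> D mod a \<noteq> 0 \<or> D mod b \<noteq> 0 then [] else [(f, a, b, D)])" and
     "b \<in> set [a..2 * f * a div k]"
    using mpos D dvd ab by (auto simp: Let_def m_def[symmetric])
  then have "(f, a, b, D) \<in> set (let k = f * a - 2 * a - f in if k \<le> 0 then [] else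
     concat (map (\<lambda>b. let m = k * b - f * a; n = f * a * b in
       if m \<le> 0 then [] else if n mod m \<noteq> 0 then [] else
       let D = n div m in
       if D < 7 \<or> D mod f \<noteq> 0 \<or> D mod a \<noteq> 0 \<or> D mod b \<noteq> 0 then [] else [(f, a, b, D)])
     [a..2 * f * a div k]))"
    using kpos by (subst Let_def) (auto simp: k_def[symmetric] simp del: set_upto)
  moreover have "f \<in> set [3..18]" "a \<in> set [2..9]"
    using f f18 a a9 by (simp_all only: set_upto atLeastAtMost_iff simp_thms)
  ultimately show ?thesis
    unfolding codegree_tuples_def by (intro in_concat_map)
qed

text \<open>The situation reached from a noncommutative Drinfeld ring of rank 7. The data for \<psi>
  and \<phi> enter symmetrically, so the locale can later be interpreted in either order and
  \<open>a < b\<close> assumed.\<close>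

locale integral_decomposition = fusion_data N dual u
  for N :: "'n::finite \<Rightarrow> 'n \<Rightarrow> 'n \<Rightarrow> int" and dual :: "'n \<Rightarrow> 'n" and u :: 'n +
  fixes d :: "'n \<Rightarrow> int" and \<rho> :: "'n \<Rightarrow> nat \<Rightarrow> nat \<Rightarrow> complex" and \<psi> \<phi> :: "'n \<Rightarrow> complex"
    and f a b D :: int
  assumes card7: "CARD('n) = 7"
    and fam: "family [(1, rep_of (\<lambda>i. of_int (d i)), of_int D), (2, \<rho>, of_int f),
      (1, rep_of \<psi>, of_int a), (1, rep_of \<phi>, of_int b)]"
    and d_pos: "0 < d i"
    and codegree_dvd: "f dvd D" "a dvd D" "b dvd D"
    and noncommutative: "\<exists>p q r. N p q r \<noteq> N q p r"
begin

definition \<chi> :: "'n \<Rightarrow> complex" where "\<chi> i = \<rho> i 0 0 + \<rho> i 1 1"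

lemma characters: "character (\<lambda>i. of_int (d i))" "character \<psi>" "character \<phi>" and rep_\<rho>: "rep 2 \<rho>"
  using fam by (simp_all add: family_def rep_of_iff')

lemma codegrees_nonzero: "f \<noteq> 0" "a \<noteq> 0" "b \<noteq> 0" "D \<noteq> 0"
  using fam by (simp_all add: family_def)

lemma unit_values: "d u = 1" "\<psi> u = 1" "\<phi> u = 1" "\<chi> u = 2"
  using character_unit[OF characters(1)] character_unit[OF characters(2)] character_unit[OF characters(3)]
    rep_unit[OF rep_\<rho>, of 0 0] rep_unit[OF rep_\<rho>, of 1 1]
  by (simp_all add: \<chi>_def)

lemma d_dual: "d (dual i) = d i"
  using character_dual[OF characters(1), of i] by simp

lemma unit_eq: "of_bool (i = u) = of_int (d i) / of_int D + \<chi> i / of_int f + \<psi> i / of_int a + \<phi> i / of_int b"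
  using family_unit[OF fam, of i] by (simp add: card7 rep_of_def \<chi>_def numeral_2_eq_2)

lemma two_sided_trace_eq:
  "of_int (two_sided_trace i j) = of_int (d i) * of_int (d j) + \<chi> i * \<chi> j + \<psi> i * \<psi> j + \<phi> i * \<phi> j"
  using two_sided_trace_family[OF fam, of i j] by (simp add: card7 rep_of_def \<chi>_def numeral_2_eq_2)

text \<open>Although \<chi> is not multiplicative, \<open>unit_eq\<close> expresses it through three
  characters, on which duality is complex conjugation.\<close>

lemma \<chi>_dual: "\<chi> (dual i) = cnj (\<chi> i)"
proof -
  have "\<chi> j = of_int f * (of_bool (j = u) - of_int (d j) / of_int D - \<psi> j / of_int a - \<phi> j / of_int b)" for j
    using unit_eq[of j] codegrees_nonzero by (simp add: field_simps)
  from this[of "dual i"] this[of i] show ?thesis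
    using dual_eq_iff[of i u] by (simp add: d_dual character_dual[OF characters(2)] character_dual[OF characters(3)])
qed

lemma norms:
  "(\<Sum>i\<in>UNIV. d i * d i) = D"
  "(\<Sum>i\<in>UNIV. \<chi> i * \<chi> (dual i)) = 2 * of_int f"
  "(\<Sum>i\<in>UNIV. \<psi> i * \<psi> (dual i)) = of_int a"
  "(\<Sum>i\<in>UNIV. \<phi> i * \<phi> (dual i)) = of_int b"
proof -
  have bi: "biorth 1 (rep_of (\<lambda>i. of_int (d i))) (of_int D)" "biorth 2 \<rho> (of_int f)"
    "biorth 1 (rep_of \<psi>) (of_int a)" "biorth 1 (rep_of \<phi>) (of_int b)"
    using fam by (simp_all add: family_def)
  have "complex_of_int (\<Sum>i\<in>UNIV. d i * d i) = of_int D"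
    using biorthD[OF bi(1), of 0 0 0 0] by (simp add: rep_of_def d_dual)
  then show "(\<Sum>i\<in>UNIV. d i * d i) = D" by (simp only: of_int_eq_iff)
  show "(\<Sum>i\<in>UNIV. \<psi> i * \<psi> (dual i)) = of_int a" "(\<Sum>i\<in>UNIV. \<phi> i * \<phi> (dual i)) = of_int b"
    using biorthD[OF bi(3), of 0 0 0 0] biorthD[OF bi(4), of 0 0 0 0] by (simp_all add: rep_of_def)
  show "(\<Sum>i\<in>UNIV. \<chi> i * \<chi> (dual i)) = 2 * of_int f"
    using biorthD[OF bi(2), of 0 0 0 0] biorthD[OF bi(2), of 0 0 1 1] biorthD[OF bi(2), of 1 1 0 0] biorthD[OF bi(2), of 1 1 1 1]
    by (simp add: \<chi>_def algebra_simps sum.distrib)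
qed

lemma orthogonality:
  "(\<Sum>i\<in>UNIV. of_int (d i) * \<chi> (dual i)) = 0"
  "(\<Sum>i\<in>UNIV. of_int (d i) * \<psi> (dual i)) = 0"
  "(\<Sum>i\<in>UNIV. of_int (d i) * \<phi> (dual i)) = 0"
  "(\<Sum>i\<in>UNIV. \<chi> i * \<psi> (dual i)) = 0"
  "(\<Sum>i\<in>UNIV. \<chi> i * \<phi> (dual i)) = 0"
  "(\<Sum>i\<in>UNIV. \<psi> i * \<phi> (dual i)) = 0"
proof -
  have o: "orth 1 (rep_of (\<lambda>i. of_int (d i))) 2 \<rho>" "orth 1 (rep_of (\<lambda>i. of_int (d i))) 1 (rep_of \<psi>)"
    "orth 1 (rep_of (\<lambda>i. of_int (d i))) 1 (rep_of \<phi>)"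
    "orth 2 \<rho> 1 (rep_of \<psi>)" "orth 2 \<rho> 1 (rep_of \<phi>)" "orth 1 (rep_of \<psi>) 1 (rep_of \<phi>)"
    using fam by (simp_all add: family_def)
  show "(\<Sum>i\<in>UNIV. of_int (d i) * \<chi> (dual i)) = 0"
    using orthD[OF o(1), of 0 0 0 0] orthD[OF o(1), of 0 0 1 1]
    by (simp add: \<chi>_def rep_of_def algebra_simps sum.distrib)
  show "(\<Sum>i\<in>UNIV. \<chi> i * \<psi> (dual i)) = 0"
    using orthD[OF o(4), of 0 0 0 0] orthD[OF o(4), of 1 1 0 0]
    by (simp add: \<chi>_def rep_of_def algebra_simps sum.distrib)
  show "(\<Sum>i\<in>UNIV. \<chi> i * \<phi> (dual i)) = 0"
    using orthD[OF o(5), of 0 0 0 0] orthD[OF o(5), of 1 1 0 0]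
    by (simp add: \<chi>_def rep_of_def algebra_simps sum.distrib)
  show "(\<Sum>i\<in>UNIV. of_int (d i) * \<psi> (dual i)) = 0" "(\<Sum>i\<in>UNIV. of_int (d i) * \<phi> (dual i)) = 0"
    "(\<Sum>i\<in>UNIV. \<psi> i * \<phi> (dual i)) = 0"
    using orthD[OF o(2), of 0 0 0 0] orthD[OF o(3), of 0 0 0 0] orthD[OF o(6), of 0 0 0 0]
    by (simp_all add: rep_of_def)
qed

lemma norm_squares:
  "(\<Sum>i\<in>UNIV. (cmod (\<chi> i))\<^sup>2) = 2 * of_int f"
  "(\<Sum>i\<in>UNIV. (cmod (\<psi> i))\<^sup>2) = of_int a"
  "(\<Sum>i\<in>UNIV. (cmod (\<phi> i))\<^sup>2) = of_int b"
proof -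
  have *: "(\<Sum>i\<in>UNIV. (cmod (h i))\<^sup>2) = of_int c"
    if "(\<Sum>i\<in>UNIV. h i * h (dual i)) = complex_of_int c" "\<And>i. h (dual i) = cnj (h i)" for h :: "'n \<Rightarrow> complex" and c
  proof -
    have "complex_of_real (\<Sum>i\<in>UNIV. (cmod (h i))\<^sup>2) = of_real (of_int c)"
      using that by (simp add: complex_norm_square flip: of_real_power)
    then show ?thesis by (simp only: of_real_eq_iff)
  qed
  show "(\<Sum>i\<in>UNIV. (cmod (\<chi> i))\<^sup>2) = 2 * of_int f"
    using *[of \<chi> "2 * f"] norms(2) \<chi>_dual by simp
  show "(\<Sum>i\<in>UNIV. (cmod (\<psi> i))\<^sup>2) = of_int a" "(\<Sum>i\<in>UNIV. (cmod (\<phi> i))\<^sup>2) = of_int b"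
    using *[of \<psi> a] *[of \<phi> b] norms(3,4) character_dual[OF characters(2)] character_dual[OF characters(3)] by simp_all
qed

text \<open>A function supported at the unit alone cannot be orthogonal to the dimensions, as these
  take the value 1 there; so a second value is nonzero.\<close>

lemma norm_greater:
  assumes "(\<Sum>i\<in>UNIV. of_int (d i) * h (dual i)) = 0" "h u \<noteq> 0"
  shows "(cmod (h u))\<^sup>2 < (\<Sum>i\<in>UNIV. (cmod (h i))\<^sup>2)"
proof -
  have "\<exists>i. i \<noteq> u \<and> h i \<noteq> 0"
  proof (rule ccontr)
    assume "\<not> (\<exists>i. i \<noteq> u \<and> h i \<noteq> 0)"
    then have "h (dual i) = (if i = u then h u else 0)" for i
      using dual_eq_iff[of i u] by auto
    then have "(\<Sum>i\<in>UNIV. of_int (d i) * h (dual i)) = (\<Sum>i\<in>UNIV. if i = u then h u else 0)"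
      using unit_values(1) by (intro sum.cong) auto
    then show False using assms by simp
  qed
  then obtain i where i: "i \<noteq> u" "h i \<noteq> 0" by blast
  then have "(cmod (h u))\<^sup>2 < (cmod (h u))\<^sup>2 + (cmod (h i))\<^sup>2" by simp
  also have "\<dots> = (\<Sum>i\<in>{u, i}. (cmod (h i))\<^sup>2)" using i by simp
  also have "\<dots> \<le> (\<Sum>i\<in>UNIV. (cmod (h i))\<^sup>2)" by (intro sum_mono2) auto
  finally show ?thesis .
qed

text \<open>The strict inequality \<open>norm_greater\<close> reads 4 < 2 f for \<chi>, and 1 < a, 1
  < b for the two characters. The bound on \<open>D\<close> counts seven squares of positive
  integers.\<close>

lemma codegree_bounds: "3 \<le> f" "2 \<le> a" "2 \<le> b" "7 \<le> D"
proof -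
  show "3 \<le> f" using norm_greater[OF orthogonality(1)] by (simp add: norm_squares unit_values)
  show "2 \<le> a" using norm_greater[OF orthogonality(2)] by (simp add: norm_squares unit_values)
  show "2 \<le> b" using norm_greater[OF orthogonality(3)] by (simp add: norm_squares unit_values)
  have "1 \<le> d i * d i" for i using d_pos[of i] by (metis int_one_le_iff_zero_less mult_pos_pos)
  then have "(\<Sum>i\<in>(UNIV::'n set). 1) \<le> (\<Sum>i\<in>UNIV. d i * d i)" by (intro sum_mono) auto
  then show "7 \<le> D" by (simp add: norms card7)
qed

lemma codegree_equation: "f * a * b * D = f * a * b + 2 * a * b * D + f * b * D + f * a * D"
proof -
  have "complex_of_int (f * a * b * D) = of_int (f * a * b + 2 * a * b * D + f * b * D + f * a * D)"
    using unit_eq[of u] codegrees_nonzero by (simp add: unit_values field_simps)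
  then show ?thesis by (simp only: of_int_eq_iff)
qed

lemma codegree_tuple: "a \<le> b \<Longrightarrow> (f, a, b, D) \<in> set codegree_tuples"
  by (rule codegree_tuples_complete[OF codegree_bounds(1,2) _ codegree_bounds(4) codegree_dvd codegree_equation])

text \<open>For a commutator \<open>w\<close>, the integral element \<open>w w\<^sup>*\<close> vanishes under all characters; its traces
  therefore isolate the two-dimensional representation over the rationals.\<close>

lemma \<chi>_rational: "\<chi> i \<in> \<rat>"
proof -
  obtain p q r where pqr: "N p q r \<noteq> N q p r" using noncommutative by blast
  define w where "w k = N p q k - N q p k" for k
  \<comment> \<open>The coefficients of w times its dual. The one at the unit is the sum of the
    squares of the entries of \<open>w\<close>, hence positive.\<close>
  define v where "v c = (\<Sum>i\<in>UNIV. \<Sum>j\<in>UNIV. w i * w j * N i (dual j) c)" for c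
  have vchar: "(\<Sum>c\<in>UNIV. of_int (v c) * \<theta> c) = 0" if \<theta>: "character \<theta>" for \<theta>
  proof -
    have 0: "(\<Sum>i\<in>UNIV. of_int (w i) * \<theta> i) = 0"
      by (simp add: w_def left_diff_distrib sum_subtractf character_mult[OF \<theta>, symmetric])
    have "(\<Sum>c\<in>UNIV. of_int (v c) * \<theta> c) = (\<Sum>c\<in>UNIV. \<Sum>i\<in>UNIV. \<Sum>j\<in>UNIV. of_int (w i) * of_int (w j) * (of_int (N i (dual j) c) * \<theta> c))"
      by (simp add: v_def sum_distrib_right mult.assoc)
    also have "\<dots> = (\<Sum>i\<in>UNIV. \<Sum>c\<in>UNIV. \<Sum>j\<in>UNIV. of_int (w i) * of_int (w j) * (of_int (N i (dual j) c) * \<theta> c))"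
      by (rule sum.swap)
    also have "\<dots> = (\<Sum>i\<in>UNIV. \<Sum>j\<in>UNIV. \<Sum>c\<in>UNIV. of_int (w i) * of_int (w j) * (of_int (N i (dual j) c) * \<theta> c))"
      by (rule sum.cong[OF refl]) (rule sum.swap)
    also have "\<dots> = (\<Sum>i\<in>UNIV. \<Sum>j\<in>UNIV. of_int (w i) * of_int (w j) * (\<theta> i * \<theta> (dual j)))"
      by (simp only: sum_distrib_left[symmetric] character_mult[OF \<theta>])
    also have "\<dots> = (\<Sum>i\<in>UNIV. of_int (w i) * \<theta> i * (\<Sum>j\<in>UNIV. of_int (w j) * \<theta> (dual j)))"
      by (simp add: sum_distrib_left mult_ac)
    also have "\<dots> = 0" using 0 by (simp flip: sum_distrib_right)
    finally show ?thesis .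
  qed
  have vu: "v u = (\<Sum>i\<in>UNIV. w i * w i)"
    by (simp add: v_def N_unit of_bool_def if_distrib[of "(*) _"] cong: if_cong)
  have "0 < w r * w r" using pqr by (simp add: w_def zero_less_mult_iff) linarith
  also have "\<dots> \<le> v u" unfolding vu by (rule member_le_sum) auto
  finally have vpos: "0 < v u" .
  have "(\<Sum>c\<in>UNIV. complex_of_int (v c) * of_bool (c = u)) = of_int (v u)"
    by (simp add: of_bool_def if_distrib[of "(*) _"] cong: if_cong)
  moreover have "(\<Sum>c\<in>UNIV. complex_of_int (v c) * of_bool (c = u)) = (\<Sum>c\<in>UNIV. of_int (v c) * \<chi> c) / of_int f"
    using vchar[OF characters(1)] vchar[OF characters(2)] vchar[OF characters(3)]
    by (simp add: unit_eq distrib_left sum.distrib flip: sum_divide_distrib)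
  ultimately have v\<chi>: "(\<Sum>c\<in>UNIV. of_int (v c) * \<chi> c) = of_int (f * v u)"
    using codegrees_nonzero by (simp add: field_simps)
  \<comment> \<open>Weighting the trace identity by \<open>v\<close> removes the three characters
    and leaves \<chi>(i) times a nonzero integer.\<close>
  have "of_int (\<Sum>c\<in>UNIV. v c * two_sided_trace i c) = (\<Sum>c\<in>UNIV. of_int (d i) * (of_int (v c) * of_int (d c))
      + \<chi> i * (of_int (v c) * \<chi> c) + \<psi> i * (of_int (v c) * \<psi> c) + \<phi> i * (of_int (v c) * \<phi> c))"
    by (simp add: two_sided_trace_eq algebra_simps)
  also have "\<dots> = \<chi> i * of_int (f * v u)"
    using vchar[OF characters(1)] vchar[OF characters(2)] vchar[OF characters(3)] v\<chi>
    by (simp add: sum.distrib flip: sum_distrib_left)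
  finally have eq: "\<chi> i = of_int (\<Sum>c\<in>UNIV. v c * two_sided_trace i c) / of_int (f * v u)"
    using vpos codegrees_nonzero by (simp add: field_simps)
  show ?thesis unfolding eq by (intro Rats_divide Rats_of_int)
qed

lemma character_sum: "\<psi> i + \<phi> i = of_int (two_sided_trace i u) - of_int (d i) - 2 * \<chi> i"
  using two_sided_trace_eq[of i u] by (simp add: unit_values)

text \<open>Both \<psi> + \<phi> and \<psi>/a + \<phi>/b are rational, and these combinations are
  independent when \<open>a\<close> and \<open>b\<close> differ.\<close>

lemma characters_rational:
  assumes "a \<noteq> b" shows "\<psi> i \<in> \<rat>" "\<phi> i \<in> \<rat>"
proof -
  have s: "\<psi> i + \<phi> i \<in> \<rat>"
    unfolding character_sum using \<chi>_rational by (intro Rats_diff Rats_mult) auto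
  have "\<psi> i / of_int a + \<phi> i / of_int b = of_bool (i = u) - of_int (d i) / of_int D - \<chi> i / of_int f"
    using unit_eq[of i] by (simp add: algebra_simps)
  also have "\<dots> \<in> \<rat>"
    using \<chi>_rational by (intro Rats_diff Rats_divide) (auto simp: of_bool_def)
  finally have t: "\<psi> i / of_int a + \<phi> i / of_int b \<in> \<rat>" .
  have "\<psi> i * of_int (b - a) = of_int a * (of_int b * (\<psi> i / of_int a + \<phi> i / of_int b) - (\<psi> i + \<phi> i))"
    using codegrees_nonzero by (simp add: field_simps)
  also have "\<dots> \<in> \<rat>" using s t by (intro Rats_mult Rats_diff) auto
  finally have "\<psi> i * of_int (b - a) / of_int (b - a) \<in> \<rat>"
    by (intro Rats_divide) auto
  then show \<psi>: "\<psi> i \<in> \<rat>" using assms by simp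
  show "\<phi> i \<in> \<rat>" using Rats_diff[OF s \<psi>] by simp
qed

section \<open>Distinctness of the codegrees of the two remaining characters\<close>

lemma character_invertible:
  assumes "d i = 1" and \<theta>: "character \<theta>"
  shows "\<theta> i * \<theta> (dual i) = 1"
proof -
  have "complex_of_int (\<Sum>e\<in>UNIV. N i (dual i) e * d e) = of_int (d i * d (dual i))"
    using character_mult[OF characters(1), of i "dual i"] by simp
  then have "(\<Sum>e\<in>UNIV. N i (dual i) e * d e) = 1"
    using assms d_dual[of i] by (simp only: of_int_eq_iff)
  then have "N i (dual i) u * d u + (\<Sum>e\<in>UNIV - {u}. N i (dual i) e * d e) = 1"
    by (simp add: sum.remove[of UNIV u])
  then have "(\<Sum>e\<in>UNIV - {u}. N i (dual i) e * d e) = 0"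
    by (simp add: N_unit unit_values)
  then have "\<forall>e\<in>UNIV - {u}. N i (dual i) e * d e = 0"
    by (subst (asm) sum_nonneg_eq_0_iff) (auto simp: N_nonneg d_pos less_imp_le)
  then have "N i (dual i) e = of_bool (e = u)" for e
    using d_pos[of e] by (cases "e = u") (auto simp: N_unit)
  then show ?thesis
    by (simp add: character_mult[OF \<theta>] character_unit[OF \<theta>] of_bool_def
        if_distrib[of of_int] if_distrib[of "\<lambda>x. x * _"] cong: if_cong)
qed

lemma cmod_invertible: "d i = 1 \<Longrightarrow> character \<theta> \<Longrightarrow> (cmod (\<theta> i))\<^sup>2 = 1"
  using character_invertible[of i \<theta>] character_dual[of \<theta> i]
  by (simp add: complex_norm_square[symmetric] flip: of_real_power)

text \<open>Each basis element of dimension 1 contributes exactly 1 to the norm \<open>a\<close> of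
  \<psi>.\<close>

lemma card_invertible_le: "int (card {i. d i = 1}) \<le> a"
proof -
  have "real (card {i. d i = 1}) = (\<Sum>i\<in>{i. d i = 1}. (cmod (\<psi> i))\<^sup>2)"
    using cmod_invertible[OF _ characters(2)] by simp
  also have "\<dots> \<le> (\<Sum>i\<in>UNIV. (cmod (\<psi> i))\<^sup>2)" by (intro sum_mono2) auto
  finally show ?thesis by (simp add: norm_squares)
qed

text \<open>Seven squares summing to 9 exceed seven ones by 2, whereas a single dimension above 1
  already exceeds by 3.\<close>

lemma dimension_not_9: "D \<noteq> 9"
proof
  assume D: "D = 9"
  have s: "(\<Sum>i\<in>(UNIV::'n set). d i * d i - 1) = 2"
    using norms(1) by (simp add: sum_subtractf card7 D)
  have nn: "0 \<le> d i * d i - 1" for i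
    using d_pos[of i] by (metis diff_ge_0_iff_ge int_one_le_iff_zero_less mult_pos_pos)
  have le: "d i * d i - 1 \<le> 2" for i
    unfolding s[symmetric] by (rule member_le_sum[OF UNIV_I nn finite])
  have ge: "3 \<le> d i * d i - 1" if "d i \<noteq> 1" for i
    using mult_mono[of 2 "d i" 2 "d i"] d_pos[of i] that by auto
  have "d i = 1" for i using le[of i] ge[of i] by linarith
  then show False using s by simp
qed

lemma codegrees_distinct: "a \<noteq> b"
proof
  assume ab: "a = b"
  then have "(f, a, a, D) \<in> set codegree_tuples" using codegree_tuple by simp
  then consider "f = 3" "a = 7" "D = 21" | "f = 7" "a = 3" "D = 21" | "D = 9"
    unfolding codegree_tuples_eq by auto
  then show False
  proof cases
    case 1
    \<comment> \<open>Eliminating \<psi> + \<phi> between the unit identity and the trace of left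
      multiplication gives this integer for \<chi> away from the unit.\<close>
    define y where "y i = 2 * d i - 3 * two_sided_trace i u" for i
    have y: "\<chi> i = of_int (y i)" if "i \<noteq> u" for i
    proof -
      have "of_int (d i) / 21 + \<chi> i / 3 + (\<psi> i + \<phi> i) / 7 = 0"
        using unit_eq[of i] that 1 ab by (simp add: add_divide_distrib algebra_simps)
      then have "7 * \<chi> i = 7 * of_int (y i)" unfolding character_sum by (simp add: y_def field_simps)
      then show ?thesis by simp
    qed
    have "(\<Sum>i\<in>UNIV. (cmod (\<chi> i))\<^sup>2) = 4 + (\<Sum>i\<in>UNIV - {u}. (cmod (\<chi> i))\<^sup>2)"
      by (simp add: sum.remove[of UNIV u] unit_values)
    also have "(\<Sum>i\<in>UNIV - {u}. (cmod (\<chi> i))\<^sup>2) = (\<Sum>i\<in>UNIV - {u}. of_int (y i * y i))"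
      by (intro sum.cong) (auto simp: y power2_eq_square simp flip: of_int_mult)
    finally have "real_of_int (\<Sum>i\<in>UNIV - {u}. y i * y i) = of_int 2"
      by (simp add: norm_squares 1)
    then have sy: "(\<Sum>i\<in>UNIV - {u}. y i * y i) = 2" by (simp only: of_int_eq_iff)
    \<comment> \<open>If \<open>y i = 0\<close>, then 3 divides the dimension; otherwise the left
      side is at most 1. Since the squares of \<open>y\<close> sum to 2, the six non-unit squared
      dimensions would sum to at least 54 - 16 = 38 instead of 20.\<close>
    have "9 - 8 * (y i * y i) \<le> d i * d i" for i
    proof (cases "y i = 0")
      case True
      then have "2 * d i = 3 * two_sided_trace i u" by (simp add: y_def)
      then have "3 \<le> d i" using d_pos[of i] by presburger
      then show ?thesis using mult_mono[of 3 "d i" 3 "d i"] True by simp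
    next
      case False
      then have "1 \<le> y i * y i" by (smt (verit) mult_le_0_iff zero_less_mult_iff)
      moreover have "1 \<le> d i * d i" using d_pos[of i] by (metis int_one_le_iff_zero_less mult_pos_pos)
      ultimately show ?thesis by simp
    qed
    then have "(\<Sum>i\<in>UNIV - {u}. 9 - 8 * (y i * y i)) \<le> (\<Sum>i\<in>UNIV - {u}. d i * d i)" by (intro sum_mono) auto
    moreover have "(\<Sum>i\<in>UNIV - {u}. d i * d i) = 20"
      using norms(1) by (simp add: sum.remove[of UNIV u] unit_values 1)
    moreover have "(\<Sum>i\<in>UNIV - {u}. 9 - 8 * (y i * y i)) = 38"
      by (simp add: sum_subtractf card7 sy flip: sum_distrib_left)
    ultimately show False by simp
  next
    case 2
    \<comment> \<open>The excess of the squared dimension over its least possible value, which is 1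
      or 4; it is 0 or at least 5. With at most three elements of dimension 1 the total 3 k - 7 is
      at most 2, so all excesses vanish and 3 k = 7.\<close>
    define e where "e i = d i * d i - (if d i = 1 then 1 else 4)" for i
    have k: "int (card {i. d i = 1}) \<le> 3" using card_invertible_le 2 by simp
    have "(\<Sum>i\<in>UNIV. (if d i = 1 then 1 else 4 :: int)) = 28 - 3 * int (card {i. d i = 1})"
    proof -
      have "(\<Sum>i\<in>UNIV. (if d i = 1 then 1 else 4 :: int)) = (\<Sum>i\<in>(UNIV::'n set). 4 - 3 * of_bool (d i = 1))"
        by (intro sum.cong) auto
      then show ?thesis by (simp add: sum_subtractf card7 flip: sum_distrib_left)
    qed
    then have se: "(\<Sum>i\<in>UNIV. e i) = 3 * int (card {i. d i = 1}) - 7"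
      using norms(1) 2 by (simp add: e_def sum_subtractf)
    have e: "e i = 0 \<or> 5 \<le> e i" for i
    proof -
      consider "d i = 1" | "d i = 2" | "3 \<le> d i" using d_pos[of i] by force
      then show ?thesis
      proof cases
        case 3
        then show ?thesis using mult_mono[of 3 "d i" 3 "d i"] by (simp add: e_def)
      qed (auto simp: e_def)
    qed
    have "0 \<le> e i" for i using e[of i] by auto
    then have le: "e i \<le> 3 * int (card {i. d i = 1}) - 7" for i
      unfolding se[symmetric] by (intro member_le_sum) auto
    have "e i = 0" for i using e[of i] le[of i] k by linarith
    then have "3 * int (card {i. d i = 1}) = 7" using se by simp
    then show False by presburger
  next
    case 3
    then show False using dimension_not_9 by simp
  qed
qed

lemma characters_integral: "\<psi> i \<in> \<int>" "\<phi> i \<in> \<int>"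
  using rational_character_integral characters(2,3) characters_rational[OF codegrees_distinct] by auto

text \<open>The trace with the unit makes 2 \<chi> an integer, and the trace with the element itself
  makes the square of \<chi> one; an integer whose square is divisible by 4 is even.\<close>

lemma \<chi>_integral: "\<chi> i \<in> \<int>"
proof -
  obtain p q where pq: "\<psi> i = of_int p" "\<phi> i = of_int q"
    using characters_integral by (metis Ints_cases)
  have "2 * \<chi> i = of_int (two_sided_trace i u - d i - p - q)"
    using character_sum[of i] by (simp add: pq algebra_simps)
  then obtain m where m: "2 * \<chi> i = of_int m" by blast
  have "\<chi> i * \<chi> i = of_int (two_sided_trace i i - d i * d i - p * p - q * q)"
    using two_sided_trace_eq[of i i] by (simp add: pq algebra_simps)
  then obtain k where k: "\<chi> i * \<chi> i = of_int k" by blast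
  have "complex_of_int (m * m) = (2 * \<chi> i) * (2 * \<chi> i)" by (simp add: m)
  also have "\<dots> = of_int (4 * k)" using k by simp
  finally have "m * m = 4 * k" by (simp only: of_int_eq_iff)
  then have "even (m * m)" by simp
  then have "even m" by simp
  then obtain l where "m = 2 * l" by (auto elim: evenE)
  then have "\<chi> i = of_int l" using m by simp
  then show ?thesis by simp
qed

end

section \<open>Character tables\<close>

text \<open>The values of the dimension, \<chi>, \<psi> and \<phi> at one basis element.\<close>

type_synonym column = "int \<times> int \<times> int \<times> int"

definition square_bounded :: "int \<Rightarrow> int list" where
  "square_bounded m = filter (\<lambda>z. z * z \<le> m) [- m..m]"

text \<open>The dimension \<open>d\<close> is not searched but solved from the unit identity
  multiplied by \<open>D\<close>. The square bounds are the norms 2 f, a, b and D less the shares 4,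
  1, 1, 1 of the unit. At an invertible element both characters have absolute value 1.\<close>

definition columns :: "int \<Rightarrow> int \<Rightarrow> int \<Rightarrow> int \<Rightarrow> column list" where
  "columns f a b D = (let ps = square_bounded (a - 1); qs = square_bounded (b - 1); F = D div f; A = D div a; B = D div b in
     concat (map (\<lambda>x. concat (map (\<lambda>p. concat (map (\<lambda>q.
       let d = - (F * x + A * p + B * q) in
       if 1 \<le> d \<and> d * d \<le> D - 1 \<and> (d = 1 \<longrightarrow> p * p = 1 \<and> q * q = 1) then [(d, x, p, q)] else []) qs)) ps))
     (square_bounded (2 * f - 4))))"

text \<open>The numerical arguments are the norms and the inner product of the first two characters still to
  be attained; a candidate column may be used repeatedly.\<close>

fun extend :: "nat \<Rightarrow> column list \<Rightarrow> int \<Rightarrow> int \<Rightarrow> int \<Rightarrow> int \<Rightarrow> int \<Rightarrow> column list list" where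
  "extend 0 cs nd nx np nq o' = (if nd = 0 \<and> nx = 0 \<and> np = 0 \<and> nq = 0 \<and> o' = 0 then [[]] else [])"
| "extend (Suc n) [] nd nx np nq o' = []"
| "extend (Suc n) ((d, x, p, q) # cs) nd nx np nq o' =
     (if d * d \<le> nd \<and> x * x \<le> nx \<and> p * p \<le> np \<and> q * q \<le> nq
      then map ((#) (d, x, p, q))
        (extend n ((d, x, p, q) # cs) (nd - d * d) (nx - x * x) (np - p * p) (nq - q * q) (o' - d * x))
      else []) @ extend (Suc n) cs nd nx np nq o'"

text \<open>The six non-unit columns must account for the norms less the share of the unit; the
  final argument is -2 because the unit contributes 1 times 2 to the vanishing product of dimension
  and \<chi>. Equal \<open>a\<close> and \<open>b\<close> are skipped in view of
  \<open>codegrees_distinct\<close>.\<close>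

definition tables :: "((int \<times> int \<times> int \<times> int) \<times> column list) list" where
  "tables = concat (map (\<lambda>(f, a, b, D). if a = b then [] else
     map (Pair (f, a, b, D)) (extend 6 (columns f a b D) (D - 1) (2 * f - 4) (a - 1) (b - 1) (- 2))) codegree_tuples)"

lemma tables_eq: "tables =
  [((3, 4, 15, 60), [(1, -1, 1, 1), (1, -1, 1, 1), (3, 0, -1, 3), (4, 0, 0, -1), (4, 0, 0, -1), (4, 0, 0, -1)]),
   ((3, 4, 18, 36), [(1, -1, 1, 1), (1, -1, 1, 1), (3, 0, -1, 3), (4, 0, 0, -2), (2, 0, 0, -1), (2, 0, 0, -1)]),
   ((3, 4, 24, 24), [(1, -1, 1, 1), (1, -1, 1, 1), (3, 0, -1, 3), (2, 0, 0, -2), (2, 0, 0, -2), (2, 0, 0, -2)]),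
   ((3, 6, 7, 42), [(1, -1, 1, 1), (1, -1, 1, 1), (1, 0, -1, 1), (1, 0, -1, 1), (1, 0, -1, 1), (6, 0, 0, -1)]),
   ((14, 2, 3, 42), [(3, -1, 0, 0), (3, -1, 0, 0), (3, -1, 0, 0), (3, -1, 0, 0), (1, 2, -1, 1), (2, 4, 0, -1)])]"
  unfolding tables_def codegree_tuples_eq by code_simp

text \<open>Multisets are the right invariant: the search uses the first candidate as often as it
  occurs and then discards it for good. The cut-offs are harmless since the remaining squares are
  nonnegative.\<close>

lemma extend_complete:
  assumes "size M = n" "set_mset M \<subseteq> set cs"
    "(\<Sum>(d, x, p, q)\<in>#M. d * d) = nd" "(\<Sum>(d, x, p, q)\<in>#M. x * x) = nx"
    "(\<Sum>(d, x, p, q)\<in>#M. p * p) = np" "(\<Sum>(d, x, p, q)\<in>#M. q * q) = nq"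
    "(\<Sum>(d, x, p, q)\<in>#M. d * x) = o'"
  shows "\<exists>l\<in>set (extend n cs nd nx np nq o'). mset l = M"
  using assms
proof (induction n cs nd nx np nq o' arbitrary: M rule: extend.induct)
  case (1 cs nd nx np nq o')
  then show ?case by simp
next
  case (2 n nd nx np nq o')
  then show ?case by simp
next
  case (3 n d x p q cs nd nx np nq o')
  show ?case
  proof (cases "(d, x, p, q) \<in># M")
    case True
    then obtain M' where M': "M = add_mset (d, x, p, q) M'" by (metis mset_add)
    have nonneg: "0 \<le> (\<Sum>c\<in>#M'. h c)" if "\<And>c. 0 \<le> h c" for h :: "column \<Rightarrow> int"
      using that by (induction M') (auto intro: add_nonneg_nonneg)
    have "0 \<le> (\<Sum>(d, x, p, q)\<in>#M'. d * d)" "0 \<le> (\<Sum>(d, x, p, q)\<in>#M'. x * x)"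
      "0 \<le> (\<Sum>(d, x, p, q)\<in>#M'. p * p)" "0 \<le> (\<Sum>(d, x, p, q)\<in>#M'. q * q)"
      by (rule nonneg, simp split: prod.splits)+
    then have le: "d * d \<le> nd \<and> x * x \<le> nx \<and> p * p \<le> np \<and> q * q \<le> nq"
      using "3.prems"(3-6) unfolding M' image_mset_add_mset sum_mset.add_mset prod.case by linarith
    have "\<exists>l\<in>set (extend n ((d, x, p, q) # cs) (nd - d * d) (nx - x * x) (np - p * p) (nq - q * q) (o' - d * x)). mset l = M'"
      using "3.prems" by (intro "3.IH"(1)[OF le]) (auto simp: M')
    then obtain l where "l \<in> set (extend n ((d, x, p, q) # cs) (nd - d * d) (nx - x * x) (np - p * p) (nq - q * q) (o' - d * x))" "mset l = M'"
      by blast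
    then show ?thesis using le by (intro bexI[of _ "(d, x, p, q) # l"]) (auto simp: M')
  next
    case False
    then have "\<exists>l\<in>set (extend (Suc n) cs nd nx np nq o'). mset l = M"
      using "3.prems" by (intro "3.IH"(2)) auto
    then show ?thesis by auto
  qed
qed

text \<open>Lifts a list of columns found by the search to an enumeration of the basis elements
  carrying them.\<close>

lemma enumerate_fibres:
  assumes "finite A" "image_mset h (mset_set A) = mset l"
  shows "\<exists>xs. distinct xs \<and> set xs = A \<and> map h xs = l"
  using assms
proof (induction l arbitrary: A)
  case Nil
  then show ?case by (simp add: mset_set_empty_iff)
next
  case (Cons c l)
  have "c \<in># image_mset h (mset_set A)" using Cons.prems by simp
  then obtain i where i: "i \<in> A" "h i = c" using Cons.prems(1) by auto
  have "mset_set A = add_mset i (mset_set (A - {i}))"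
    using i Cons.prems(1) by (simp add: mset_set.remove)
  then have "image_mset h (mset_set (A - {i})) = mset l" using Cons.prems(2) i by simp
  then obtain xs where "distinct xs" "set xs = A - {i}" "map h xs = l"
    using Cons.IH[of "A - {i}"] Cons.prems(1) by auto
  then show ?case using i by (intro exI[of _ "i # xs"]) auto
qed

lemma square_bounded_complete: "z * z \<le> m \<Longrightarrow> z \<in> set (square_bounded m)"
proof -
  assume z: "z * z \<le> m"
  have "\<bar>z\<bar> * 1 \<le> \<bar>z\<bar> * \<bar>z\<bar>" if "z \<noteq> 0" using that by (intro mult_left_mono) auto
  then have "\<bar>z\<bar> \<le> m" using z by (cases "z = 0") (auto simp flip: abs_mult)
  then show ?thesis using z by (auto simp: square_bounded_def)
qed

lemma columns_complete:
  assumes "x * x \<le> 2 * f - 4" "p * p \<le> a - 1" "q * q \<le> b - 1"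
    and "d + (D div f * x + D div a * p + D div b * q) = 0" "1 \<le> d" "d * d \<le> D - 1"
    and "d = 1 \<Longrightarrow> p * p = 1 \<and> q * q = 1"
  shows "(d, x, p, q) \<in> set (columns f a b D)"
proof -
  have d: "d = - (D div f * x + D div a * p + D div b * q)" using assms(4) by simp
  show ?thesis
    unfolding columns_def Let_def
  proof (intro in_concat_map)
    show "x \<in> set (square_bounded (2 * f - 4))" "p \<in> set (square_bounded (a - 1))" "q \<in> set (square_bounded (b - 1))"
      using assms(1-3) by (simp_all add: square_bounded_complete)
    show "(d, x, p, q) \<in> set (if 1 \<le> - (D div f * x + D div a * p + D div b * q) \<and>
        - (D div f * x + D div a * p + D div b * q) * - (D div f * x + D div a * p + D div b * q) \<le> D - 1 \<and>
        (- (D div f * x + D div a * p + D div b * q) = 1 \<longrightarrow> p * p = 1 \<and> q * q = 1)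
       then [(- (D div f * x + D div a * p + D div b * q), x, p, q)] else [])"
      unfolding d[symmetric] using assms(5-7) by simp
  qed
qed

context integral_decomposition
begin

text \<open>Integer copies of the complex values; the floor is exact because the values are known to
  be integers.\<close>

definition X :: "'n \<Rightarrow> int" where "X i = \<lfloor>Re (\<chi> i)\<rfloor>"
definition P :: "'n \<Rightarrow> int" where "P i = \<lfloor>Re (\<psi> i)\<rfloor>"
definition Q :: "'n \<Rightarrow> int" where "Q i = \<lfloor>Re (\<phi> i)\<rfloor>"

lemma integral_values: "\<chi> i = of_int (X i)" "\<psi> i = of_int (P i)" "\<phi> i = of_int (Q i)"
  using \<chi>_integral[of i] characters_integral[of i] by (auto simp: X_def P_def Q_def elim!: Ints_cases)

lemma integral_dual: "X (dual i) = X i" "P (dual i) = P i" "Q (dual i) = Q i"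
  using \<chi>_dual[of i] character_dual[OF characters(2), of i] character_dual[OF characters(3), of i]
  by (simp_all add: integral_values)

lemma integral_unit: "X u = 2" "P u = 1" "Q u = 1"
  using unit_values by (simp_all add: X_def P_def Q_def)

lemma integral_trace: "two_sided_trace i j = d i * d j + X i * X j + P i * P j + Q i * Q j"
proof -
  have "complex_of_int (two_sided_trace i j) = of_int (d i * d j + X i * X j + P i * P j + Q i * Q j)"
    using two_sided_trace_eq[of i j] by (simp add: integral_values)
  then show ?thesis by (simp only: of_int_eq_iff)
qed

lemma integral_norms:
  "(\<Sum>i\<in>UNIV. d i * d i) = D" "(\<Sum>i\<in>UNIV. X i * X i) = 2 * f" "(\<Sum>i\<in>UNIV. P i * P i) = a"
  "(\<Sum>i\<in>UNIV. Q i * Q i) = b" "(\<Sum>i\<in>UNIV. d i * X i) = 0"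
proof -
  have "complex_of_int (\<Sum>i\<in>UNIV. X i * X i) = of_int (2 * f)" "complex_of_int (\<Sum>i\<in>UNIV. P i * P i) = of_int a"
    "complex_of_int (\<Sum>i\<in>UNIV. Q i * Q i) = of_int b" "complex_of_int (\<Sum>i\<in>UNIV. d i * X i) = of_int 0"
    using norms(2-4) orthogonality(1) by (simp_all add: integral_values integral_dual)
  then show "(\<Sum>i\<in>UNIV. X i * X i) = 2 * f" "(\<Sum>i\<in>UNIV. P i * P i) = a"
    "(\<Sum>i\<in>UNIV. Q i * Q i) = b" "(\<Sum>i\<in>UNIV. d i * X i) = 0" by (simp_all only: of_int_eq_iff)
qed (rule norms(1))

lemma character_products:
  "d i * d j = (\<Sum>k\<in>UNIV. N i j k * d k)" "P i * P j = (\<Sum>k\<in>UNIV. N i j k * P k)"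
  "Q i * Q j = (\<Sum>k\<in>UNIV. N i j k * Q k)"
proof -
  have "complex_of_int (d i * d j) = of_int (\<Sum>k\<in>UNIV. N i j k * d k)"
    "complex_of_int (P i * P j) = of_int (\<Sum>k\<in>UNIV. N i j k * P k)"
    "complex_of_int (Q i * Q j) = of_int (\<Sum>k\<in>UNIV. N i j k * Q k)"
    using character_mult[OF characters(1), of i j] character_mult[OF characters(2), of i j] character_mult[OF characters(3), of i j]
    by (simp_all add: integral_values)
  then show "d i * d j = (\<Sum>k\<in>UNIV. N i j k * d k)" "P i * P j = (\<Sum>k\<in>UNIV. N i j k * P k)"
    "Q i * Q j = (\<Sum>k\<in>UNIV. N i j k * Q k)" by (simp_all only: of_int_eq_iff)
qed

lemma invertible_values: "d i = 1 \<Longrightarrow> P i * P i = 1" "d i = 1 \<Longrightarrow> Q i * Q i = 1"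
proof -
  assume "d i = 1"
  then have "complex_of_int (P i * P i) = of_int 1" "complex_of_int (Q i * Q i) = of_int 1"
    using character_invertible[OF _ characters(2), of i] character_invertible[OF _ characters(3), of i]
    by (simp_all add: integral_values integral_dual)
  then show "P i * P i = 1" "Q i * Q i = 1" by (simp_all only: of_int_eq_iff)
qed

text \<open>This is \<open>unit_eq\<close> multiplied by \<open>D\<close>; the Drinfeld condition
  makes the quotients integers.\<close>

lemma column_equation:
  assumes "i \<noteq> u" shows "d i + (D div f * X i + D div a * P i + D div b * Q i) = 0"
proof -
  have dv: "complex_of_int D / of_int c = of_int (D div c)" if "c dvd D" "c \<noteq> 0" for c
    using that by (auto elim!: dvdE)
  have "0 = of_int D * (of_int (d i) / of_int D + \<chi> i / of_int f + \<psi> i / of_int a + \<phi> i / of_int b)"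
    unfolding unit_eq[symmetric] using assms by simp
  also have "\<dots> = of_int (d i) + (of_int D / of_int f * \<chi> i + of_int D / of_int a * \<psi> i + of_int D / of_int b * \<phi> i)"
    using codegrees_nonzero by (simp add: field_simps)
  also have "\<dots> = of_int (d i + (D div f * X i + D div a * P i + D div b * Q i))"
    using codegree_dvd codegrees_nonzero by (simp add: dv integral_values)
  finally have "complex_of_int (d i + (D div f * X i + D div a * P i + D div b * Q i)) = of_int 0" by simp
  then show ?thesis by (simp only: of_int_eq_iff)
qed

definition column :: "'n \<Rightarrow> column" where "column i = (d i, X i, P i, Q i)"

lemma table_cases:
  assumes "a < b"
  obtains l xs where "((f, a, b, D), l) \<in> set tables" "distinct xs" "set xs = UNIV - {u}" "map column xs = l"
proof -
  define M where "M = image_mset column (mset_set (UNIV - {u}))"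
  have rest: "(\<Sum>i\<in>UNIV - {u}. h i) = (\<Sum>i\<in>UNIV. h i) - h u" for h :: "'n \<Rightarrow> int"
    by (simp add: sum.remove[of UNIV u])
  have M: "size M = 6" "(\<Sum>(d, x, p, q)\<in>#M. d * d) = D - 1" "(\<Sum>(d, x, p, q)\<in>#M. x * x) = 2 * f - 4"
    "(\<Sum>(d, x, p, q)\<in>#M. p * p) = a - 1" "(\<Sum>(d, x, p, q)\<in>#M. q * q) = b - 1"
    "(\<Sum>(d, x, p, q)\<in>#M. d * x) = - 2"
    by (simp_all add: M_def column_def image_mset.compositionality o_def sum_unfold_sum_mset[symmetric] rest
        integral_norms integral_unit unit_values card7)
  have le: "h i * h i \<le> (\<Sum>i\<in>UNIV. h i * h i) - h u * h u" if "i \<noteq> u" for i and h :: "'n \<Rightarrow> int"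
    unfolding rest[of "\<lambda>i. h i * h i", symmetric] using that by (intro member_le_sum) auto
  have "set_mset M \<subseteq> set (columns f a b D)"
  proof
    fix c assume "c \<in># M"
    then obtain i where i: "i \<noteq> u" "c = column i" by (auto simp: M_def)
    have "1 \<le> d i" using d_pos[of i] by simp
    then show "c \<in> set (columns f a b D)"
      unfolding i(2) column_def
      using le[OF i(1), of d] le[OF i(1), of X] le[OF i(1), of P] le[OF i(1), of Q] column_equation[OF i(1)] invertible_values[of i]
      by (intro columns_complete) (simp_all add: integral_norms integral_unit unit_values)
  qed
  from extend_complete[OF M(1) this M(2-)] obtain l where
    l: "l \<in> set (extend 6 (columns f a b D) (D - 1) (2 * f - 4) (a - 1) (b - 1) (- 2))" "mset l = M"
    by blast
  have "((f, a, b, D), l) \<in> set tables"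
    unfolding tables_def
    by (rule in_concat_map[OF codegree_tuple]) (use assms l in auto)
  moreover obtain xs where "distinct xs" "set xs = UNIV - {u}" "map column xs = l"
    using enumerate_fibres[of "UNIV - {u}" column l] l(2) by (auto simp: M_def)
  ultimately show ?thesis by (rule that)
qed

end

section \<open>Structure constants\<close>

text \<open>Index \<open>i < 3\<close> stands for \<open>g\<^sup>i\<close>, index \<open>3 + i\<close> for \<open>g\<^sup>i s\<close> (where \<open>s g = g\<^sup>-\<^sup>1 s\<close>), and index 6
  for an element \<open>y\<close> absorbing \<open>g\<close>.\<close>

definition left_index :: "nat \<Rightarrow> nat \<Rightarrow> nat" where
  "left_index i j = (if j < 3 then (i + j) mod 3 else if j < 6 then 3 + (i + j) mod 3 else j)"

definition right_index :: "nat \<Rightarrow> nat \<Rightarrow> nat" where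
  "right_index i j = (if i < 3 then (i + j) mod 3 else if i < 6 then 3 + (i + 2 * j) mod 3 else i)"

text \<open>Of the four parameters, \<gamma> and \<beta> are the multiplicities of y and of each
  \<open>g^i s\<close> in s s. The multiplicity of y in s y, which equals that of each
  \<open>g^i s\<close> in y y, is \<delta>, and \<kappa> is that of y in y y. Since 3 is 0 modulo 3,
  the offset of the second block drops out of the exponents, and the factor 2 stands for -1.\<close>

definition std_coeff :: "int \<times> int \<times> int \<times> int \<Rightarrow> nat \<Rightarrow> nat \<Rightarrow> nat \<Rightarrow> int" where
  "std_coeff = (\<lambda>(\<gamma>, \<beta>, \<delta>, \<kappa>) i j k.
    if i < 3 then of_bool (k = left_index i j)
    else if j < 3 then of_bool (k = right_index i j)
    else if i < 6 \<and> j < 6 then if k < 3 then of_bool (k = (i + 2 * j) mod 3) else if k < 6 then \<beta> else \<gamma>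
    else if i < 6 \<or> j < 6 then if k < 3 then 0 else if k < 6 then \<gamma> else \<delta>
    else if k < 3 then 1 else if k < 6 then \<delta> else \<kappa>)"

lemma all_less_7: "(\<forall>i<(7::nat). A i) \<longleftrightarrow> A 0 \<and> A 1 \<and> A 2 \<and> A 3 \<and> A 4 \<and> A 5 \<and> A 6"
proof -
  have "i < 7 \<longleftrightarrow> i = 0 \<or> i = 1 \<or> i = 2 \<or> i = 3 \<or> i = 4 \<or> i = 5 \<or> i = 6" for i :: nat
    by arith
  then show ?thesis by simp blast
qed

context fusion_data
begin

text \<open>If duality were the identity, the anti-automorphism would reverse products without
  changing anything.\<close>

lemma exists_not_self_dual:
  assumes "N p q r \<noteq> N q p r" shows "\<exists>i. dual i \<noteq> i"
proof (rule ccontr)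
  assume "\<not> (\<exists>i. dual i \<noteq> i)"
  then have "dual i = i" for i by simp
  then show False using assms N_dual[of q p r] by simp
qed

end

section \<open>Translations by invertible basis elements\<close>

context integral_decomposition
begin

lemma invertible_dual:
  assumes "d i = 1" shows "N i (dual i) e = of_bool (e = u)"
proof -
  have "(\<Sum>e\<in>UNIV. N i (dual i) e * d e) = 1"
    using character_products(1)[of i "dual i"] assms d_dual[of i] by simp
  then have "N i (dual i) u * d u + (\<Sum>e\<in>UNIV - {u}. N i (dual i) e * d e) = 1"
    by (simp add: sum.remove[of UNIV u])
  then have "(\<Sum>e\<in>UNIV - {u}. N i (dual i) e * d e) = 0"
    by (simp add: N_unit unit_values)
  then have "\<forall>e\<in>UNIV - {u}. N i (dual i) e * d e = 0"
    by (subst (asm) sum_nonneg_eq_0_iff) (auto simp: N_nonneg d_pos less_imp_le)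
  then show ?thesis
    using d_pos[of e] by (cases "e = u") (auto simp: N_unit)
qed

text \<open>Multiplying back by \<open>dual i\<close> shows that the squares of the row sum to 1;
  nonnegative integers with this property form a unit vector.\<close>

lemma invertible_row:
  assumes "d i = 1" shows "\<exists>m. \<forall>k. N i j k = of_bool (k = m)"
proof -
  have "(\<Sum>m\<in>UNIV. N (dual i) i m * N m j j) = (\<Sum>m\<in>UNIV. N i j m * N (dual i) m j)"
    by (rule N_assoc)
  moreover have "N (dual i) i m = of_bool (m = u)" for m
    using invertible_dual[of "dual i" m] assms by (simp add: d_dual)
  ultimately have 1: "(\<Sum>m\<in>UNIV. N i j m * N i j m) = 1"
    by (simp add: N_frob_left[of i j, symmetric] N_unit_left of_bool_def if_distrib[of "\<lambda>x. x * _"] cong: if_cong)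
  have "\<exists>m. N i j m \<noteq> 0"
  proof (rule ccontr)
    assume "\<not> (\<exists>m. N i j m \<noteq> 0)"
    then show False using 1 by simp
  qed
  then obtain m where m: "N i j m \<noteq> 0" by blast
  have rest: "N i j m * N i j m + (\<Sum>k\<in>UNIV - {m}. N i j k * N i j k) = 1"
    using 1 by (simp add: sum.remove[of UNIV m])
  have ge: "1 \<le> N i j m" using m N_nonneg[of i j m] by simp
  then have "N i j m * 1 \<le> N i j m * N i j m" by (intro mult_left_mono) auto
  moreover have nn: "0 \<le> (\<Sum>k\<in>UNIV - {m}. N i j k * N i j k)" by (intro sum_nonneg) simp
  ultimately have m1: "N i j m = 1" and "(\<Sum>k\<in>UNIV - {m}. N i j k * N i j k) = 0" using rest ge by linarith+
  then have "\<forall>k\<in>UNIV - {m}. N i j k * N i j k = 0" by (subst (asm) sum_nonneg_eq_0_iff) auto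
  then show ?thesis using m1 by (intro exI[of _ m]) auto
qed

text \<open>For invertible \<open>i\<close>, left translation permutes the basis, and this is the
  permutation. The mirrored \<open>rm\<close> is obtained from it through duality.\<close>

definition lm :: "'n \<Rightarrow> 'n \<Rightarrow> 'n" where "lm i j = (SOME m. \<forall>k. N i j k = of_bool (k = m))"

lemma N_lm: "d i = 1 \<Longrightarrow> N i j k = of_bool (k = lm i j)"
  using someI_ex[OF invertible_row[of i j]] unfolding lm_def by blast

definition rm :: "'n \<Rightarrow> 'n \<Rightarrow> 'n" where "rm j i = dual (lm (dual i) (dual j))"

lemma N_rm: "d i = 1 \<Longrightarrow> N j i k = of_bool (k = rm j i)"
  using N_dual[of i j k] N_lm[of "dual i" "dual j" "dual k"] dual_eq_iff[of k "rm j i"]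
  by (simp add: d_dual rm_def)

lemma lm_eqI: "d i = 1 \<Longrightarrow> N i j k \<noteq> 0 \<Longrightarrow> lm i j = k"
  using N_lm[of i j k] by (auto split: if_splits)

lemma rm_eqI: "d i = 1 \<Longrightarrow> N j i k \<noteq> 0 \<Longrightarrow> rm j i = k"
  using N_rm[of i j k] by (auto split: if_splits)

lemma lm_inverse: "d i = 1 \<Longrightarrow> lm (dual i) (lm i j) = j"
  using N_frob_left[of i j "lm i j"] by (intro lm_eqI) (auto simp: d_dual N_lm)

lemma lm_inj: "d i = 1 \<Longrightarrow> lm i j = lm i k \<longleftrightarrow> j = k"
  by (metis lm_inverse)

lemma rm_inverse: "d i = 1 \<Longrightarrow> rm (rm j i) (dual i) = j"
  using N_frob_right[of j i "rm j i"] by (intro rm_eqI) (auto simp: d_dual N_rm)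

lemma lm_values: "d i = 1 \<Longrightarrow> d (lm i j) = d j" "d i = 1 \<Longrightarrow> P (lm i j) = P i * P j" "d i = 1 \<Longrightarrow> Q (lm i j) = Q i * Q j"
  using character_products[of i j]
  by (simp_all add: N_lm of_bool_def if_distrib[of "\<lambda>x. x * _"] cong: if_cong)

text \<open>This lemma and the next two are associativity with an invertible factor, which moves
  from an argument to the result or between the two arguments.\<close>

lemma N_lm_left: "d i = 1 \<Longrightarrow> N (lm i j) k l = N j k (lm (dual i) l)"
proof -
  assume i: "d i = 1"
  have "N i m l = of_bool (m = lm (dual i) l)" for m
    using N_frob_left[of i m l] N_lm[of "dual i" l m] i by (simp add: d_dual)
  then show ?thesis using N_assoc[of i j k l] N_lm[OF i, of j]
    by (simp add: of_bool_def if_distrib[of "\<lambda>x. x * _"] if_distrib[of "(*) _"] cong: if_cong)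
qed

lemma N_rm_middle: "d i = 1 \<Longrightarrow> N j (rm k i) l = N j k (rm l (dual i))"
proof -
  assume i: "d i = 1"
  have "N m i l = of_bool (m = rm l (dual i))" for m
    using N_frob_right[of m i l] N_rm[of "dual i" l m] i by (simp add: d_dual)
  then show ?thesis using N_assoc[of j k i l] N_rm[OF i, of k]
    by (simp add: of_bool_def if_distrib[of "\<lambda>x. x * _"] if_distrib[of "(*) _"] cong: if_cong)
qed

lemma N_rm_left: "d i = 1 \<Longrightarrow> N (rm j i) k l = N j (lm i k) l"
proof -
  assume i: "d i = 1"
  then show ?thesis using N_assoc[of j i k l] N_rm[OF i, of j] N_lm[OF i, of k]
    by (simp add: of_bool_def if_distrib[of "\<lambda>x. x * _"] if_distrib[of "(*) _"] cong: if_cong)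
qed

text \<open>The trace of a permutation matrix counts fixed points, so the character table prescribes
  their number.\<close>

lemma trace_fixed_points: "d i = 1 \<Longrightarrow> two_sided_trace i u = (\<Sum>k\<in>UNIV. of_bool (k = lm i k))"
  by (simp add: two_sided_trace_unit N_lm)

lemma trace_conj_fixed_points:
  assumes "d i = 1" shows "two_sided_trace i i = (\<Sum>k\<in>UNIV. N (lm i k) i k)"
  by (simp add: two_sided_trace_def N_lm[OF assms, of _ _] of_bool_def if_distrib[of "\<lambda>x. x * _"] cong: if_cong)

text \<open>Two traces of \<open>g\<close> drive the argument. Left translation has trace 1 - 2 + 1
  + 1 = 1, so \<open>y\<close> is its only fixed point. The map sending x to g x g has trace 4 and
  therefore fixes \<open>s1\<close>, \<open>s2\<close>, \<open>s3\<close> and \<open>y\<close>,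
  which is the relation between left and right translation. All coefficients then reduce to those of
  one self-dual \<open>t\<close> and \<open>y\<close>.\<close>

lemma standard_form:
  assumes dist: "distinct [u, g, h, s1, s2, s3, y]" and all: "UNIV = {u, g, h, s1, s2, s3, y}"
    and g: "column g = (1, - 1, 1, 1)" and h: "column h = (1, - 1, 1, 1)"
    and s: "column s1 = (ds, 0, ps, qs)" "column s2 = (ds, 0, ps, qs)" "column s3 = (ds, 0, ps, qs)"
    and y: "column y = (dy, xy, py, qy)"
    and ne: "(ds, ps, qs) \<noteq> (1, 1, 1)" "(dy, py, qy) \<noteq> (1, 1, 1)" "(dy, py, qy) \<noteq> (ds, ps, qs)"
  obtains e \<gamma> \<beta> \<delta> \<kappa> where "bij_betw e {..<7} (UNIV :: 'n set)" "e 0 = u"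
    "\<forall>i<7. \<forall>j<7. \<forall>k<7. N (e i) (e j) (e k) = std_coeff (\<gamma>, \<beta>, \<delta>, \<kappa>) i j k"
    "0 \<le> \<gamma>" "0 \<le> \<beta>" "0 \<le> \<delta>" "0 \<le> \<kappa>"
    "ds * ds = 1 + \<gamma> * dy + 3 * (\<beta> * ds)" "ps * ps = 1 + \<gamma> * py + 3 * (\<beta> * ps)"
    "ds * dy = 3 * (\<gamma> * ds) + \<delta> * dy" "dy * dy = 3 + \<kappa> * dy + 3 * (\<delta> * ds)"
proof -
  have vg: "d g = 1" "X g = - 1" "P g = 1" "Q g = 1" and vh: "d h = 1" "X h = - 1" "P h = 1" "Q h = 1"
    using g h by (simp_all add: column_def)
  have vy: "d y = dy" "P y = py" "Q y = qy" using y by (simp_all add: column_def)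
  define S where "S = {s1, s2, s3}"
  have vS: "d t = ds" "P t = ps" "Q t = qs" if "t \<in> S" for t
    using that s by (auto simp: S_def column_def)
  have cls: "t \<in> {u, g, h} \<or> t \<in> S \<or> t = y" for t
    using all by (auto simp: S_def)
  \<comment> \<open>The three classes are distinguished by the dimension, \<open>P\<close> and
    \<open>Q\<close>, and translation by \<open>g\<close> preserves these because they equal 1 at
    \<open>g\<close>.\<close>
  have cl1: "t \<in> {u, g, h}" if "d t = 1" "P t = 1" "Q t = 1" for t
    using cls[of t] vS[of t] vy that ne by auto
  have clS: "t \<in> S" if "d t = ds" "P t = ps" "Q t = qs" for t
    using cls[of t] vg vh vy that ne unit_values(1) integral_unit by auto
  have cly: "t = y" if "d t = dy" "P t = py" "Q t = qy" for t
    using cls[of t] vS[of t] vg vh that ne unit_values(1) integral_unit by auto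
  have lmg: "d (lm g t) = d t" "P (lm g t) = P t" "Q (lm g t) = Q t" for t
    using vg by (simp_all add: lm_values)
  have ugh: "u \<noteq> g" "u \<noteq> h" "g \<noteq> h" "y \<notin> S" "u \<notin> S" "g \<notin> S" "h \<notin> S" "y \<noteq> u" "y \<noteq> g" "y \<noteq> h"
    using dist by (auto simp: S_def)
  have gu: "lm g u = g" using vg by (intro lm_eqI) (auto simp: N_unit_right)
  have hu: "lm h u = h" using vh by (intro lm_eqI) (auto simp: N_unit_right)
  have gy: "lm g y = y" using cly[of "lm g y"] lmg[of y] vy by simp
  have nofix: "lm g t \<noteq> t" if "t \<noteq> y" for t
  proof
    assume t: "lm g t = t"
    have "(\<Sum>k\<in>{t, y}. of_bool (k = lm g k)) \<le> (\<Sum>k\<in>UNIV. of_bool (k = lm g k) :: int)"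
      by (intro sum_mono2) auto
    then have "2 \<le> two_sided_trace g u"
      using that t gy vg by (simp add: trace_fixed_points)
    then show False using integral_trace[of g u] vg unit_values(1) integral_unit by simp
  qed
  have inj: "lm g t \<noteq> lm g t'" if "t \<noteq> t'" for t t'
    using that lm_inj[OF vg(1)] by blast
  have G: "lm g t \<in> {u, g, h}" if "t \<in> {u, g, h}" for t
    using that lmg[of t] vg vh unit_values(1) integral_unit by (intro cl1) auto
  have gg: "lm g g = h"
    using G[of g] G[of h] nofix[of g] nofix[of h] inj[of u g] inj[of u h] inj[of g h] ugh gu by auto
  have gh: "lm g h = u"
    using G[of h] nofix[of h] inj[of u h] ugh gu by auto
  have dg: "dual g = h"
  proof -
    have "lm g (dual g) = u" using vg by (intro lm_eqI) (auto simp: N_unit)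
    then show ?thesis using gh inj[of "dual g" h] by auto
  qed
  have dh: "dual h = g" using dg dual_dual[of g] by simp
  have hg_inv: "lm h (lm g t) = t" for t using lm_inverse[OF vg(1)] dg by simp
  have hg: "lm h g = u" "lm h h = g" "lm h y = y"
    using hg_inv[of u] hg_inv[of g] hg_inv[of y] gu gg gy by simp_all
  \<comment> \<open>Each basis element contributes at most 1 to the trace 4, and \<open>u\<close>,
    \<open>g\<close>, \<open>h\<close> contribute nothing; so none of the other four may be
    missing.\<close>
  have conj: "N (lm g t) g t = 1" if "t \<in> S \<or> t = y" for t
  proof (rule ccontr)
    assume ne1: "N (lm g t) g t \<noteq> 1"
    have le1: "N (lm g k) g k \<le> 1" for k using vg by (simp add: N_rm)
    have zero: "N (lm g k) g k = 0" if "k \<in> {u, g, h}" for k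
    proof -
      have "N (lm g u) g u = 0" using ugh(2) unfolding gu N_lm[OF vg(1)] gg by simp
      moreover have "N (lm g g) g g = 0" using ugh(1) unfolding gg N_lm[OF vh(1)] hg by simp
      moreover have "N (lm g h) g h = 0" using ugh(3) unfolding gh N_unit_left by simp
      ultimately show ?thesis using that by blast
    qed
    have t0: "N (lm g t) g t \<le> 0" using ne1 vg by (simp add: N_rm split: if_splits)
    define A where "A = {s1, s2, s3, y} - {t}"
    have "N (lm g k) g k \<le> (if k \<in> A then 1 else 0)" for k
    proof -
      have "k \<in> {u, g, h} \<or> k = t \<or> k \<in> A" using all unfolding A_def by blast
      then show ?thesis using le1[of k] zero[of k] t0 by (auto split: if_splits)
    qed
    then have "(\<Sum>k\<in>UNIV. N (lm g k) g k) \<le> (\<Sum>k\<in>UNIV. if k \<in> A then 1 else 0)"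
      by (intro sum_mono) auto
    also have "\<dots> = int (card A)" by (simp add: sum.If_cases)
    also have "card A = 3" using that dist unfolding A_def by (subst card_Diff_singleton) (auto simp: S_def)
    finally show False
      using integral_trace[of g g] vg by (simp add: trace_conj_fixed_points)
  qed
  have rg: "rm (lm g t) g = t" if "t \<in> S \<or> t = y" for t
    using conj[OF that] vg by (intro rm_eqI) auto
  have dS: "dual t \<in> S" if "t \<in> S" for t
    using vS[OF that] by (intro clS) (simp_all add: d_dual integral_dual)
  have dy': "dual y = y" using vy by (intro cly) (simp_all add: d_dual integral_dual)
  \<comment> \<open>An involution of a set of three elements has a fixed point; it takes the role of
    s.\<close>
  have "\<exists>t\<in>S. dual t = t"
    using dS[of s1] dS[of s2] dS[of s3] dual_dual[of s1] dual_dual[of s2] dual_dual[of s3] dist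
    unfolding S_def by auto
  then obtain t where t: "t \<in> S" "dual t = t" by blast
  define t' where "t' = lm g t"
  define t'' where "t'' = lm g t'"
  have gS: "lm g r \<in> S" if "r \<in> S" for r
    using lmg[of r] vS[OF that] by (intro clS) auto
  have t': "t' \<in> S" "t'' \<in> S" "t' \<noteq> t" "t'' \<noteq> t'"
    using gS[of t] gS[of t'] nofix[of t] nofix[of t'] t ugh by (auto simp: t'_def t''_def)
  have finS: "finite S" by (simp add: S_def)
  have card3: "card S = 3" using dist by (simp add: S_def)
  \<comment> \<open>Otherwise \<open>g\<close> would exchange \<open>t\<close> and
    \<open>t'\<close>, and the third element of \<open>S\<close> would be a second fixed
    point.\<close>
  have t''t: "t'' \<noteq> t"
  proof
    assume eq: "t'' = t"
    have "card {t, t'} = 2" using t' by simp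
    then have "\<not> S \<subseteq> {t, t'}" using card_mono[of "{t, t'}" S] card3 by auto
    then obtain r where r: "r \<in> S" "r \<noteq> t" "r \<noteq> t'" by blast
    have "{t, t', r} \<subseteq> S" "card {t, t', r} = 3" using r t t' by auto
    then have "{t, t', r} = S" using card3 by (intro card_subset_eq[OF finS]) auto
    then have S_eq: "S = {t, t', r}" by (rule sym)
    then show False
      using gS[OF r(1), unfolded S_eq] nofix[of r] inj[of r t] inj[of r t'] r ugh eq by (auto simp: t'_def t''_def)
  qed
  have "{t, t', t''} \<subseteq> S" "card {t, t', t''} = 3" using t t' t''t by auto
  then have "{t, t', t''} = S" using card3 by (intro card_subset_eq[OF finS]) auto
  then have S3: "S = {t, t', t''}" by (rule sym)
  have gt'': "lm g t'' = t"
    using gS[OF t'(2), unfolded S3] nofix[of t''] inj[of t'' t] t' t''t ugh by (auto simp: t'_def t''_def)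
  have lg: "lm g u = g" "lm g g = h" "lm g h = u" "lm g t = t'" "lm g t' = t''" "lm g t'' = t" "lm g y = y"
    using gu gg gh gt'' gy by (simp_all add: t'_def t''_def)
  have lh: "lm h u = h" "lm h g = u" "lm h h = g" "lm h t = t''" "lm h t' = t" "lm h t'' = t'" "lm h y = y"
    using hu hg hg_inv[of t] hg_inv[of t'] hg_inv[of t''] lg by simp_all
  have rmg: "rm u g = g" "rm g g = h" "rm h g = u" "rm t g = t''" "rm t' g = t" "rm t'' g = t'" "rm y g = y"
  proof -
    show "rm u g = g" using vg by (intro rm_eqI) (auto simp: N_unit_left)
    show "rm g g = h" using vg lg by (intro rm_eqI) (auto simp: N_lm)
    show "rm h g = u" using vg vh lh by (intro rm_eqI) (auto simp: N_lm)
    show "rm t g = t''" "rm t' g = t" "rm t'' g = t'" "rm y g = y"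
      using rg[of t''] rg[of t] rg[of t'] rg[of y] lg t t' by simp_all
  qed
  have rmh: "rm u h = h" "rm g h = u" "rm h h = g" "rm t h = t'" "rm t' h = t''" "rm t'' h = t" "rm y h = y"
    using rm_inverse[OF vg(1), of h] rm_inverse[OF vg(1), of u] rm_inverse[OF vg(1), of g] rm_inverse[OF vg(1), of y]
      rm_inverse[OF vg(1), of t] rm_inverse[OF vg(1), of t'] rm_inverse[OF vg(1), of t''] rmg dg by simp_all
  \<comment> \<open>Translating back replaces \<open>t'\<close> and \<open>t''\<close> by
    \<open>t\<close> in either argument, so only products of \<open>t\<close> and \<open>y\<close>
    remain to be computed.\<close>
  have L: "N t' k l = N t k (lm h l)" "N t'' k l = N t k (lm g l)" for k l
    using N_lm_left[OF vg(1), of t k l] N_lm_left[OF vh(1), of t k l] lg lh dg dh by simp_all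
  have R: "N j t' l = N j t (rm l g)" "N j t'' l = N j t (rm l h)" for j l
    using N_rm_middle[OF vg(1), of j t l] N_rm_middle[OF vh(1), of j t l] rmg rmh dg dh by simp_all
  have neq: "t \<noteq> u" "t \<noteq> g" "t \<noteq> h" "t \<noteq> y" "t' \<noteq> u" "t' \<noteq> g" "t' \<noteq> h" "t' \<noteq> y" "t'' \<noteq> u" "t'' \<noteq> g" "t'' \<noteq> h" "t'' \<noteq> y"
    using S3 ugh by auto
  note neqs = neq t'(3,4) t''t ugh(1-3,8-10)
  define \<gamma> where "\<gamma> = N t t y"
  define \<beta> where "\<beta> = N t t t"
  define \<delta> where "\<delta> = N y y t"
  define \<kappa> where "\<kappa> = N y y y"
  have NG: "N u k l = of_bool (l = k)" "N g k l = of_bool (l = lm g k)" "N h k l = of_bool (l = lm h k)"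
    "N k u l = of_bool (l = k)" "N k g l = of_bool (l = rm k g)" "N k h l = of_bool (l = rm k h)" for k l
    using vg vh by (auto simp: N_unit_left N_unit_right N_lm N_rm)
  have tt: "N t t u = 1" "N t t g = 0" "N t t h = 0" "N t t y = \<gamma>" "N t t t = \<beta>" "N t t t' = \<beta>" "N t t t'' = \<beta>"
  proof -
    show "N t t u = 1" using t by (simp add: N_unit')
    show "N t t g = 0" "N t t h = 0"
      using N_frob_right[of t t g] N_frob_right[of t t h] t neqs by (simp_all add: NG lg lh)
    \<comment> \<open>Both sides are the coefficient of \<open>k\<close> in the product
      \<open>t\<close> \<open>g\<close> \<open>t\<close>, bracketed in two ways; this makes the
      coefficients in \<open>t t\<close> constant on \<open>S\<close>.\<close>
    have *: "N t t (lm g k) = N t t (rm k g)" for k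
      using N_rm_left[OF vg(1), of t t k] by (simp add: rmg lg L R)
    show "N t t y = \<gamma>" "N t t t = \<beta>" by (simp_all add: \<gamma>_def \<beta>_def)
    show "N t t t'' = \<beta>" using *[of t'] by (simp add: lg rmg \<beta>_def)
    then show "N t t t' = \<beta>" using *[of t] by (simp add: lg rmg)
  qed
  have yy: "N y y u = 1" "N y y g = 1" "N y y h = 1" "N y y t = \<delta>" "N y y y = \<kappa>"
    using N_frob_right[of y y g] N_frob_right[of y y h]
    by (simp_all add: N_unit' dy' NG lg lh \<delta>_def \<kappa>_def)
  have ty: "N t y u = 0" "N t y g = 0" "N t y h = 0" "N t y t = \<gamma>" "N t y t' = \<gamma>" "N t y t'' = \<gamma>" "N t y y = \<delta>"
    using N_frob_right[of t y g] N_frob_right[of t y h] N_frob_left[of t y t] N_frob_left[of t y t'] N_frob_left[of t y t'']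
      N_frob_right[of t y y] neqs t
    by (simp_all add: N_unit' dy' NG lg lh R rmg rmh \<gamma>_def \<delta>_def)
  have yt: "N y t u = 0" "N y t g = 0" "N y t h = 0" "N y t t = \<gamma>" "N y t t' = \<gamma>" "N y t t'' = \<gamma>" "N y t y = \<delta>"
    using N_frob_right[of y t g] N_frob_right[of y t h] N_frob_right[of y t t] N_frob_right[of y t t'] N_frob_right[of y t t'']
      N_frob_left[of y t y] neqs t
    by (simp_all add: N_unit' dy' NG lg lh L \<gamma>_def \<delta>_def)
  have yy': "N y y t' = \<delta>" "N y y t'' = \<delta>"
    using N_frob_right[of y y t'] N_frob_right[of y y t''] by (simp_all add: dy' L lg lh ty)
  note rules = NG tt ty yt yy yy' L R lg lh rmg rmh
  define e where "e i = [u, g, h, t, t', t'', y] ! i" for i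
  have e: "e 0 = u" "e 1 = g" "e 2 = h" "e 3 = t" "e 4 = t'" "e 5 = t''" "e 6 = y"
    by (simp_all add: e_def)
  have UN: "UNIV = {u, g, h, t, t', t'', y}" using all S3 by (auto simp: S_def)
  have "bij_betw e {..<7} UNIV"
  proof -
    have "e = (!) [u, g, h, t, t', t'', y]" by (simp add: e_def fun_eq_iff)
    moreover have "distinct [u, g, h, t, t', t'', y]" by (simp add: neqs neqs[symmetric])
    ultimately show ?thesis by (simp only:) (rule bij_betw_nth, simp_all add: UN)
  qed
  moreover have "\<forall>i<7. \<forall>j<7. \<forall>k<7. N (e i) (e j) (e k) = std_coeff (\<gamma>, \<beta>, \<delta>, \<kappa>) i j k"
    unfolding all_less_7 e
    by (simp add: rules std_coeff_def left_index_def right_index_def neqs neqs[symmetric])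
  moreover have "0 \<le> \<gamma>" "0 \<le> \<beta>" "0 \<le> \<delta>" "0 \<le> \<kappa>"
    by (simp_all add: \<gamma>_def \<beta>_def \<delta>_def \<kappa>_def N_nonneg)
  \<comment> \<open>Dimensions are compared in the products \<open>t t\<close>, \<open>t y\<close>
    and \<open>y y\<close>, and the values of \<open>P\<close> in \<open>t t\<close>.\<close>
  moreover have "ds * ds = 1 + \<gamma> * dy + 3 * (\<beta> * ds)" "ps * ps = 1 + \<gamma> * py + 3 * (\<beta> * ps)"
    "ds * dy = 3 * (\<gamma> * ds) + \<delta> * dy" "dy * dy = 3 + \<kappa> * dy + 3 * (\<delta> * ds)"
    using character_products(1,2)[of t t] character_products(1)[of t y] character_products(1)[of y y]
      vS[OF t(1)] vS[OF t'(1)] vS[OF t'(2)] vy vg vh unit_values(1) integral_unit neqs neqs[symmetric]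
    unfolding UN by (simp_all add: tt ty yy yy')
  ultimately show ?thesis using that e(1) by blast
qed

section \<open>Exclusion of two tables and determination of the parameters\<close>

lemma two_fixed_points:
  assumes "d i = 1" "lm i j = j" "lm i k = k" "j \<noteq> k" shows "2 \<le> two_sided_trace i u"
proof -
  have "(\<Sum>k\<in>{j, k}. of_bool (k = lm i k)) \<le> (\<Sum>k\<in>UNIV. of_bool (k = lm i k) :: int)"
    by (intro sum_mono2) auto
  then show ?thesis using assms by (simp add: trace_fixed_points)
qed

text \<open>The dimensions 3 and 4 occur only once, so \<open>g\<close> fixes both of these elements
  although its left translation has trace 1.\<close>

lemma no_table_36:
  assumes "set [g, h, y, z, x1, x2] = UNIV - {u}" "distinct [g, h, y, z, x1, x2]"
    "map column [g, h, y, z, x1, x2] = [(1, - 1, 1, 1), (1, - 1, 1, 1), (3, 0, - 1, 3), (4, 0, 0, - 2), (2, 0, 0, - 1), (2, 0, 0, - 1)]"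
  shows False
proof -
  have UN: "t \<in> {u, g, h, y, z, x1, x2}" for t using assms(1) by auto
  have v: "d g = 1" "X g = - 1" "P g = 1" "Q g = 1" "d h = 1" "d y = 3" "d z = 4" "d x1 = 2" "d x2 = 2"
    using assms(3) by (simp_all add: column_def)
  have "lm g y = y" "lm g z = z"
    using UN[of "lm g y"] UN[of "lm g z"] lm_values(1)[OF v(1), of y] lm_values(1)[OF v(1), of z] v unit_values(1) by auto
  then have "2 \<le> two_sided_trace g u"
    using two_fixed_points[OF v(1)] assms(2) by auto
  then show False using integral_trace[of g u] v unit_values(1) integral_unit by simp
qed

text \<open>The involution \<open>k\<close> has trace 5 and fixes everything outside
  \<open>u\<close> and \<open>k\<close>. Some \<open>i\<close> of dimension 3 is not self-dual, and
  comparing dimensions shows that no product of \<open>v\<close> and \<open>dual v\<close> contains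
  it. The trace of \<open>i\<close> would then be 0, while the table gives 3 - 2 = 1.\<close>

lemma no_table_42:
  assumes set: "set [v1, v2, v3, v4, k, w] = UNIV - {u}" and dist: "distinct [v1, v2, v3, v4, k, w]"
    and col: "map column [v1, v2, v3, v4, k, w] = [(3, - 1, 0, 0), (3, - 1, 0, 0), (3, - 1, 0, 0), (3, - 1, 0, 0), (1, 2, - 1, 1), (2, 4, 0, - 1)]"
  shows False
proof -
  have UN: "UNIV = {u, v1, v2, v3, v4, k, w}" using set by auto
  have du: "u \<notin> {v1, v2, v3, v4, k, w}" using set by auto
  have dv: "d v1 = 3" "d v2 = 3" "d v3 = 3" "d v4 = 3" "d k = 1" "d w = 2" "d u = 1"
    and kv: "X k = 2" "P k = - 1" "Q k = 1"
    using col unit_values(1) by (auto simp: column_def)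
  have vv: "X i = - 1 \<and> P i = 0 \<and> Q i = 0" if "i \<in> {v1, v2, v3, v4}" for i
    using col that by (auto simp: column_def)
  have kk: "lm k k = u"
  proof -
    have "lm k u = k" using dv by (intro lm_eqI) (auto simp: N_unit_right)
    then have "lm k k \<noteq> k" using lm_inj[OF dv(5), of k u] du by auto
    moreover have "d (lm k k) = 1" using dv lm_values(1)[OF dv(5)] by simp
    moreover have "lm k k \<in> {u, v1, v2, v3, v4, k, w}" using UN by auto
    ultimately show ?thesis using dv by auto
  qed
  have k_fixed: "lm k i = i" if "i \<notin> {u, k}" for i
  proof (rule ccontr)
    assume i: "lm k i \<noteq> i"
    have ku: "lm k u = k" using dv by (intro lm_eqI) (auto simp: N_unit_right)
    define A where "A = UNIV - {u, k, i}"
    have "two_sided_trace k u = (\<Sum>j\<in>UNIV. of_bool (j = lm k j))" using dv by (simp add: trace_fixed_points)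
    also have "\<dots> \<le> (\<Sum>j\<in>UNIV. if j \<in> A then 1 else 0)"
      using i kk ku du by (intro sum_mono) (auto simp: A_def)
    also have "\<dots> = int (card A)" by (simp add: sum.If_cases)
    also have "card A = 4"
      unfolding A_def using that du by (subst card_Diff_subset) (auto simp: card7)
    finally show False using integral_trace[of k u] dv kv integral_unit by simp
  qed
  have knk: "N i (dual i) k = 1" if "i \<notin> {u, k}" for i
    using N_frob_right[of i "dual i" k] k_fixed[OF that] dv by (simp add: N_lm)
  \<comment> \<open>The product of \<open>v\<close> and \<open>dual v\<close> is self-dual, so it
    contains \<open>i\<close> and \<open>dual i\<close> equally often; a nonzero multiplicity
    contributes at least 2 to \<open>E v\<close>.\<close>
  have self: "N v (dual v) (dual i) = N v (dual v) i" for v i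
    using N_dual[of "dual v" v i] by simp
  obtain i where i: "dual i \<noteq> i" using noncommutative exists_not_self_dual by blast
  have di: "d (dual i) = d i" by (rule d_dual)
  have "i \<in> {u, v1, v2, v3, v4, k, w}" "dual i \<in> {u, v1, v2, v3, v4, k, w}" using UN by auto
  then have iv: "i \<in> {v1, v2, v3, v4}" "dual i \<in> {v1, v2, v3, v4}"
    using i di dv du dual_unit dual_eq_iff[of i u] by auto
  have dims: "d v * d v = N v (dual v) u + N v (dual v) k + 2 * N v (dual v) w +
      3 * (N v (dual v) v1 + N v (dual v) v2 + N v (dual v) v3 + N v (dual v) v4)" for v
    using character_products(1)[of v "dual v"] dist du unfolding UN by (simp add: d_dual dv algebra_simps)
  define E where "E v = N v (dual v) v1 + N v (dual v) v2 + N v (dual v) v3 + N v (dual v) v4" for v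
  have E_ge: "N v (dual v) i + N v (dual v) (dual i) \<le> E v" for v
    using iv i N_nonneg[of v "dual v"] unfolding E_def by auto
  have E: "d v * d v = 2 + 2 * N v (dual v) w + 3 * E v" if "v \<notin> {u, k}" for v
    using dims[of v] knk[OF that] by (simp add: N_unit E_def)
  \<comment> \<open>For dimension 2 the equation 2 = 2 w + 3 E forces E = 0, and for dimension 3 the
    equation 7 = 2 w + 3 E forces E = 1. Neither leaves room for a pair of dual
    constituents.\<close>
  have zero: "N v (dual v) i = 0" for v
  proof -
    have nn: "0 \<le> N v (dual v) i" "0 \<le> N v (dual v) w" by (simp_all add: N_nonneg)
    have "v \<in> {u, v1, v2, v3, v4, k, w}" using UN by auto
    then consider "v \<in> {u, k}" | "v \<notin> {u, k}" "d v = 2" | "v \<notin> {u, k}" "d v = 3"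
      using dv dist du by auto
    then show ?thesis
    proof cases
      case 1
      then have "d v = 1" using dv by auto
      moreover have "i \<noteq> u" using iv du by auto
      ultimately show ?thesis by (simp add: invertible_dual)
    next
      case 2
      then have "2 = 2 * N v (dual v) w + 3 * E v" using E[of v] by simp
      then show ?thesis using E_ge[of v] self[of v i] nn by presburger
    next
      case 3
      then have "7 = 2 * N v (dual v) w + 3 * E v" using E[of v] by simp
      then show ?thesis using E_ge[of v] self[of v i] nn by presburger
    qed
  qed
  have "two_sided_trace i u = (\<Sum>l\<in>UNIV. N l (dual l) i)"
    using N_frob_right[of i] by (simp add: two_sided_trace_unit)
  also have "\<dots> = 0" by (simp add: zero)
  finally have "d i + 2 * X i + P i + Q i = 0"
    using integral_trace[of i u] unit_values(1) integral_unit by simp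
  then show False using vv[OF iv(1)] iv(1) dv by auto
qed

lemma classification:
  assumes ab: "a < b"
  obtains e r where "bij_betw e {..<7} (UNIV :: 'n set)" "e 0 = u" "r \<in> {(1, 0, 0, 2), (0, 0, 1, 5), (1, 1, 0, 2)}"
    "\<forall>i<7. \<forall>j<7. \<forall>k<7. N (e i) (e j) (e k) = std_coeff r i j k"
proof -
  note result = that
  obtain l xs where l: "((f, a, b, D), l) \<in> set tables" "distinct xs" "set xs = UNIV - {u}" "map column xs = l"
    using table_cases[OF ab] .
  have UN: "UNIV = insert u (set xs)" "u \<notin> set xs" using l(3) by auto
  have "l \<in> set (map snd tables)" using l(1) by (simp only: set_map) (rule image_eqI[rotated], auto)
  then have "l = [(1, - 1, 1, 1), (1, - 1, 1, 1), (3, 0, - 1, 3), (4, 0, 0, - 1), (4, 0, 0, - 1), (4, 0, 0, - 1)] \<or>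
      l = [(1, - 1, 1, 1), (1, - 1, 1, 1), (3, 0, - 1, 3), (4, 0, 0, - 2), (2, 0, 0, - 1), (2, 0, 0, - 1)] \<or>
      l = [(1, - 1, 1, 1), (1, - 1, 1, 1), (3, 0, - 1, 3), (2, 0, 0, - 2), (2, 0, 0, - 2), (2, 0, 0, - 2)] \<or>
      l = [(1, - 1, 1, 1), (1, - 1, 1, 1), (1, 0, - 1, 1), (1, 0, - 1, 1), (1, 0, - 1, 1), (6, 0, 0, - 1)] \<or>
      l = [(3, - 1, 0, 0), (3, - 1, 0, 0), (3, - 1, 0, 0), (3, - 1, 0, 0), (1, 2, - 1, 1), (2, 4, 0, - 1)]"
    unfolding tables_eq by simp
  then consider "l = [(1, - 1, 1, 1), (1, - 1, 1, 1), (3, 0, - 1, 3), (4, 0, 0, - 1), (4, 0, 0, - 1), (4, 0, 0, - 1)]"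
    | "l = [(1, - 1, 1, 1), (1, - 1, 1, 1), (3, 0, - 1, 3), (4, 0, 0, - 2), (2, 0, 0, - 1), (2, 0, 0, - 1)]"
    | "l = [(1, - 1, 1, 1), (1, - 1, 1, 1), (3, 0, - 1, 3), (2, 0, 0, - 2), (2, 0, 0, - 2), (2, 0, 0, - 2)]"
    | "l = [(1, - 1, 1, 1), (1, - 1, 1, 1), (1, 0, - 1, 1), (1, 0, - 1, 1), (1, 0, - 1, 1), (6, 0, 0, - 1)]"
    | "l = [(3, - 1, 0, 0), (3, - 1, 0, 0), (3, - 1, 0, 0), (3, - 1, 0, 0), (1, 2, - 1, 1), (2, 4, 0, - 1)]"
    by blast
  \<comment> \<open>Shared by the three surviving tables. In each of them the four product
    equations, being linear in the nonnegative parameters, have exactly one of the listed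
    solutions.\<close>
  moreover have standard: thesis
    if elems: "distinct [g, h, s1, s2, s3, y]" "set [g, h, s1, s2, s3, y] = set xs"
      and cols: "column g = (1, - 1, 1, 1)" "column h = (1, - 1, 1, 1)"
      "column s1 = (ds, 0, ps, qs)" "column s2 = (ds, 0, ps, qs)" "column s3 = (ds, 0, ps, qs)" "column y = (dy, xy, py, qy)"
      and ne: "(ds, ps, qs) \<noteq> (1, 1, 1)" "(dy, py, qy) \<noteq> (1, 1, 1)" "(dy, py, qy) \<noteq> (ds, ps, qs)"
      and param: "\<And>\<gamma> \<beta> \<delta> \<kappa>. 0 \<le> \<gamma> \<Longrightarrow> 0 \<le> \<beta> \<Longrightarrow> 0 \<le> \<delta> \<Longrightarrow> 0 \<le> \<kappa> \<Longrightarrow>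
        ds * ds = 1 + \<gamma> * dy + 3 * (\<beta> * ds) \<Longrightarrow> ps * ps = 1 + \<gamma> * py + 3 * (\<beta> * ps) \<Longrightarrow>
        ds * dy = 3 * (\<gamma> * ds) + \<delta> * dy \<Longrightarrow> dy * dy = 3 + \<kappa> * dy + 3 * (\<delta> * ds) \<Longrightarrow>
        (\<gamma>, \<beta>, \<delta>, \<kappa>) \<in> {(1, 0, 0, 2), (0, 0, 1, 5), (1, 1, 0, 2)}"
    for g h s1 s2 s3 y ds ps qs dy xy py qy
  proof -
    have "distinct [u, g, h, s1, s2, s3, y]" using elems UN(2) by auto
    moreover have "UNIV = {u, g, h, s1, s2, s3, y}"
      by (rule trans[OF UN(1)]) (simp flip: elems(2) add: insert_commute)
    ultimately obtain e \<gamma> \<beta> \<delta> \<kappa> where "bij_betw e {..<7} (UNIV :: 'n set)" "e 0 = u"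
      "\<forall>i<7. \<forall>j<7. \<forall>k<7. N (e i) (e j) (e k) = std_coeff (\<gamma>, \<beta>, \<delta>, \<kappa>) i j k"
      "(\<gamma>, \<beta>, \<delta>, \<kappa>) \<in> {(1, 0, 0, 2), (0, 0, 1, 5), (1, 1, 0, 2)}"
      by (rule standard_form[OF _ _ cols ne]) (use param in blast)
    then show thesis using result by blast
  qed
  ultimately show ?thesis
  proof cases
    case 1
    then obtain g h y s1 s2 s3 where "xs = [g, h, y, s1, s2, s3]" using l(4) by (auto simp: map_eq_Cons_conv)
    with l(2,4) 1 show ?thesis by (intro standard[of g h s1 s2 s3 y 4 0 "- 1" 3 0 "- 1" 3]) auto
  next
    case 2
    then obtain g h y z x1 x2 where "xs = [g, h, y, z, x1, x2]" using l(4) by (auto simp: map_eq_Cons_conv)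
    then show ?thesis using no_table_36[of g h y z x1 x2] l 2 by simp
  next
    case 3
    then obtain g h y s1 s2 s3 where "xs = [g, h, y, s1, s2, s3]" using l(4) by (auto simp: map_eq_Cons_conv)
    with l(2,4) 3 show ?thesis by (intro standard[of g h s1 s2 s3 y 2 0 "- 2" 3 0 "- 1" 3]) auto
  next
    case 4
    then obtain g h y s1 s2 s3 where "xs = [g, h, s1, s2, s3, y]" using l(4) by (auto simp: map_eq_Cons_conv)
    with l(2,4) 4 show ?thesis by (intro standard[of g h s1 s2 s3 y 1 "- 1" 1 6 0 0 "- 1"]) auto
  next
    case 5
    then obtain v1 v2 v3 v4 k w where "xs = [v1, v2, v3, v4, k, w]" using l(4) by (auto simp: map_eq_Cons_conv)
    then show ?thesis using no_table_42[of v1 v2 v3 v4 k w] l 5 by simp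
  qed
qed

end

section \<open>Coordinates of a fusion ring\<close>

text \<open>Transports the ring to a finite index type through an enumeration of its basis, so that
  the results on structure constants apply.\<close>

locale fusion_coords =
  fixes S :: "'a based_ring" and \<beta> :: "'n::finite \<Rightarrow> 'a"
  assumes fusion: "fusion_ring S" and bij: "bij_betw \<beta> UNIV (basis S)"
begin

lemma fusion_facts:
  shows is_ring: "ring S" and free: "free_basis S" and one_basis: "\<one>\<^bsub>S\<^esub> \<in> basis S"
    and coeff_nonneg: "\<And>x y z. x \<in> basis S \<Longrightarrow> y \<in> basis S \<Longrightarrow> z \<in> basis S \<Longrightarrow> 0 \<le> fusion_coeff S x y z"
    and invol_closed: "\<And>x. x \<in> basis S \<Longrightarrow> invol S x \<in> basis S"
    and invol_invol: "\<And>x. x \<in> basis S \<Longrightarrow> invol S (invol S x) = x"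
    and anti: "\<exists>h. anti_automorphism S h \<and> (\<forall>x\<in>basis S. h x = invol S x)"
    and coeff_one: "\<And>x y. x \<in> basis S \<Longrightarrow> y \<in> basis S \<Longrightarrow>
      fusion_coeff S x (invol S y) \<one>\<^bsub>S\<^esub> = (if x = y then 1 else 0)"
  using fusion unfolding fusion_ring_def by blast+

sublocale R: ring S by (rule is_ring)

definition ix :: "'a \<Rightarrow> 'n" where "ix = inv_into UNIV \<beta>"

lemma ix_\<beta> [simp]: "ix (\<beta> i) = i"
  using bij by (simp add: ix_def bij_betw_def)

lemma \<beta>_ix [simp]: "b \<in> basis S \<Longrightarrow> \<beta> (ix b) = b"
  using bij unfolding ix_def by (intro f_inv_into_f) (simp add: bij_betw_def)

lemma \<beta>_basis [simp]: "\<beta> i \<in> basis S"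
  using bij by (auto simp: bij_betw_def)

lemma \<beta>_eq_iff [simp]: "\<beta> i = \<beta> j \<longleftrightarrow> i = j"
  by (metis ix_\<beta>)

lemma basis_carrier: "basis S \<subseteq> carrier S" and finite_basis: "finite (basis S)"
  using free by (auto simp: free_basis_def)

lemma \<beta>_carrier [simp]: "\<beta> i \<in> carrier S"
  using basis_carrier \<beta>_basis by blast

lemma sum_basis: "(\<Sum>b\<in>basis S. f b) = (\<Sum>i\<in>UNIV. f (\<beta> i))"
  by (rule sum.reindex_bij_betw[OF bij, symmetric])

definition lc :: "('n \<Rightarrow> int) \<Rightarrow> 'a" where
  "lc c = (\<Oplus>\<^bsub>S\<^esub>i\<in>UNIV. [c i] \<cdot>\<^bsub>S\<^esub> \<beta> i)"

definition cf :: "'a \<Rightarrow> 'n \<Rightarrow> int" where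
  "cf x i = coord S x (\<beta> i)"

lemma lc_closed [simp]: "lc c \<in> carrier S"
  unfolding lc_def by (rule R.finsum_closed) auto

lemma lin_comb_lc: "lin_comb S c = lc (c \<circ> \<beta>)"
proof -
  have "lin_comb S c = (\<Oplus>\<^bsub>S\<^esub>b\<in>\<beta> ` UNIV. [c b] \<cdot>\<^bsub>S\<^esub> b)"
    using bij by (simp add: lin_comb_def bij_betw_def)
  also have "\<dots> = lc (c \<circ> \<beta>)"
    unfolding lc_def by (subst R.add.finprod_reindex) (auto simp: inj_on_def)
  finally show ?thesis .
qed

lemma coord_ex: "x \<in> carrier S \<Longrightarrow> is_coord S x (coord S x)"
  using free theI'[of "is_coord S x"] unfolding free_basis_def coord_def by blast

lemma coord_eqI: "x \<in> carrier S \<Longrightarrow> is_coord S x c \<Longrightarrow> coord S x = c"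
  using free coord_ex[of x] unfolding free_basis_def by blast

lemma coord_off_basis: "x \<in> carrier S \<Longrightarrow> a \<notin> basis S \<Longrightarrow> coord S x a = 0"
  using coord_ex[of x] by (simp add: is_coord_def)

lemma lc_cf [simp]: "x \<in> carrier S \<Longrightarrow> lc (cf x) = x"
  using coord_ex[of x] unfolding is_coord_def lin_comb_lc by (simp add: cf_def[abs_def] o_def)

lemma cf_lc [simp]: "cf (lc c) = c"
proof -
  define c' where "c' a = (if a \<in> basis S then c (ix a) else 0)" for a
  have "c' \<circ> \<beta> = c" by (simp add: c'_def fun_eq_iff)
  then have "is_coord S (lc c) c'"
    by (simp add: is_coord_def lin_comb_lc) (simp add: c'_def)
  then have "coord S (lc c) = c'" by (intro coord_eqI) auto
  then show ?thesis by (simp add: cf_def[abs_def] c'_def)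
qed

lemma cf_inj: "x \<in> carrier S \<Longrightarrow> y \<in> carrier S \<Longrightarrow> cf x = cf y \<Longrightarrow> x = y"
  by (metis lc_cf)

lemma lc_add: "lc (\<lambda>i. c i + c' i) = lc c \<oplus>\<^bsub>S\<^esub> lc c'"
  unfolding lc_def by (subst R.finsum_addf[symmetric]) (auto simp: R.add.int_pow_mult intro!: R.finsum_cong')

lemma cf_add: "x \<in> carrier S \<Longrightarrow> y \<in> carrier S \<Longrightarrow> cf (x \<oplus>\<^bsub>S\<^esub> y) = (\<lambda>i. cf x i + cf y i)"
  using lc_add[of "cf x" "cf y"] by (metis cf_lc lc_cf)

lemma cf_zero: "cf \<zero>\<^bsub>S\<^esub> = (\<lambda>i. 0)"
  using cf_add[of "\<zero>\<^bsub>S\<^esub>" "\<zero>\<^bsub>S\<^esub>"] by (simp add: fun_eq_iff)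

lemma cf_finsum:
  assumes "finite A" "f \<in> A \<rightarrow> carrier S"
  shows "cf (\<Oplus>\<^bsub>S\<^esub>i\<in>A. f i) = (\<lambda>k. \<Sum>i\<in>A. cf (f i) k)"
  using assms by (induction A rule: finite_induct) (auto simp: cf_zero cf_add Pi_def)

lemma cf_minus: "x \<in> carrier S \<Longrightarrow> cf (\<ominus>\<^bsub>S\<^esub> x) = (\<lambda>k. - cf x k)"
  using cf_add[of x "\<ominus>\<^bsub>S\<^esub> x"] by (simp add: R.r_neg cf_zero fun_eq_iff) (metis add_eq_0_iff)

lemma cf_nat_mult: "x \<in> carrier S \<Longrightarrow> cf ([(n::nat)] \<cdot>\<^bsub>S\<^esub> x) = (\<lambda>k. int n * cf x k)"
  by (induction n) (auto simp: cf_zero cf_add algebra_simps)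

lemma cf_int_mult: "x \<in> carrier S \<Longrightarrow> cf ([(n::int)] \<cdot>\<^bsub>S\<^esub> x) = (\<lambda>k. n * cf x k)"
  using add_pow_int_ge[of n S x] add_pow_int_lt[of n S x]
  by (cases "n \<ge> 0") (auto simp: cf_nat_mult cf_minus)

lemma zero_int_mult [simp]: "[(0::int)] \<cdot>\<^bsub>S\<^esub> x = \<zero>\<^bsub>S\<^esub>"
  using add_pow_int_ge[of 0 S x] by simp

lemma cf_\<beta>: "cf (\<beta> j) = (\<lambda>i. of_bool (i = j))"
proof -
  have "lc (\<lambda>i. of_bool (i = j)) = (\<Oplus>\<^bsub>S\<^esub>i\<in>UNIV. if i = j then \<beta> i else \<zero>\<^bsub>S\<^esub>)"
    unfolding lc_def by (intro R.finsum_cong') auto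
  also have "\<dots> = \<beta> j"
    using R.finsum_singleton[of j UNIV \<beta>] by (simp add: eq_commute)
  finally show ?thesis by (metis cf_lc)
qed

definition N :: "'n \<Rightarrow> 'n \<Rightarrow> 'n \<Rightarrow> int" where "N i j k = fusion_coeff S (\<beta> i) (\<beta> j) (\<beta> k)"
definition dual :: "'n \<Rightarrow> 'n" where "dual i = ix (invol S (\<beta> i))"
definition unit :: 'n where "unit = ix \<one>\<^bsub>S\<^esub>"

lemma \<beta>_unit: "\<beta> unit = \<one>\<^bsub>S\<^esub>"
  by (simp add: unit_def one_basis)

lemma \<beta>_dual: "\<beta> (dual i) = invol S (\<beta> i)"
  by (simp add: dual_def invol_closed)

lemma cf_\<beta>_mult: "cf (\<beta> i \<otimes>\<^bsub>S\<^esub> \<beta> j) k = N i j k"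
  by (simp add: cf_def N_def fusion_coeff_def)

lemma cf_mult:
  assumes "x \<in> carrier S" "y \<in> carrier S"
  shows "cf (x \<otimes>\<^bsub>S\<^esub> y) k = (\<Sum>i\<in>UNIV. \<Sum>j\<in>UNIV. cf x i * cf y j * N i j k)"
proof -
  have "x \<otimes>\<^bsub>S\<^esub> y = lc (cf x) \<otimes>\<^bsub>S\<^esub> lc (cf y)" using assms by simp
  also have "\<dots> = (\<Oplus>\<^bsub>S\<^esub>i\<in>UNIV. ([cf x i] \<cdot>\<^bsub>S\<^esub> \<beta> i) \<otimes>\<^bsub>S\<^esub> lc (cf y))"
    unfolding lc_def[of "cf x"] by (rule R.finsum_ldistr) auto
  also have "\<dots> = (\<Oplus>\<^bsub>S\<^esub>i\<in>UNIV. \<Oplus>\<^bsub>S\<^esub>j\<in>UNIV. ([cf x i] \<cdot>\<^bsub>S\<^esub> \<beta> i) \<otimes>\<^bsub>S\<^esub> ([cf y j] \<cdot>\<^bsub>S\<^esub> \<beta> j))"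
    unfolding lc_def[of "cf y"] by (intro R.finsum_cong' refl R.finsum_rdistr) auto
  also have "\<dots> = (\<Oplus>\<^bsub>S\<^esub>i\<in>UNIV. \<Oplus>\<^bsub>S\<^esub>j\<in>UNIV. [cf y j] \<cdot>\<^bsub>S\<^esub> ([cf x i] \<cdot>\<^bsub>S\<^esub> (\<beta> i \<otimes>\<^bsub>S\<^esub> \<beta> j)))"
    by (intro R.finsum_cong' refl) (auto simp: R.add_pow_ldistr_int R.add_pow_rdistr_int)
  finally have eq: "x \<otimes>\<^bsub>S\<^esub> y = \<dots>" .
  show ?thesis
    unfolding eq by (simp add: cf_finsum cf_int_mult cf_\<beta>_mult Pi_def mult_ac)
qed

lemma \<beta>_mult: "\<beta> i \<otimes>\<^bsub>S\<^esub> \<beta> j = lc (N i j)"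
  using lc_cf[of "\<beta> i \<otimes>\<^bsub>S\<^esub> \<beta> j"] by (simp add: cf_\<beta>_mult[abs_def])

lemma cf_\<beta>_mult_left: "y \<in> carrier S \<Longrightarrow> cf (\<beta> i \<otimes>\<^bsub>S\<^esub> y) k = (\<Sum>j\<in>UNIV. cf y j * N i j k)"
proof -
  assume y: "y \<in> carrier S"
  have "(\<Sum>l\<in>UNIV. \<Sum>j\<in>UNIV. of_bool (l = i) * cf y j * N l j k) = (\<Sum>l\<in>UNIV. if l = i then \<Sum>j\<in>UNIV. cf y j * N i j k else 0)"
    by (intro sum.cong refl) auto
  then show ?thesis using y by (simp add: cf_mult cf_\<beta>)
qed

lemma cf_\<beta>_mult_right: "x \<in> carrier S \<Longrightarrow> cf (x \<otimes>\<^bsub>S\<^esub> \<beta> j) k = (\<Sum>i\<in>UNIV. cf x i * N i j k)"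
  by (simp add: cf_mult cf_\<beta> of_bool_def if_distrib[of "(*) _"] if_distrib[of "\<lambda>x. x * _"] cong: if_cong)

text \<open>The only axiom that is not a direct coordinate computation is \<open>N_dual\<close>: the
  anti-automorphism is given as a map on the ring and must first be shown to respect integral
  combinations.\<close>

lemma fusion_data: "fusion_data N dual unit"
proof
  fix i j k l
  show "0 \<le> N i j k" by (simp add: N_def coeff_nonneg)
  have "cf (\<beta> unit \<otimes>\<^bsub>S\<^esub> \<beta> j) k = of_bool (j = k)" unfolding \<beta>_unit by (auto simp: cf_\<beta>)
  then show "N unit j k = of_bool (j = k)" by (simp only: cf_\<beta>_mult)
  have "cf (\<beta> j \<otimes>\<^bsub>S\<^esub> \<beta> unit) k = of_bool (j = k)" unfolding \<beta>_unit by (auto simp: cf_\<beta>)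
  then show "N j unit k = of_bool (j = k)" by (simp only: cf_\<beta>_mult)
  have "cf ((\<beta> i \<otimes>\<^bsub>S\<^esub> \<beta> j) \<otimes>\<^bsub>S\<^esub> \<beta> k) l = cf (\<beta> i \<otimes>\<^bsub>S\<^esub> (\<beta> j \<otimes>\<^bsub>S\<^esub> \<beta> k)) l"
    by (simp add: R.m_assoc)
  then show "(\<Sum>m\<in>UNIV. N i j m * N m k l) = (\<Sum>m\<in>UNIV. N j k m * N i m l)"
    by (simp add: cf_\<beta>_mult_left cf_\<beta>_mult_right cf_\<beta>_mult)
  show "dual (dual i) = i" by (simp add: dual_def invol_closed invol_invol)
  show "N i (dual j) unit = of_bool (i = j)"
    by (simp add: N_def \<beta>_dual \<beta>_unit coeff_one)
  obtain h where h: "anti_automorphism S h" "\<And>x. x \<in> basis S \<Longrightarrow> h x = invol S x" using anti by blast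
  have h\<beta>: "h (\<beta> i) = \<beta> (dual i)" for i by (simp add: h(2) \<beta>_dual)
  have hcl: "h x \<in> carrier S" if "x \<in> carrier S" for x
    using h(1) that by (auto simp: anti_automorphism_def bij_betw_def)
  have hadd: "h (x \<oplus>\<^bsub>S\<^esub> y) = h x \<oplus>\<^bsub>S\<^esub> h y" if "x \<in> carrier S" "y \<in> carrier S" for x y
    using h(1) that by (simp add: anti_automorphism_def)
  have hzero: "h \<zero>\<^bsub>S\<^esub> = \<zero>\<^bsub>S\<^esub>"
    using hadd[of "\<zero>\<^bsub>S\<^esub>" "\<zero>\<^bsub>S\<^esub>"] hcl[of "\<zero>\<^bsub>S\<^esub>"] R.add.l_cancel_one'[of "h \<zero>\<^bsub>S\<^esub>" "h \<zero>\<^bsub>S\<^esub>"] by simp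
  have hneg: "h (\<ominus>\<^bsub>S\<^esub> x) = \<ominus>\<^bsub>S\<^esub> h x" if "x \<in> carrier S" for x
    using hadd[of "\<ominus>\<^bsub>S\<^esub> x" x] hzero that hcl by (simp add: R.l_neg R.minus_equality)
  have hnat: "h ([n] \<cdot>\<^bsub>S\<^esub> x) = [n] \<cdot>\<^bsub>S\<^esub> h x" if "x \<in> carrier S" for x and n :: nat
    using that by (induction n) (simp_all add: hzero hadd hcl)
  have hint: "h ([n] \<cdot>\<^bsub>S\<^esub> x) = [n] \<cdot>\<^bsub>S\<^esub> h x" if "x \<in> carrier S" for x and n :: int
    using add_pow_int_ge[of n S] add_pow_int_lt[of n S] that
    by (cases "n \<ge> 0") (auto simp: hnat hneg)
  have hsum: "h (\<Oplus>\<^bsub>S\<^esub>i\<in>A. f i) = (\<Oplus>\<^bsub>S\<^esub>i\<in>A. h (f i))" if "finite A" "f \<in> A \<rightarrow> carrier S" for A and f :: "'n \<Rightarrow> 'a"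
    using that by (induction A rule: finite_induct) (auto simp: hzero hadd hcl Pi_def)
  \<comment> \<open>Being additive and equal to the involution on the basis, \<open>h\<close>
    permutes coordinates by \<open>dual\<close>.\<close>
  have hlc: "cf (h (lc c)) (dual k) = c k" for c k
  proof -
    have "h (lc c) = (\<Oplus>\<^bsub>S\<^esub>i\<in>UNIV. [c i] \<cdot>\<^bsub>S\<^esub> \<beta> (dual i))"
      unfolding lc_def by (subst hsum) (auto simp: hint h\<beta> Pi_def)
    then have "cf (h (lc c)) (dual k) = (\<Sum>i\<in>UNIV. c i * of_bool (dual k = dual i))"
      by (simp add: cf_finsum cf_int_mult cf_\<beta> Pi_def)
    also have "\<dots> = (\<Sum>i\<in>UNIV. if i = k then c k else 0)"
    proof (intro sum.cong refl)
      fix i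
      have "dual (dual m) = m" for m by (simp add: dual_def invol_closed invol_invol)
      then have "dual k = dual i \<longleftrightarrow> i = k" by metis
      then show "c i * of_bool (dual k = dual i) = (if i = k then c k else 0)" by simp
    qed
    finally show ?thesis by simp
  qed
  have "cf (\<beta> (dual j) \<otimes>\<^bsub>S\<^esub> \<beta> (dual i)) (dual k) = cf (h (\<beta> i \<otimes>\<^bsub>S\<^esub> \<beta> j)) (dual k)"
    using h(1) by (simp add: anti_automorphism_def flip: h\<beta>)
  also have "\<dots> = N i j k" unfolding \<beta>_mult by (rule hlc)
  finally show "N (dual j) (dual i) (dual k) = N i j k" by (simp only: cf_\<beta>_mult)
qed

sublocale fusion_data N dual unit by (rule fusion_data)

lemma noncommutative_coeff:
  assumes "noncommutative S" shows "\<exists>p q r. N p q r \<noteq> N q p r"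
proof (rule ccontr)
  assume "\<not> ?thesis"
  then have c: "N p q r = N q p r" for p q r by simp
  obtain x y where xy: "x \<in> carrier S" "y \<in> carrier S" "x \<otimes>\<^bsub>S\<^esub> y \<noteq> y \<otimes>\<^bsub>S\<^esub> x"
    using assms by (auto simp: noncommutative_def)
  have "cf (x \<otimes>\<^bsub>S\<^esub> y) k = cf (y \<otimes>\<^bsub>S\<^esub> x) k" for k
    using xy by (simp add: cf_mult) (subst sum.swap, simp add: c[of _ _ k] mult_ac)
  then show False using cf_inj[of "x \<otimes>\<^bsub>S\<^esub> y" "y \<otimes>\<^bsub>S\<^esub> x"] xy by auto
qed

lemma hom_lc:
  assumes d: "d \<in> Ring.ring_hom S (class_ring :: real ring)"
  shows "d (lc c) = (\<Sum>i\<in>UNIV. of_int (c i) * d (\<beta> i))"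
proof -
  have add: "d (x \<oplus>\<^bsub>S\<^esub> y) = d x + d y" if "x \<in> carrier S" "y \<in> carrier S" for x y
    using ring_hom_add[OF d that] by (simp add: class_ring_simps)
  have zero: "d \<zero>\<^bsub>S\<^esub> = 0" using add[of "\<zero>\<^bsub>S\<^esub>" "\<zero>\<^bsub>S\<^esub>"] by simp
  have neg: "d (\<ominus>\<^bsub>S\<^esub> x) = - d x" if "x \<in> carrier S" for x
    using add[of x "\<ominus>\<^bsub>S\<^esub> x"] that zero by (simp add: R.r_neg)
  have nat: "d ([n] \<cdot>\<^bsub>S\<^esub> x) = of_nat n * d x" if "x \<in> carrier S" for x and n :: nat
    using that by (induction n) (simp_all add: zero add algebra_simps)
  have int: "d ([n] \<cdot>\<^bsub>S\<^esub> x) = of_int n * d x" if "x \<in> carrier S" for x and n :: int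
    using add_pow_int_ge[of n S x] add_pow_int_lt[of n S x] that
    by (cases "n \<ge> 0") (auto simp: nat neg)
  have "d (\<Oplus>\<^bsub>S\<^esub>i\<in>A. f i) = (\<Sum>i\<in>A. d (f i))" if "finite A" "f \<in> A \<rightarrow> carrier S" for A and f :: "'n \<Rightarrow> 'a"
    using that by (induction A rule: finite_induct) (auto simp: zero add Pi_def)
  then show ?thesis by (simp add: lc_def int)
qed

lemma FPdim_character:
  assumes "is_FPdim S d"
  shows "character (\<lambda>i. of_real (d (\<beta> i)))" "0 < d (\<beta> i)"
proof -
  have d: "d \<in> Ring.ring_hom S (class_ring :: real ring)" using assms by (simp add: is_FPdim_def)
  have "d (\<beta> i) * d (\<beta> j) = (\<Sum>k\<in>UNIV. of_int (N i j k) * d (\<beta> k))" for i j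
    using ring_hom_mult[OF d, of "\<beta> i" "\<beta> j"] hom_lc[OF d, of "N i j"] by (simp add: \<beta>_mult class_ring_simps)
  then have "complex_of_real (d (\<beta> i) * d (\<beta> j)) = of_real (\<Sum>k\<in>UNIV. of_int (N i j k) * d (\<beta> k))" for i j
    by (simp only:)
  then have "complex_of_real (d (\<beta> i)) * of_real (d (\<beta> j)) = (\<Sum>k\<in>UNIV. of_int (N i j k) * of_real (d (\<beta> k)))" for i j
    by simp
  moreover have "d (\<beta> unit) = 1" using ring_hom_one[OF d] by (simp add: \<beta>_unit class_ring_simps)
  ultimately show "character (\<lambda>i. of_real (d (\<beta> i)))" by (simp add: character_def)
  show "0 < d (\<beta> i)" using assms by (simp add: is_FPdim_def)
qed

text \<open>Distinct characters are orthogonal, whereas two positive ones have a positive pairing.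
  Extensionality settles the values off the carrier.\<close>

lemma FPdim_unique:
  assumes "is_FPdim S d" "is_FPdim S d'" shows "d = d'"
proof -
  have eq: "d (\<beta> i) = d' (\<beta> i)" for i
  proof (rule ccontr)
    assume "d (\<beta> i) \<noteq> d' (\<beta> i)"
    then have "(\<lambda>i. complex_of_real (d (\<beta> i))) \<noteq> (\<lambda>i. of_real (d' (\<beta> i)))" by (metis of_real_eq_iff)
    from character_orth[OF FPdim_character(1)[OF assms(1)] FPdim_character(1)[OF assms(2)] this]
    have "complex_of_real (\<Sum>b\<in>UNIV. d (\<beta> b) * d' (\<beta> (dual b))) = of_real 0" by simp
    then have "(\<Sum>b\<in>UNIV. d (\<beta> b) * d' (\<beta> (dual b))) = 0" by (simp only: of_real_eq_iff)
    moreover have "0 < (\<Sum>b\<in>UNIV. d (\<beta> b) * d' (\<beta> (dual b)))"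
      by (intro sum_pos mult_pos_pos FPdim_character(2) assms) auto
    ultimately show False by simp
  qed
  have hom: "d \<in> Ring.ring_hom S (class_ring :: real ring)" "d' \<in> Ring.ring_hom S (class_ring :: real ring)"
    and ext: "d \<in> extensional (carrier S)" "d' \<in> extensional (carrier S)"
    using assms by (simp_all add: is_FPdim_def)
  have "d x = d' x" if "x \<in> carrier S" for x
    using hom_lc[OF hom(1), of "cf x"] hom_lc[OF hom(2), of "cf x"] that eq by simp
  then show ?thesis using ext by (intro extensionalityI) auto
qed

lemma FPdim_eq: "is_FPdim S d \<Longrightarrow> FPdim S = d"
  unfolding FPdim_def by (rule the_equality) (auto intro: FPdim_unique)

section \<open>Representations of the complexification\<close>

abbreviation "C \<equiv> complexification S"

definition mrep :: "nat \<Rightarrow> ('n \<Rightarrow> nat \<Rightarrow> nat \<Rightarrow> complex) \<Rightarrow> ('a \<Rightarrow> complex) \<Rightarrow> complex mat" where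
  "mrep n \<rho> x = mat n n (\<lambda>(i, j). \<Sum>b\<in>UNIV. x (\<beta> b) * \<rho> b i j)"

definition dirac :: "'n \<Rightarrow> 'a \<Rightarrow> complex" where
  "dirac b a = of_bool (a = \<beta> b)"

lemma mrep_carrier [simp]: "mrep n \<rho> x \<in> carrier_mat n n"
  by (simp add: mrep_def)

lemma mrep_index: "i < n \<Longrightarrow> j < n \<Longrightarrow> mrep n \<rho> x $$ (i, j) = (\<Sum>b\<in>UNIV. x (\<beta> b) * \<rho> b i j)"
  by (simp add: mrep_def)

lemma mem_C: "x \<in> carrier C \<longleftrightarrow> (\<forall>a. a \<notin> basis S \<longrightarrow> x a = 0)"
  by (simp add: complexification_def)

lemma C_eqI: "x \<in> carrier C \<Longrightarrow> y \<in> carrier C \<Longrightarrow> (\<And>i. x (\<beta> i) = y (\<beta> i)) \<Longrightarrow> x = y"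
  unfolding mem_C by (rule ext) (metis \<beta>_ix)

lemma C_add: "x \<oplus>\<^bsub>C\<^esub> y = (\<lambda>a. x a + y a)"
  by (simp add: complexification_def)

lemma C_mult_\<beta>: "(x \<otimes>\<^bsub>C\<^esub> y) (\<beta> k) = (\<Sum>i\<in>UNIV. \<Sum>j\<in>UNIV. x (\<beta> i) * y (\<beta> j) * of_int (N i j k))"
  by (simp add: complexification_def sum_basis N_def)

lemma C_mult_carrier: "x \<otimes>\<^bsub>C\<^esub> y \<in> carrier C"
  by (simp add: complexification_def)

lemma C_one_\<beta>: "\<one>\<^bsub>C\<^esub> (\<beta> k) = of_bool (k = unit)"
  by (auto simp: complexification_def \<beta>_unit[symmetric])

lemma C_one_carrier: "\<one>\<^bsub>C\<^esub> \<in> carrier C"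
  using one_basis by (auto simp: complexification_def)

lemma dirac_carrier [simp]: "dirac b \<in> carrier C"
  by (auto simp: mem_C dirac_def)

lemma dirac_\<beta> [simp]: "dirac b (\<beta> i) = of_bool (i = b)"
  by (simp add: dirac_def)

lemma mult_index:
  "A \<in> carrier_mat n m \<Longrightarrow> B \<in> carrier_mat m k \<Longrightarrow> i < n \<Longrightarrow> j < k \<Longrightarrow>
    (A * B) $$ (i, j) = (\<Sum>l<m. A $$ (i, l) * B $$ (l, j))"
  by (auto simp: scalar_prod_def lessThan_atLeast0)

lemma mult_vec_index:
  "A \<in> carrier_mat n m \<Longrightarrow> v \<in> carrier_vec m \<Longrightarrow> i < n \<Longrightarrow> (A *\<^sub>v v) $ i = (\<Sum>l<m. A $$ (i, l) * v $ l)"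
  by (auto simp: scalar_prod_def lessThan_atLeast0)

lemma is_rep_mrep:
  assumes \<rho>: "rep n \<rho>" shows "is_rep S n (mrep n \<rho>)"
  unfolding is_rep_def Ring.ring_hom_def
proof (intro conjI CollectI allI impI ballI)
  show "mrep n \<rho> \<in> carrier C \<rightarrow> carrier (ring_mat TYPE(complex) n ())"
    by (auto simp: ring_mat_simps)
  show "mrep n \<rho> \<one>\<^bsub>C\<^esub> = \<one>\<^bsub>ring_mat TYPE(complex) n ()\<^esub>"
  proof (rule eq_matI)
    fix i j assume "i < dim_row \<one>\<^bsub>ring_mat TYPE(complex) n ()\<^esub>" "j < dim_col \<one>\<^bsub>ring_mat TYPE(complex) n ()\<^esub>"
    then have ij: "i < n" "j < n" by (simp_all add: ring_mat_simps)
    have "(\<Sum>b\<in>UNIV. of_bool (b = unit) * \<rho> b i j) = (\<Sum>b\<in>UNIV. if b = unit then \<rho> b i j else 0)"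
      by (intro sum.cong) auto
    then show "mrep n \<rho> \<one>\<^bsub>C\<^esub> $$ (i, j) = \<one>\<^bsub>ring_mat TYPE(complex) n ()\<^esub> $$ (i, j)"
      using ij rep_unit[OF \<rho> ij] by (simp add: mrep_index C_one_\<beta> ring_mat_simps)
  qed (simp_all add: ring_mat_simps mrep_def)
  fix x y assume xy: "x \<in> carrier C \<and> y \<in> carrier C"
  show "mrep n \<rho> (x \<oplus>\<^bsub>C\<^esub> y) = mrep n \<rho> x \<oplus>\<^bsub>ring_mat TYPE(complex) n ()\<^esub> mrep n \<rho> y"
    by (rule eq_matI) (auto simp: ring_mat_simps mrep_def C_add algebra_simps sum.distrib)
  show "mrep n \<rho> (x \<otimes>\<^bsub>C\<^esub> y) = mrep n \<rho> x \<otimes>\<^bsub>ring_mat TYPE(complex) n ()\<^esub> mrep n \<rho> y"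
    unfolding ring_mat_simps
  proof (rule eq_matI)
    fix i j assume "i < dim_row (mrep n \<rho> x * mrep n \<rho> y)" "j < dim_col (mrep n \<rho> x * mrep n \<rho> y)"
    then have ij: "i < n" "j < n" by (simp_all add: mrep_def)
    have "mrep n \<rho> (x \<otimes>\<^bsub>C\<^esub> y) $$ (i, j) = (\<Sum>k\<in>UNIV. \<Sum>a\<in>UNIV. \<Sum>b\<in>UNIV. x (\<beta> a) * y (\<beta> b) * (of_int (N a b k) * \<rho> k i j))"
      using ij by (simp add: mrep_index C_mult_\<beta> sum_distrib_right mult.assoc)
    also have "\<dots> = (\<Sum>a\<in>UNIV. \<Sum>k\<in>UNIV. \<Sum>b\<in>UNIV. x (\<beta> a) * y (\<beta> b) * (of_int (N a b k) * \<rho> k i j))"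
      by (rule sum.swap)
    also have "\<dots> = (\<Sum>a\<in>UNIV. \<Sum>b\<in>UNIV. \<Sum>k\<in>UNIV. x (\<beta> a) * y (\<beta> b) * (of_int (N a b k) * \<rho> k i j))"
      by (rule sum.cong[OF refl]) (rule sum.swap)
    also have "\<dots> = (\<Sum>a\<in>UNIV. \<Sum>b\<in>UNIV. x (\<beta> a) * y (\<beta> b) * (\<Sum>m<n. \<rho> a i m * \<rho> b m j))"
      by (simp only: rep_mult[OF \<rho> ij] sum_distrib_left[symmetric])
    also have "\<dots> = (\<Sum>a\<in>UNIV. \<Sum>b\<in>UNIV. \<Sum>m<n. (x (\<beta> a) * \<rho> a i m) * (y (\<beta> b) * \<rho> b m j))"
      by (simp add: sum_distrib_left mult_ac)
    also have "\<dots> = (\<Sum>m<n. (\<Sum>a\<in>UNIV. x (\<beta> a) * \<rho> a i m) * (\<Sum>b\<in>UNIV. y (\<beta> b) * \<rho> b m j))"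
      by (simp add: sum_product sum.swap[of _ UNIV "{..<n}"])
    also have "\<dots> = (mrep n \<rho> x * mrep n \<rho> y) $$ (i, j)"
      using ij by (simp add: mult_index[OF mrep_carrier mrep_carrier] mrep_index)
    finally show "mrep n \<rho> (x \<otimes>\<^bsub>C\<^esub> y) $$ (i, j) = (mrep n \<rho> x * mrep n \<rho> y) $$ (i, j)" .
  qed (simp_all add: mrep_def)
next
  fix c x
  show "mrep n \<rho> (\<lambda>a. c * x a) = c \<cdot>\<^sub>m mrep n \<rho> x"
    by (rule eq_matI) (auto simp: mrep_def sum_distrib_left mult.assoc)
qed

text \<open>Conversely to \<open>is_rep_mrep\<close>: by linearity a representation is determined by
  its matrices at the Dirac vectors, and these satisfy the product rule of the structure
  constants.\<close>

lemma is_rep_coefficients: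
  assumes "is_rep S n \<sigma>"
  obtains \<tau> where "rep n \<tau>" "\<And>x. x \<in> carrier C \<Longrightarrow> \<sigma> x = mrep n \<tau> x"
proof -
  define \<tau> where "\<tau> b i j = \<sigma> (dirac b) $$ (i, j)" for b i j
  have carr: "\<sigma> x \<in> carrier_mat n n" if "x \<in> carrier C" for x
    using assms that by (auto simp: is_rep_def Ring.ring_hom_def ring_mat_simps)
  have mult: "\<sigma> (x \<otimes>\<^bsub>C\<^esub> y) = \<sigma> x * \<sigma> y" if "x \<in> carrier C" "y \<in> carrier C" for x y
    using assms that by (auto simp: is_rep_def Ring.ring_hom_def ring_mat_simps)
  have add: "\<sigma> (\<lambda>a. x a + y a) = \<sigma> x + \<sigma> y" if "x \<in> carrier C" "y \<in> carrier C" for x y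
    using assms that unfolding is_rep_def Ring.ring_hom_def by (simp add: ring_mat_simps C_add)
  have one: "\<sigma> \<one>\<^bsub>C\<^esub> = 1\<^sub>m n"
    using assms by (simp add: is_rep_def Ring.ring_hom_def ring_mat_simps)
  have scale: "\<sigma> (\<lambda>a. c * x a) = c \<cdot>\<^sub>m \<sigma> x" if "x \<in> carrier C" for c x
    using assms that by (simp add: is_rep_def)
  have comb: "(\<lambda>a. \<Sum>b\<in>A. c b * dirac b a) \<in> carrier C \<and>
      \<sigma> (\<lambda>a. \<Sum>b\<in>A. c b * dirac b a) $$ (i, j) = (\<Sum>b\<in>A. c b * \<tau> b i j)"
    if "finite A" "i < n" "j < n" for A c i j
    using that(1)
  proof (induction A rule: finite_induct)
    case empty
    \<comment> \<open>The empty combination is the zero vector; scaling by 0 shows that \<sigma>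
      sends it to the zero matrix.\<close>
    have "\<sigma> (\<lambda>a. 0 * dirac unit a) = 0 \<cdot>\<^sub>m \<sigma> (dirac unit)" by (rule scale) simp
    then show ?case using that carr[OF dirac_carrier, of unit] by (auto simp: mem_C)
  next
    case (insert e A)
    have e: "(\<lambda>a. c e * dirac e a) \<in> carrier C" using dirac_carrier[of e] by (simp add: mem_C)
    have "\<sigma> (\<lambda>a. \<Sum>b\<in>insert e A. c b * dirac b a) = \<sigma> (\<lambda>a. c e * dirac e a) + \<sigma> (\<lambda>a. \<Sum>b\<in>A. c b * dirac b a)"
      using insert.hyps add[OF e conjunct1[OF insert.IH]] by simp
    moreover have "\<sigma> (\<lambda>a. c e * dirac e a) = c e \<cdot>\<^sub>m \<sigma> (dirac e)" by (rule scale) simp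
    ultimately show ?case
      using insert that e carr[OF conjunct1[OF insert.IH]] carr[OF dirac_carrier, of e]
      by (auto simp: \<tau>_def mem_C)
  qed
  have eq: "\<sigma> x = mrep n \<tau> x" if x: "x \<in> carrier C" for x
  proof (rule eq_matI)
    show "dim_row (\<sigma> x) = dim_row (mrep n \<tau> x)" "dim_col (\<sigma> x) = dim_col (mrep n \<tau> x)"
      using carr[OF x] by (auto simp: mrep_def)
    fix i j assume "i < dim_row (mrep n \<tau> x)" "j < dim_col (mrep n \<tau> x)"
    then have ij: "i < n" "j < n" by (simp_all add: mrep_def)
    have "x = (\<lambda>a. \<Sum>b\<in>UNIV. x (\<beta> b) * dirac b a)"
    proof (rule C_eqI[OF x conjunct1[OF comb[OF finite ij]]])
      fix i
      have "(\<Sum>b\<in>UNIV. x (\<beta> b) * dirac b (\<beta> i)) = (\<Sum>b\<in>UNIV. if b = i then x (\<beta> b) else 0)"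
        by (intro sum.cong) auto
      then show "x (\<beta> i) = (\<Sum>b\<in>UNIV. x (\<beta> b) * dirac b (\<beta> i))" by simp
    qed
    then have "\<sigma> x $$ (i, j) = \<sigma> (\<lambda>a. \<Sum>b\<in>UNIV. x (\<beta> b) * dirac b a) $$ (i, j)" by (rule arg_cong)
    then show "\<sigma> x $$ (i, j) = mrep n \<tau> x $$ (i, j)"
      using ij conjunct2[OF comb[OF finite ij]] by (simp add: mrep_index)
  qed
  have "rep n \<tau>"
    unfolding rep_def
  proof (intro conjI allI impI)
    fix i j assume ij: "i < n" "j < n"
    have "dirac unit = \<one>\<^bsub>C\<^esub>"
      by (rule C_eqI) (auto simp: C_one_carrier C_one_\<beta>)
    then show "\<tau> unit i j = of_bool (i = j)" using ij by (simp add: \<tau>_def one)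
  next
    fix a b i j assume ij: "i < n" "j < n"
    have "(\<Sum>m<n. \<tau> a i m * \<tau> b m j) = (\<sigma> (dirac a) * \<sigma> (dirac b)) $$ (i, j)"
      using ij by (simp add: mult_index[OF carr carr] \<tau>_def)
    also have "\<dots> = mrep n \<tau> (dirac a \<otimes>\<^bsub>C\<^esub> dirac b) $$ (i, j)"
      unfolding mult[OF dirac_carrier dirac_carrier, symmetric] by (simp only: eq[OF C_mult_carrier])
    also have "\<dots> = (\<Sum>c\<in>UNIV. (dirac a \<otimes>\<^bsub>C\<^esub> dirac b) (\<beta> c) * \<tau> c i j)"
      using ij by (simp add: mrep_index)
    also have "\<dots> = (\<Sum>c\<in>UNIV. of_int (N a b c) * \<tau> c i j)"
    proof (intro sum.cong refl arg_cong2[of _ _ _ _ "(*)"])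
      fix c
      have "(dirac a \<otimes>\<^bsub>C\<^esub> dirac b) (\<beta> c) = (\<Sum>i\<in>UNIV. \<Sum>j\<in>UNIV. if j = b then if i = a then of_int (N a b c) else 0 else 0)"
        unfolding C_mult_\<beta> by (intro sum.cong refl) auto
      then show "(dirac a \<otimes>\<^bsub>C\<^esub> dirac b) (\<beta> c) = of_int (N a b c)" by simp
    qed
    finally show "(\<Sum>m<n. \<tau> a i m * \<tau> b m j) = (\<Sum>c\<in>UNIV. of_int (N a b c) * \<tau> c i j)" .
  qed
  then show ?thesis using that eq by blast
qed

text \<open>The Schur relations invert \<rho> explicitly: the element \<open>x\<close> is chosen so
  that its matrix has the single nonzero column \<open>v / w $ l\<close>, at a position
  \<open>l\<close> where \<open>w\<close> does not vanish.\<close>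

lemma mrep_transitive:
  assumes bi: "biorth n \<rho> g" and g: "g \<noteq> 0" and w: "w \<in> carrier_vec n" "w \<noteq> 0\<^sub>v n" and v: "v \<in> carrier_vec n"
  shows "\<exists>x\<in>carrier C. mrep n \<rho> x *\<^sub>v w = v"
proof -
  obtain l where l: "l < n" "w $ l \<noteq> 0"
    using w by (metis carrier_vecD eq_vecI index_zero_vec)
  define x where "x a = (if a \<in> basis S then \<Sum>k<n. v $ k / (g * w $ l) * \<rho> (dual (ix a)) l k else 0)" for a
  have "x \<in> carrier C" by (simp add: mem_C x_def)
  moreover have "mrep n \<rho> x *\<^sub>v w = v"
  proof (rule eq_vecI)
    fix i assume "i < dim_vec v"
    then have i: "i < n" using v by simp
    have xb: "(\<Sum>b\<in>UNIV. x (\<beta> b) * \<rho> b i j) = (if j = l then v $ i / w $ l else 0)" if j: "j < n" for j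
    proof -
      have "(\<Sum>b\<in>UNIV. x (\<beta> b) * \<rho> b i j) = (\<Sum>b\<in>UNIV. \<Sum>k<n. v $ k / (g * w $ l) * (\<rho> b i j * \<rho> (dual b) l k))"
        by (simp add: x_def sum_distrib_right sum_distrib_left mult_ac)
      also have "\<dots> = (\<Sum>k<n. v $ k / (g * w $ l) * (\<Sum>b\<in>UNIV. \<rho> b i j * \<rho> (dual b) l k))"
        by (subst sum.swap) (simp add: sum_distrib_left)
      also have "\<dots> = (\<Sum>k<n. if k = i then (if j = l then v $ i / w $ l else 0) else 0)"
        using biorthD[OF bi i j l(1)] g by (intro sum.cong refl) (auto simp: field_simps)
      finally show ?thesis using i by simp
    qed
    have "(mrep n \<rho> x *\<^sub>v w) $ i = (\<Sum>j<n. if j = l then v $ i / w $ l * w $ l else 0)"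
      unfolding mult_vec_index[OF mrep_carrier w(1) i] by (intro sum.cong refl) (auto simp: mrep_index i xb)
    then show "(mrep n \<rho> x *\<^sub>v w) $ i = v $ i" using l by simp
  qed (use v in \<open>simp add: mrep_def\<close>)
  ultimately show ?thesis by blast
qed

lemma subspace_vec_subset: "VectorSpace.subspace class_ring W (module_vec TYPE(complex) n) \<Longrightarrow> W \<subseteq> carrier_vec n"
  and subspace_vec_zero: "VectorSpace.subspace class_ring W (module_vec TYPE(complex) n) \<Longrightarrow> 0\<^sub>v n \<in> W"
  by (auto simp: VectorSpace.subspace_def LinearCombinations.submodule_def module_vec_simps)

lemma irreducible_mrep:
  assumes n: "0 < n" and \<rho>: "rep n \<rho>" and bi: "biorth n \<rho> g" and g: "g \<noteq> 0"
  shows "irreducible_rep S n (mrep n \<rho>)"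
  unfolding irreducible_rep_def
proof (intro conjI allI impI)
  show "is_rep S n (mrep n \<rho>)" by (rule is_rep_mrep[OF \<rho>])
  fix W assume W: "VectorSpace.subspace class_ring W (module_vec TYPE(complex) n) \<and>
    (\<forall>x\<in>carrier C. \<forall>w\<in>W. mrep n \<rho> x *\<^sub>v w \<in> W)"
  show "W = {0\<^sub>v n} \<or> W = carrier_vec n"
  proof (rule disjCI)
    assume "W \<noteq> carrier_vec n"
    then obtain v where v: "v \<in> carrier_vec n" "v \<notin> W" using subspace_vec_subset W by blast
    have "w = 0\<^sub>v n" if "w \<in> W" for w
    proof (rule ccontr)
      assume "w \<noteq> 0\<^sub>v n"
      moreover have "w \<in> carrier_vec n" using subspace_vec_subset[OF conjunct1[OF W]] that by blast
      ultimately obtain x where x: "x \<in> carrier C" "mrep n \<rho> x *\<^sub>v w = v"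
        using mrep_transitive[OF bi g _ _ v(1)] by blast
      have "mrep n \<rho> x *\<^sub>v w \<in> W" using conjunct2[OF W] x(1) that by blast
      then show False using x(2) v(2) by simp
    qed
    then show "W = {0\<^sub>v n}" using subspace_vec_zero W by blast
  qed
qed (rule n)

lemma cf_central_element: "cf (central_element S) k = (\<Sum>i\<in>UNIV. N i (dual i) k)"
proof -
  have "central_element S = (\<Oplus>\<^bsub>S\<^esub>b\<in>\<beta> ` UNIV. b \<otimes>\<^bsub>S\<^esub> invol S b)"
    using bij by (simp add: central_element_def bij_betw_def)
  also have "\<dots> = (\<Oplus>\<^bsub>S\<^esub>i\<in>UNIV. \<beta> i \<otimes>\<^bsub>S\<^esub> \<beta> (dual i))"
    unfolding \<beta>_dual using subsetD[OF basis_carrier invol_closed[OF \<beta>_basis]]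
    by (subst R.add.finprod_reindex) (auto simp: inj_on_def)
  finally show ?thesis by (simp add: cf_finsum cf_\<beta>_mult Pi_def)
qed

lemma complexify_carrier: "x \<in> carrier S \<Longrightarrow> complexify S x \<in> carrier C"
  by (simp add: mem_C complexify_def coord_off_basis)

lemma complexify_\<beta>: "complexify S x (\<beta> k) = of_int (cf x k)"
  by (simp add: complexify_def cf_def)

lemma central_element_carrier: "central_element S \<in> carrier S"
  unfolding central_element_def using basis_carrier invol_closed by (intro R.finsum_closed) auto

lemma mrep_central:
  assumes \<rho>: "rep n \<rho>" and bi: "biorth n \<rho> g"
  shows "mrep n \<rho> (complexify S (central_element S)) = (of_nat n * g) \<cdot>\<^sub>m 1\<^sub>m n"
proof (rule eq_matI)
  fix i j assume "i < dim_row ((of_nat n * g) \<cdot>\<^sub>m 1\<^sub>m n)" "j < dim_col ((of_nat n * g) \<cdot>\<^sub>m 1\<^sub>m n)"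
  then have ij: "i < n" "j < n" by simp_all
  have "mrep n \<rho> (complexify S (central_element S)) $$ (i, j) = (\<Sum>k\<in>UNIV. \<Sum>b\<in>UNIV. of_int (N b (dual b) k) * \<rho> k i j)"
    using ij by (simp add: mrep_index complexify_\<beta> cf_central_element sum_distrib_right)
  also have "\<dots> = (\<Sum>b\<in>UNIV. \<Sum>k\<in>UNIV. of_int (N b (dual b) k) * \<rho> k i j)" by (rule sum.swap)
  also have "\<dots> = (\<Sum>b\<in>UNIV. \<Sum>m<n. \<rho> b i m * \<rho> (dual b) m j)" by (simp only: rep_mult[OF \<rho> ij])
  also have "\<dots> = (\<Sum>m<n. \<Sum>b\<in>UNIV. \<rho> b i m * \<rho> (dual b) m j)" by (rule sum.swap)
  also have "\<dots> = (\<Sum>m<n. if i = j then g else 0)" using biorthD[OF bi] ij by (intro sum.cong refl) simp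
  also have "\<dots> = ((of_nat n * g) \<cdot>\<^sub>m 1\<^sub>m n) $$ (i, j)" using ij by simp
  finally show "mrep n \<rho> (complexify S (central_element S)) $$ (i, j) = ((of_nat n * g) \<cdot>\<^sub>m 1\<^sub>m n) $$ (i, j)" .
qed (simp_all add: mrep_def)

lemma formal_codegree_eqI:
  assumes "0 < n" "\<sigma> (complexify S (central_element S)) = (of_nat n * g) \<cdot>\<^sub>m 1\<^sub>m n"
  shows "formal_codegree S n \<sigma> = g"
proof -
  have "(THE \<alpha>. \<sigma> (complexify S (central_element S)) = \<alpha> \<cdot>\<^sub>m 1\<^sub>m n) = of_nat n * g"
  proof (rule the_equality[where P = "\<lambda>\<alpha>. \<sigma> (complexify S (central_element S)) = \<alpha> \<cdot>\<^sub>m 1\<^sub>m n", OF assms(2)])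
    fix \<alpha> assume "\<sigma> (complexify S (central_element S)) = \<alpha> \<cdot>\<^sub>m 1\<^sub>m n"
    then have "((of_nat n * g) \<cdot>\<^sub>m 1\<^sub>m n) $$ (0, 0) = (\<alpha> \<cdot>\<^sub>m 1\<^sub>m n) $$ (0, 0)" using assms(2) by simp
    then show "\<alpha> = of_nat n * g" using assms(1) by simp
  qed
  then show ?thesis using assms(1) by (simp add: formal_codegree_def)
qed

text \<open>Pairing P \<rho>(dual b) = \<sigma>(dual b) P with entries of \<rho>(b) gives zero on
  one side, by orthogonality, and the entries of P times \<open>g\<close> on the other. So every
  intertwiner is zero.\<close>

lemma not_equivalent_mrep:
  assumes n: "0 < n" and bi: "biorth n \<rho> g" and g: "g \<noteq> 0" and o: "orth n \<rho> m \<sigma>"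
  shows "\<not> equivalent_reps S n (mrep n \<rho>) m (mrep m \<sigma>)"
proof
  assume "equivalent_reps S n (mrep n \<rho>) m (mrep m \<sigma>)"
  then obtain P where nm: "n = m" and P: "P \<in> carrier_mat n n" "invertible_mat P"
    and eqm: "\<forall>x\<in>carrier C. P * mrep n \<rho> x = mrep m \<sigma> x * P"
    unfolding equivalent_reps_def by blast
  have eq: "P * mrep n \<rho> x = mrep n \<sigma> x * P" if "x \<in> carrier C" for x
    using eqm that nm by simp
  have o': "orth n \<rho> n \<sigma>" using o nm by simp
  have dirac: "mrep k \<theta> (dirac b) $$ (i, j) = \<theta> b i j" if "i < k" "j < k" for k \<theta> b i j
  proof -
    have "(\<Sum>c\<in>UNIV. dirac b (\<beta> c) * \<theta> c i j) = (\<Sum>c\<in>UNIV. if c = b then \<theta> c i j else 0)"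
      by (intro sum.cong) auto
    then show ?thesis using that by (simp add: mrep_index)
  qed
  have eq': "(\<Sum>p<n. P $$ (k, p) * \<rho> b p l) = (\<Sum>p<n. \<sigma> b k p * P $$ (p, l))" if kl: "k < n" "l < n" for b k l
  proof -
    have "(P * mrep n \<rho> (dirac b)) $$ (k, l) = (mrep n \<sigma> (dirac b) * P) $$ (k, l)" by (simp add: eq)
    then show ?thesis using kl by (simp add: mult_index[OF P(1) mrep_carrier] mult_index[OF mrep_carrier P(1)] dirac)
  qed
  have zero: "P $$ (k, j) = 0" if kj: "k < n" "j < n" for k j
  proof -
    have "0 = (\<Sum>q<n. (\<Sum>b\<in>UNIV. \<rho> b 0 j * \<sigma> (dual b) k q) * P $$ (q, 0))"
      using orthD[OF o'] kj n by simp
    also have "\<dots> = (\<Sum>b\<in>UNIV. \<rho> b 0 j * (\<Sum>q<n. \<sigma> (dual b) k q * P $$ (q, 0)))"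
      by (simp add: sum_distrib_left sum_distrib_right mult.assoc sum.swap[of _ UNIV "{..<n}"])
    also have "\<dots> = (\<Sum>b\<in>UNIV. \<rho> b 0 j * (\<Sum>p<n. P $$ (k, p) * \<rho> (dual b) p 0))"
      using kj n by (simp add: eq')
    also have "\<dots> = (\<Sum>p<n. P $$ (k, p) * (\<Sum>b\<in>UNIV. \<rho> b 0 j * \<rho> (dual b) p 0))"
      by (simp add: sum_distrib_left sum.swap[of _ UNIV "{..<n}"] mult_ac)
    also have "\<dots> = (\<Sum>p<n. if p = j then P $$ (k, j) * g else 0)"
      using biorthD[OF bi n kj(2) _ n] by (intro sum.cong refl) auto
    finally show ?thesis using kj g by simp
  qed
  obtain B where B: "P * B = 1\<^sub>m n" "B * P = 1\<^sub>m (dim_row B)"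
    using P unfolding invertible_mat_def inverts_mat_def by auto
  have "dim_col (B * P) = dim_row B" unfolding B(2) by simp
  moreover have "dim_col (P * B) = n" unfolding B(1) by simp
  ultimately have Bc: "B \<in> carrier_mat n n" using P(1) by auto
  have "(P * B) $$ (0, 0) = 0"
    unfolding mult_index[OF P(1) Bc n n] using zero n by (intro sum.neutral) simp
  then show False using n by (simp add: B(1))
qed

text \<open>If \<sigma> were orthogonal to every member, pairing \<open>family_unit\<close> with it
  would turn its entry 1 at the unit into 0. Hence some average is a nonzero intertwiner; it is
  injective because \<sigma> is irreducible and surjective by
  \<open>mrep_transitive\<close>.\<close>

lemma irreducible_complete:
  assumes L: "family L" and card: "(\<Sum>(n, \<rho>, g)\<leftarrow>L. n\<^sup>2) = CARD('n)" and pos: "\<And>n \<rho> g. (n, \<rho>, g) \<in> set L \<Longrightarrow> 0 < n"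
    and \<sigma>: "irreducible_rep S m \<sigma>"
  obtains n \<rho> g where "(n, \<rho>, g) \<in> set L" "equivalent_reps S m \<sigma> n (mrep n \<rho>)" "formal_codegree S m \<sigma> = g"
proof -
  have m: "0 < m" using \<sigma> by (simp add: irreducible_rep_def)
  obtain \<tau> where \<tau>: "rep m \<tau>" "\<And>x. x \<in> carrier C \<Longrightarrow> \<sigma> x = mrep m \<tau> x"
    using is_rep_coefficients[of m \<sigma>] \<sigma> unfolding irreducible_rep_def by blast
  have "\<exists>n \<rho> g. (n, \<rho>, g) \<in> set L \<and> \<not> orth n \<rho> m \<tau>"
  proof (rule ccontr)
    assume "\<not> ?thesis"
    then have orth: "orth (fst (L ! s)) (fst (snd (L ! s))) m \<tau>" if "s < length L" for s
      using that by (metis nth_mem prod.collapse)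
    have "1 = \<tau> (dual unit) 0 0" using rep_unit[OF \<tau>(1)] m by simp
    also have "\<dots> = (\<Sum>c\<in>UNIV. of_bool (c = unit) * \<tau> (dual c) 0 0)"
      by (simp add: of_bool_def if_distrib[of "\<lambda>x. x * _"] cong: if_cong)
    also have "\<dots> = (\<Sum>c\<in>UNIV. \<Sum>s<length L. \<Sum>i<fst (L ! s). fst (snd (L ! s)) c i i * \<tau> (dual c) 0 0 / snd (snd (L ! s)))"
      unfolding family_unit[OF L card]
      by (simp add: sum_list_sum_nth case_prod_unfold lessThan_atLeast0 sum_distrib_right sum_divide_distrib)
    also have "\<dots> = (\<Sum>s<length L. \<Sum>i<fst (L ! s). (\<Sum>c\<in>UNIV. fst (snd (L ! s)) c i i * \<tau> (dual c) 0 0) / snd (snd (L ! s)))"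
      by (subst sum.swap) (simp add: sum_divide_distrib sum.swap[of _ UNIV "{..<fst (L ! s)}" for s])
    also have "\<dots> = 0"
      using orthD[OF orth] m by (intro sum.neutral ballI) simp
    finally show False by simp
  qed
  then obtain n \<rho> g where t: "(n, \<rho>, g) \<in> set L" "\<not> orth n \<rho> m \<tau>" by blast
  then obtain i0 j0 k0 l0 where ij: "i0 < n" "j0 < n" "k0 < m" "l0 < m"
    and ne: "(\<Sum>b\<in>UNIV. \<rho> b i0 j0 * \<tau> (dual b) k0 l0) \<noteq> 0"
    by (auto simp: orth_def)
  have \<rho>: "rep n \<rho>" and bi: "biorth n \<rho> g" and g: "g \<noteq> 0"
    using L t(1) unfolding family_def by auto
  define T where "T = mat n m (\<lambda>(p, q). \<Sum>b\<in>UNIV. \<rho> b p j0 * \<tau> (dual b) k0 q)"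
  have T: "T \<in> carrier_mat n m" by (simp add: T_def)
  have inter: "T * \<sigma> x = mrep n \<rho> x * T" if x: "x \<in> carrier C" for x
  proof (rule eq_matI)
    fix i l assume "i < dim_row (mrep n \<rho> x * T)" "l < dim_col (mrep n \<rho> x * T)"
    then have il: "i < n" "l < m" using T by (simp_all add: mrep_def)
    have "(\<Sum>p<n. \<rho> a i p * T $$ (p, l)) = (\<Sum>p<m. T $$ (i, p) * \<tau> a p l)" for a
      using intertwine[OF \<rho> \<tau>(1) il(1) ij(2,3) il(2)] il by (simp add: T_def)
    then have "(\<Sum>a\<in>UNIV. x (\<beta> a) * (\<Sum>p<n. \<rho> a i p * T $$ (p, l))) = (\<Sum>a\<in>UNIV. x (\<beta> a) * (\<Sum>p<m. T $$ (i, p) * \<tau> a p l))"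
      by simp
    moreover have "(\<Sum>a\<in>UNIV. x (\<beta> a) * (\<Sum>p<n. \<rho> a i p * T $$ (p, l))) = (\<Sum>p<n. (\<Sum>a\<in>UNIV. x (\<beta> a) * \<rho> a i p) * T $$ (p, l))"
      by (simp add: sum_distrib_left sum_distrib_right sum.swap[of _ UNIV "{..<n}"] mult_ac)
    moreover have "(\<Sum>a\<in>UNIV. x (\<beta> a) * (\<Sum>p<m. T $$ (i, p) * \<tau> a p l)) = (\<Sum>p<m. T $$ (i, p) * (\<Sum>a\<in>UNIV. x (\<beta> a) * \<tau> a p l))"
      by (simp add: sum_distrib_left sum.swap[of _ UNIV "{..<m}"] mult_ac)
    ultimately show "(T * \<sigma> x) $$ (i, l) = (mrep n \<rho> x * T) $$ (i, l)"
      using il by (simp add: \<tau>(2)[OF x] mult_index[OF T mrep_carrier] mult_index[OF mrep_carrier T] mrep_index)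
  qed (use T in \<open>simp_all add: \<tau>(2)[OF x] mrep_def\<close>)
  have \<sigma>c: "\<sigma> x \<in> carrier_mat m m" if "x \<in> carrier C" for x by (simp add: \<tau>(2)[OF that])
  \<comment> \<open>The kernel of the intertwiner is an invariant subspace, so irreducibility of
    \<sigma> leaves only the trivial choices.\<close>
  define K where "K = {v \<in> carrier_vec m. T *\<^sub>v v = 0\<^sub>v n}"
  have "VectorSpace.subspace class_ring K (module_vec TYPE(complex) m)"
  proof -
    interpret V: vectorspace class_ring "module_vec TYPE(complex) m" by (rule vec_vs)
    show ?thesis
      unfolding VectorSpace.subspace_def
    proof (intro conjI LinearCombinations.submodule.intro)
      show "vectorspace class_ring (module_vec TYPE(complex) m)" by unfold_locales
      show "Module.module class_ring (module_vec TYPE(complex) m)" by unfold_locales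
      show "K \<subseteq> carrier (module_vec TYPE(complex) m)" by (auto simp: K_def module_vec_simps)
      show "v \<oplus>\<^bsub>module_vec TYPE(complex) m\<^esub> w \<in> K" if "v \<in> K" "w \<in> K" for v w
        using that T by (simp add: K_def module_vec_simps mult_add_distrib_mat_vec[OF T])
      show "\<zero>\<^bsub>module_vec TYPE(complex) m\<^esub> \<in> K" using T by (auto simp: K_def module_vec_simps)
      show "c \<odot>\<^bsub>module_vec TYPE(complex) m\<^esub> v \<in> K" if "v \<in> K" for c v
        using that T by (auto simp: K_def module_vec_simps mult_mat_vec[OF T])
    qed
  qed
  moreover have "\<sigma> x *\<^sub>v w \<in> K" if "x \<in> carrier C" "w \<in> K" for x w
  proof -
    have w: "w \<in> carrier_vec m" "T *\<^sub>v w = 0\<^sub>v n" using that by (auto simp: K_def)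
    have "T *\<^sub>v (\<sigma> x *\<^sub>v w) = (T * \<sigma> x) *\<^sub>v w" using assoc_mult_mat_vec[OF T \<sigma>c[OF that(1)] w(1)] by simp
    also have "\<dots> = mrep n \<rho> x *\<^sub>v (T *\<^sub>v w)"
      unfolding inter[OF that(1)] by (rule assoc_mult_mat_vec[OF mrep_carrier T w(1)])
    also have "\<dots> = 0\<^sub>v n" unfolding w(2) by (rule eq_vecI) (auto simp: mrep_def)
    finally show ?thesis using \<sigma>c[OF that(1)] w(1) by (auto simp: K_def)
  qed
  ultimately have K: "K = {0\<^sub>v m} \<or> K = carrier_vec m"
    using \<sigma> unfolding irreducible_rep_def by blast
  define w0 where "w0 = T *\<^sub>v unit_vec m l0"
  have "w0 $ i0 = (\<Sum>b\<in>UNIV. \<rho> b i0 j0 * \<tau> (dual b) k0 l0)"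
    unfolding w0_def using ij T by (simp add: mult_vec_index[OF T] T_def if_distrib[of "(*) _"] cong: if_cong)
  then have "w0 $ i0 \<noteq> 0" using ne by simp
  then have "w0 \<noteq> 0\<^sub>v n" using ij by auto
  moreover have "w0 \<in> carrier_vec n" using T by (simp add: w0_def)
  ultimately have w0: "w0 \<in> carrier_vec n" "w0 \<noteq> 0\<^sub>v n" by simp_all
  then have "unit_vec m l0 \<notin> K" by (simp add: K_def w0_def)
  then have K0: "K = {0\<^sub>v m}" using K unit_vec_carrier[of m l0] by blast
  have "\<exists>q\<in>carrier_vec m. T *\<^sub>v q = v" if v: "v \<in> carrier_vec n" for v
  proof -
    obtain x where x: "x \<in> carrier C" "mrep n \<rho> x *\<^sub>v w0 = v"
      using mrep_transitive[OF bi g w0 v] by blast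
    have "T *\<^sub>v (\<sigma> x *\<^sub>v unit_vec m l0) = (T * \<sigma> x) *\<^sub>v unit_vec m l0"
      using assoc_mult_mat_vec[OF T \<sigma>c[OF x(1)] unit_vec_carrier] by simp
    also have "\<dots> = v"
      unfolding inter[OF x(1)] using assoc_mult_mat_vec[OF mrep_carrier T unit_vec_carrier] x(2) by (simp add: w0_def)
    finally show ?thesis using \<sigma>c[OF x(1)] by (intro bexI[of _ "\<sigma> x *\<^sub>v unit_vec m l0"]) auto
  qed
  \<comment> \<open>Preimages of the unit vectors form the columns of a right inverse of
    \<open>T\<close>.\<close>
  then have "\<forall>i. \<exists>q. q \<in> carrier_vec m \<and> T *\<^sub>v q = unit_vec n i" by (meson unit_vec_carrier)
  then obtain q where q: "q i \<in> carrier_vec m" "T *\<^sub>v q i = unit_vec n i" for i by metis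
  define Q where "Q = mat m n (\<lambda>(r, i). q i $ r)"
  have Q: "Q \<in> carrier_mat m n" by (simp add: Q_def)
  have colQ: "col Q i = q i" if "i < n" for i
    using that q(1)[of i] by (intro eq_vecI) (auto simp: Q_def)
  have TQ: "T * Q = 1\<^sub>m n"
  proof (rule eq_matI)
    fix i j assume "i < dim_row (1\<^sub>m n)" "j < dim_col (1\<^sub>m n)"
    then have ij: "i < n" "j < n" by simp_all
    have "(T * Q) $$ (i, j) = (T *\<^sub>v q j) $ i"
      using ij T Q by (simp add: mult_mat_vec_def colQ)
    then show "(T * Q) $$ (i, j) = 1\<^sub>m n $$ (i, j)" using ij q(2)[of j] by simp
  qed (use T Q in simp_all)
  have QT: "Q * T = 1\<^sub>m m"
  proof -
    \<comment> \<open>\<open>T\<close> annihilates this difference since \<open>T * Q\<close> is the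
      identity, and its kernel is zero.\<close>
    have v0: "(Q * T) *\<^sub>v v - v = 0\<^sub>v m" if v: "v \<in> carrier_vec m" for v
    proof -
      have QTv: "(Q * T) *\<^sub>v v \<in> carrier_vec m" using Q T v by simp
      have "T *\<^sub>v ((Q * T) *\<^sub>v v) = (T * Q) *\<^sub>v (T *\<^sub>v v)"
        using assoc_mult_mat_vec[OF Q T v] assoc_mult_mat_vec[OF T Q, of "T *\<^sub>v v"] T v by simp
      also have "\<dots> = T *\<^sub>v v" unfolding TQ using T v by simp
      finally have "T *\<^sub>v ((Q * T) *\<^sub>v v - v) = 0\<^sub>v n"
        using mult_minus_distrib_mat_vec[OF T QTv v] T v by simp
      then have "(Q * T) *\<^sub>v v - v \<in> K" using QTv v by (simp add: K_def)
      then show ?thesis using K0 by simp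
    qed
    show ?thesis
    proof (rule eq_matI)
      fix i j assume "i < dim_row (1\<^sub>m m)" "j < dim_col (1\<^sub>m m)"
      then have ij: "i < m" "j < m" by simp_all
      have "((Q * T) *\<^sub>v unit_vec m j - unit_vec m j) $ i = 0" using v0[of "unit_vec m j"] ij by simp
      moreover have "((Q * T) *\<^sub>v unit_vec m j) $ i = (Q * T) $$ (i, j)"
      proof -
        define M where "M = Q * T"
        have M: "M \<in> carrier_mat m m" using Q T by (simp add: M_def)
        have "(M *\<^sub>v unit_vec m j) $ i = (\<Sum>l<m. if l = j then M $$ (i, j) else 0)"
          unfolding mult_vec_index[OF M unit_vec_carrier ij(1)] using ij by (intro sum.cong) auto
        then show ?thesis using ij by (simp add: M_def)
      qed
      ultimately show "(Q * T) $$ (i, j) = 1\<^sub>m m $$ (i, j)" using ij Q T by simp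
    qed (use Q T in simp_all)
  qed
  \<comment> \<open>The two products have equal traces, so the degrees agree.\<close>
  have "of_nat n = (\<Sum>i<n. (T * Q) $$ (i, i))" by (simp add: TQ)
  also have "\<dots> = (\<Sum>i<n. \<Sum>j<m. T $$ (i, j) * Q $$ (j, i))" by (simp add: mult_index[OF T Q])
  also have "\<dots> = (\<Sum>j<m. \<Sum>i<n. Q $$ (j, i) * T $$ (i, j))" by (subst sum.swap) (simp add: mult.commute)
  also have "\<dots> = (\<Sum>j<m. (Q * T) $$ (j, j))" by (simp add: mult_index[OF Q T])
  also have "\<dots> = (of_nat m :: complex)" by (simp add: QT)
  finally have nm: "m = n" by simp
  have "equivalent_reps S m \<sigma> n (mrep n \<rho>)"
    unfolding equivalent_reps_def
  proof (intro conjI nm bexI[of _ T])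
    show "invertible_mat T"
      unfolding invertible_mat_def inverts_mat_def using T Q TQ QT nm by (intro conjI exI[of _ Q]) auto
    show "\<forall>x\<in>carrier C. T * \<sigma> x = mrep n \<rho> x * T" using inter by blast
    show "T \<in> carrier_mat m m" using T nm by simp
  qed
  moreover have "formal_codegree S m \<sigma> = g"
  proof (rule formal_codegree_eqI[OF m])
    define z where "z = complexify S (central_element S)"
    have z: "z \<in> carrier C" unfolding z_def by (intro complexify_carrier central_element_carrier)
    have "T * \<sigma> z = ((of_nat n * g) \<cdot>\<^sub>m 1\<^sub>m n) * T" using inter[OF z] mrep_central[OF \<rho> bi] by (simp add: z_def)
    also have "\<dots> = (of_nat n * g) \<cdot>\<^sub>m T" using T by (simp add: mult_smult_assoc_mat[OF one_carrier_mat T])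
    finally have "Q * (T * \<sigma> z) = (of_nat n * g) \<cdot>\<^sub>m (Q * T)" using mult_smult_distrib[OF Q T] by simp
    then have "\<sigma> z = (of_nat n * g) \<cdot>\<^sub>m 1\<^sub>m m"
      using assoc_mult_mat[OF Q T \<sigma>c[OF z]] \<sigma>c[OF z] by (simp add: QT)
    then show "\<sigma> (complexify S (central_element S)) = (of_nat m * g) \<cdot>\<^sub>m 1\<^sub>m m" by (simp add: z_def nm)
  qed
  ultimately show ?thesis using that t(1) by blast
qed

lemma has_formal_codegrees_family:
  assumes L: "family L" and card: "(\<Sum>(n, \<rho>, g)\<leftarrow>L. n\<^sup>2) = CARD('n)" and pos: "\<And>n \<rho> g. (n, \<rho>, g) \<in> set L \<Longrightarrow> 0 < n"
  shows "has_formal_codegrees S (map (\<lambda>(n, \<rho>, g). (g, n)) L)"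
proof -
  define \<rho>s where "\<rho>s k = mrep (fst (L ! k)) (fst (snd (L ! k)))" for k
  have p: "0 < fst (L ! k)" if "k < length L" for k
    using pos[of "fst (L ! k)" "fst (snd (L ! k))" "snd (snd (L ! k))"] that by simp
  have n: "snd (map (\<lambda>(n, \<rho>, g). (g, n)) L ! k) = fst (L ! k)" "fst (map (\<lambda>(n, \<rho>, g). (g, n)) L ! k) = snd (snd (L ! k))"
    if "k < length L" for k using that by (simp_all add: case_prod_unfold)
  show ?thesis
    unfolding has_formal_codegrees_def
  proof (intro exI[of _ \<rho>s] conjI allI impI)
    fix k assume "k < length (map (\<lambda>(n, \<rho>, g). (g, n)) L)"
    then have k: "k < length L" by simp
    show "irreducible_rep S (snd (map (\<lambda>(n, \<rho>, g). (g, n)) L ! k)) (\<rho>s k)"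
      unfolding n[OF k] \<rho>s_def by (rule irreducible_mrep[OF p[OF k] family_nth[OF L k]])
    show "formal_codegree S (snd (map (\<lambda>(n, \<rho>, g). (g, n)) L ! k)) (\<rho>s k) = fst (map (\<lambda>(n, \<rho>, g). (g, n)) L ! k)"
      unfolding n[OF k] \<rho>s_def
      by (rule formal_codegree_eqI) (rule p[OF k], rule mrep_central[OF family_nth(1,2)[OF L k]])
  next
    fix k l assume "k < length (map (\<lambda>(n, \<rho>, g). (g, n)) L)" "l < length (map (\<lambda>(n, \<rho>, g). (g, n)) L)" and kl: "k \<noteq> l"
    then have k: "k < length L" and l: "l < length L" by simp_all
    show "\<not> equivalent_reps S (snd (map (\<lambda>(n, \<rho>, g). (g, n)) L ! k)) (\<rho>s k) (snd (map (\<lambda>(n, \<rho>, g). (g, n)) L ! l)) (\<rho>s l)"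
      unfolding n[OF k] n[OF l] \<rho>s_def
      by (rule not_equivalent_mrep[OF p[OF k] family_nth(2,3)[OF L k] family_orth[OF L k l kl]])
  next
    fix m \<sigma> assume irr: "irreducible_rep S m \<sigma>"
    obtain n' \<rho> g where t: "(n', \<rho>, g) \<in> set L" "equivalent_reps S m \<sigma> n' (mrep n' \<rho>)" "formal_codegree S m \<sigma> = g"
      by (rule irreducible_complete[OF L card _ irr]) (erule pos)
    then obtain k where k: "k < length L" "L ! k = (n', \<rho>, g)" by (auto simp: in_set_conv_nth)
    then show "\<exists>k<length (map (\<lambda>(n, \<rho>, g). (g, n)) L). equivalent_reps S m \<sigma> (snd (map (\<lambda>(n, \<rho>, g). (g, n)) L ! k)) (\<rho>s k)"
      using t(2) by (intro exI[of _ k]) (simp add: \<rho>s_def)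
  qed
qed

end

section \<open>The three rings\<close>

text \<open>The duality in all three models: \<open>g\<close> and its inverse are exchanged,
  everything else is self-dual.\<close>

definition swap12 :: "nat \<Rightarrow> nat" where
  "swap12 i = (if i = 1 then 2 else if i = 2 then 1 else i)"

definition std_char :: "int \<times> int \<Rightarrow> nat \<Rightarrow> int" where
  "std_char = (\<lambda>(p, q) i. if i < 3 then 1 else if i < 6 then p else q)"

text \<open>The two-dimensional representation of the symmetric group on three letters, extended by zero.\<close>

definition std_rep :: "nat \<Rightarrow> nat \<Rightarrow> nat \<Rightarrow> int" where
  "std_rep b i j = [[[1, 0], [0, 1]], [[0, - 1], [1, - 1]], [[- 1, 1], [- 1, 0]],
     [[0, 1], [1, 0]], [[- 1, 0], [- 1, 1]], [[1, - 1], [0, - 1]], [[0, 0], [0, 0]]] ! b ! i ! j"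

text \<open>Each entry consists of the structure parameters and, for each of the three characters, its values
  on \<open>s\<close> and \<open>y\<close> and its codegree; the last character is the Frobenius-Perron dimension.\<close>

definition std_data :: "((int \<times> int \<times> int \<times> int) \<times> ((int \<times> int) \<times> int) list) list" where
  "std_data =
    [((1, 0, 0, 2), [((0, - 1), 4), ((- 2, 3), 24), ((2, 3), 24)]),
     ((0, 0, 1, 5), [((- 1, 0), 6), ((1, - 1), 7), ((1, 6), 42)]),
     ((1, 1, 0, 2), [((0, - 1), 4), ((- 1, 3), 15), ((4, 3), 60)])]"

text \<open>Sums and quantifiers over the seven indices are written as list operations so that the
  identities can be settled by evaluation.\<close>

definition sum7 :: "(nat \<Rightarrow> int) \<Rightarrow> int" where "sum7 f = sum_list (map f [0..<7])"

definition all7 :: "(nat \<Rightarrow> bool) \<Rightarrow> bool" where "all7 A = list_all A [0..<7]"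

lemma sum7: "sum7 f = (\<Sum>i<7. f i)"
  by (simp add: sum7_def interv_sum_list_conv_sum_set_nat lessThan_atLeast0)

lemma all7: "all7 A \<longleftrightarrow> (\<forall>i<7. A i)"
  by (auto simp: all7_def list_all_iff)

definition assoc_check :: "int \<times> int \<times> int \<times> int \<Rightarrow> bool" where
  "assoc_check r = all7 (\<lambda>i. all7 (\<lambda>j. all7 (\<lambda>k. all7 (\<lambda>l.
     sum7 (\<lambda>m. std_coeff r i j m * std_coeff r m k l) = sum7 (\<lambda>m. std_coeff r j k m * std_coeff r i m l)))))"

lemma assoc_check_std: "assoc_check (1, 0, 0, 2)" "assoc_check (0, 0, 1, 5)" "assoc_check (1, 1, 0, 2)"
  by code_simp+

definition coeff_check :: "int \<times> int \<times> int \<times> int \<Rightarrow> bool" where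
  "coeff_check r = all7 (\<lambda>i. all7 (\<lambda>j. all7 (\<lambda>k.
     0 \<le> std_coeff r i j k \<and> std_coeff r (swap12 j) (swap12 i) (swap12 k) = std_coeff r i j k) \<and>
     std_coeff r 0 i j = of_bool (i = j) \<and> std_coeff r i 0 j = of_bool (i = j) \<and>
     std_coeff r i (swap12 j) 0 = of_bool (i = j)))"

definition character_check :: "(int \<times> int \<times> int \<times> int) \<times> ((int \<times> int) \<times> int) list \<Rightarrow> bool" where
  "character_check = (\<lambda>(r, ts). list_all (\<lambda>(t, a).
      all7 (\<lambda>i. all7 (\<lambda>j. std_char t i * std_char t j = sum7 (\<lambda>k. std_coeff r i j k * std_char t k))) \<and>
      sum7 (\<lambda>i. std_char t i * std_char t (swap12 i)) = a \<and>
      list_all (\<lambda>i. list_all (\<lambda>j. sum7 (\<lambda>b. std_rep b i j * std_char t (swap12 b)) = 0) [0, 1]) [0, 1]) ts \<and>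
    sorted_wrt (\<lambda>(t, a) (t', a'). sum7 (\<lambda>i. std_char t i * std_char t' (swap12 i)) = 0) ts)"

definition rep_check :: "int \<times> int \<times> int \<times> int \<Rightarrow> bool" where
  "rep_check r = list_all (\<lambda>i. list_all (\<lambda>j.
     all7 (\<lambda>a. all7 (\<lambda>b. std_rep a i 0 * std_rep b 0 j + std_rep a i 1 * std_rep b 1 j = sum7 (\<lambda>c. std_coeff r a b c * std_rep c i j))) \<and>
     list_all (\<lambda>k. list_all (\<lambda>l. sum7 (\<lambda>b. std_rep b i j * std_rep (swap12 b) k l) = (if i = l \<and> j = k then 3 else 0)) [0, 1]) [0, 1]) [0, 1]) [0, 1]"

lemma std_checks: "list_all (\<lambda>(r, ts). coeff_check r \<and> character_check (r, ts) \<and> rep_check r) std_data"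
  by code_simp

text \<open>Elements are integer sequences vanishing from 7 on, so equality in the ring is equality
  of functions. Duality is precomposition with \<open>swap12\<close>, which on basis vectors agrees
  with \<open>swap12\<close> on indices because that is an involution.\<close>

definition std_ring :: "int \<times> int \<times> int \<times> int \<Rightarrow> (nat \<Rightarrow> int) based_ring" where
  "std_ring r = \<lparr>carrier = {x. \<forall>i\<ge>7. x i = 0},
     monoid.mult = (\<lambda>x y k. if k < 7 then \<Sum>i<7. \<Sum>j<7. x i * y j * std_coeff r i j k else 0),
     monoid.one = (\<lambda>i. of_bool (i = 0)), ring.zero = (\<lambda>i. 0), ring.add = (\<lambda>x y i. x i + y i),
     basis = (\<lambda>j i. of_bool (i = j)) ` {..<7}, invol = (\<lambda>x i. x (swap12 i))\<rparr>"

definition vec7 :: "nat \<Rightarrow> nat \<Rightarrow> int" where "vec7 j = (\<lambda>i. of_bool (i = j))"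

lemma swap12_less: "i < 7 \<Longrightarrow> swap12 i < 7" and swap12_swap12 [simp]: "swap12 (swap12 i) = i"
  by (auto simp: swap12_def)

lemma std_ring_simps:
  "carrier (std_ring r) = {x. \<forall>i\<ge>7. x i = 0}" "\<one>\<^bsub>std_ring r\<^esub> = vec7 0" "\<zero>\<^bsub>std_ring r\<^esub> = (\<lambda>i. 0)"
  "basis (std_ring r) = vec7 ` {..<7}"
  by (simp_all add: std_ring_def vec7_def[abs_def])

lemma std_ring_add: "x \<oplus>\<^bsub>std_ring r\<^esub> y = (\<lambda>i. x i + y i)"
  by (simp add: std_ring_def)

lemma std_ring_mult: "x \<otimes>\<^bsub>std_ring r\<^esub> y = (\<lambda>k. if k < 7 then \<Sum>i<7. \<Sum>j<7. x i * y j * std_coeff r i j k else 0)"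
  by (simp add: std_ring_def)

lemma std_ring_invol: "invol (std_ring r) x = (\<lambda>i. x (swap12 i))"
  by (simp add: std_ring_def)

lemma vec7_apply [simp]: "vec7 j i = of_bool (i = j)"
  by (simp add: vec7_def)

lemma vec7_inj [simp]: "vec7 i = vec7 j \<longleftrightarrow> i = j"
  by (auto simp: vec7_def fun_eq_iff)

lemma vec7_carrier: "j < 7 \<Longrightarrow> vec7 j \<in> carrier (std_ring r)"
  by (auto simp: std_ring_simps)

text \<open>The type \<open>7\<close> serves as a set of seven indices; a chosen bijection links it
  to the numerals used in the evaluated checks.\<close>

definition idx :: "7 \<Rightarrow> nat" where "idx = (SOME f. bij_betw f UNIV {..<7})"

lemma bij_idx: "bij_betw idx UNIV {..<7}"
proof -
  have "\<exists>f. bij_betw f (UNIV :: 7 set) {..<7::nat}"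
    by (rule finite_same_card_bij) simp_all
  then show ?thesis unfolding idx_def by (rule someI_ex)
qed

lemma idx_less [simp]: "idx i < 7"
  using bij_idx by (auto simp: bij_betw_def)

lemma sum_idx: "(\<Sum>i\<in>UNIV. f (idx i)) = (\<Sum>i<7. f i)"
  by (rule sum.reindex_bij_betw[OF bij_idx])

definition enum7 :: "7 \<Rightarrow> nat \<Rightarrow> int" where "enum7 i = vec7 (idx i)"

section \<open>The models are fusion rings\<close>

locale std =
  fixes r :: "int \<times> int \<times> int \<times> int"
  assumes assoc: "assoc_check r" and coeff: "coeff_check r"
begin

lemma coeff_assoc: "i < 7 \<Longrightarrow> j < 7 \<Longrightarrow> k < 7 \<Longrightarrow> l < 7 \<Longrightarrow>
    (\<Sum>m<7. std_coeff r i j m * std_coeff r m k l) = (\<Sum>m<7. std_coeff r j k m * std_coeff r i m l)"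
  using assoc unfolding assoc_check_def all7 sum7 by blast

lemma coeff_facts:
  "i < 7 \<Longrightarrow> j < 7 \<Longrightarrow> k < 7 \<Longrightarrow> 0 \<le> std_coeff r i j k"
  "i < 7 \<Longrightarrow> j < 7 \<Longrightarrow> k < 7 \<Longrightarrow> std_coeff r (swap12 j) (swap12 i) (swap12 k) = std_coeff r i j k"
  "i < 7 \<Longrightarrow> j < 7 \<Longrightarrow> std_coeff r 0 i j = of_bool (i = j)"
  "i < 7 \<Longrightarrow> j < 7 \<Longrightarrow> std_coeff r i 0 j = of_bool (i = j)"
  "i < 7 \<Longrightarrow> j < 7 \<Longrightarrow> std_coeff r i (swap12 j) 0 = of_bool (i = j)"
  using coeff unfolding coeff_check_def all7 by blast+

lemma sum_of_bool_left: "(i::nat) < 7 \<Longrightarrow> (\<Sum>m<7. of_bool (m = i) * f m) = (f i :: int)"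
proof -
  assume i: "i < 7"
  have "(\<Sum>m<7. of_bool (m = i) * f m) = (\<Sum>m<7. if m = i then f i else 0)" by (intro sum.cong) auto
  then show ?thesis using i by simp
qed

lemma mult_assoc:
  "(x \<otimes>\<^bsub>std_ring r\<^esub> y) \<otimes>\<^bsub>std_ring r\<^esub> z = x \<otimes>\<^bsub>std_ring r\<^esub> (y \<otimes>\<^bsub>std_ring r\<^esub> z)"
proof
  fix l
  show "((x \<otimes>\<^bsub>std_ring r\<^esub> y) \<otimes>\<^bsub>std_ring r\<^esub> z) l = (x \<otimes>\<^bsub>std_ring r\<^esub> (y \<otimes>\<^bsub>std_ring r\<^esub> z)) l"
  proof (cases "l < 7")
    case l: True
    have "((x \<otimes>\<^bsub>std_ring r\<^esub> y) \<otimes>\<^bsub>std_ring r\<^esub> z) l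
      = (\<Sum>m<7. \<Sum>k<7. \<Sum>i<7. \<Sum>j<7. x i * y j * z k * (std_coeff r i j m * std_coeff r m k l))"
      using l by (simp add: std_ring_mult sum_distrib_right sum_distrib_left mult_ac)
    also have "\<dots> = (\<Sum>k<7. \<Sum>m<7. \<Sum>i<7. \<Sum>j<7. x i * y j * z k * (std_coeff r i j m * std_coeff r m k l))"
      by (rule sum.swap)
    also have "\<dots> = (\<Sum>k<7. \<Sum>i<7. \<Sum>m<7. \<Sum>j<7. x i * y j * z k * (std_coeff r i j m * std_coeff r m k l))"
      by (rule sum.cong[OF refl]) (rule sum.swap)
    also have "\<dots> = (\<Sum>k<7. \<Sum>i<7. \<Sum>j<7. \<Sum>m<7. x i * y j * z k * (std_coeff r i j m * std_coeff r m k l))"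
      by (rule sum.cong[OF refl], rule sum.cong[OF refl], rule sum.swap)
    also have "\<dots> = (\<Sum>k<7. \<Sum>i<7. \<Sum>j<7. \<Sum>m<7. x i * y j * z k * (std_coeff r j k m * std_coeff r i m l))"
      by (rule sum.cong[OF refl], rule sum.cong[OF refl], rule sum.cong[OF refl])
        (simp add: coeff_assoc l flip: sum_distrib_left)
    also have "\<dots> = (\<Sum>i<7. \<Sum>k<7. \<Sum>j<7. \<Sum>m<7. x i * y j * z k * (std_coeff r j k m * std_coeff r i m l))"
      by (rule sum.swap)
    also have "\<dots> = (\<Sum>i<7. \<Sum>j<7. \<Sum>k<7. \<Sum>m<7. x i * y j * z k * (std_coeff r j k m * std_coeff r i m l))"
      by (rule sum.cong[OF refl]) (rule sum.swap)
    also have "\<dots> = (\<Sum>i<7. \<Sum>j<7. \<Sum>m<7. \<Sum>k<7. x i * y j * z k * (std_coeff r j k m * std_coeff r i m l))"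
      by (rule sum.cong[OF refl], rule sum.cong[OF refl], rule sum.swap)
    also have "\<dots> = (\<Sum>i<7. \<Sum>m<7. \<Sum>j<7. \<Sum>k<7. x i * y j * z k * (std_coeff r j k m * std_coeff r i m l))"
      by (rule sum.cong[OF refl]) (rule sum.swap)
    also have "\<dots> = (x \<otimes>\<^bsub>std_ring r\<^esub> (y \<otimes>\<^bsub>std_ring r\<^esub> z)) l"
      using l by (simp add: std_ring_mult sum_distrib_right sum_distrib_left mult_ac)
    finally show ?thesis .
  qed (simp add: std_ring_mult)
qed

lemma vec7_mult_left: "i < 7 \<Longrightarrow> vec7 i \<otimes>\<^bsub>std_ring r\<^esub> y = (\<lambda>k. if k < 7 then \<Sum>j<7. y j * std_coeff r i j k else 0)"
proof -
  assume i: "i < 7"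
  have "(\<Sum>m<7. \<Sum>j<7. of_bool (m = i) * y j * std_coeff r m j k) = (\<Sum>m<7. of_bool (m = i) * (\<Sum>j<7. y j * std_coeff r m j k))" for k
    by (simp add: sum_distrib_left mult.assoc)
  then show ?thesis using i by (simp add: std_ring_mult sum_of_bool_left fun_eq_iff)
qed

lemma vec7_mult_right: "j < 7 \<Longrightarrow> x \<otimes>\<^bsub>std_ring r\<^esub> vec7 j = (\<lambda>k. if k < 7 then \<Sum>i<7. x i * std_coeff r i j k else 0)"
proof -
  assume j: "j < 7"
  have "(\<Sum>i<7. \<Sum>m<7. x i * of_bool (m = j) * std_coeff r i m k) = (\<Sum>i<7. \<Sum>m<7. of_bool (m = j) * (x i * std_coeff r i m k))" for k
    by (simp add: mult_ac)
  then show ?thesis using j by (simp add: std_ring_mult sum_of_bool_left fun_eq_iff)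
qed

lemma ring_std: "ring (std_ring r)"
proof (rule ringI)
  show "abelian_group (std_ring r)"
  proof (rule abelian_groupI)
    fix x assume "x \<in> carrier (std_ring r)"
    then show "\<exists>y\<in>carrier (std_ring r). y \<oplus>\<^bsub>std_ring r\<^esub> x = \<zero>\<^bsub>std_ring r\<^esub>"
      by (intro bexI[of _ "\<lambda>i. - x i"]) (auto simp: std_ring_simps std_ring_add)
  qed (auto simp: std_ring_simps std_ring_add)
  show "Group.monoid (std_ring r)"
  proof (rule Group.monoidI)
    fix x assume x: "x \<in> carrier (std_ring r)"
    have "(\<Sum>j<7. x j * of_bool (j = k)) = x k" if "k < 7" for k
      using sum_of_bool_left[OF that, of x] by (simp add: mult.commute)
    then show "\<one>\<^bsub>std_ring r\<^esub> \<otimes>\<^bsub>std_ring r\<^esub> x = x" "x \<otimes>\<^bsub>std_ring r\<^esub> \<one>\<^bsub>std_ring r\<^esub> = x"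
      using x by (auto simp: vec7_mult_left vec7_mult_right std_ring_simps(1,2) coeff_facts fun_eq_iff)
  qed (auto simp: std_ring_simps(1) std_ring_mult[of r] mult_assoc[simplified std_ring_mult] simp flip: vec7_def,
       auto simp: std_ring_simps mult_assoc[unfolded std_ring_mult])
qed (auto simp: std_ring_mult std_ring_add algebra_simps sum.distrib fun_eq_iff)

lemma lin_comb_std: "lin_comb (std_ring r) c = (\<lambda>i. if i < 7 then c (vec7 i) else 0)"
proof -
  interpret R: ring "std_ring r" by (rule ring_std)
  have minus: "\<ominus>\<^bsub>std_ring r\<^esub> x = (\<lambda>i. - x i)" if "x \<in> carrier (std_ring r)" for x
    using that by (intro R.minus_equality) (auto simp: std_ring_simps std_ring_add)
  have nat: "[n] \<cdot>\<^bsub>std_ring r\<^esub> x = (\<lambda>i. int n * x i)" if "x \<in> carrier (std_ring r)" for x and n :: nat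
    using that by (induction n) (auto simp: std_ring_simps std_ring_add algebra_simps)
  have int: "[n] \<cdot>\<^bsub>std_ring r\<^esub> x = (\<lambda>i. n * x i)" if "x \<in> carrier (std_ring r)" for x and n :: int
  proof (cases "n \<ge> 0")
    case False
    have "[nat (- n)] \<cdot>\<^bsub>std_ring r\<^esub> x \<in> carrier (std_ring r)" using that by simp
    then show ?thesis using False that add_pow_int_lt[of n "std_ring r" x] by (simp add: minus nat)
  qed (use that in \<open>simp add: add_pow_int_ge nat\<close>)
  have "lin_comb (std_ring r) c = (\<Oplus>\<^bsub>std_ring r\<^esub>j\<in>{..<7}. [c (vec7 j)] \<cdot>\<^bsub>std_ring r\<^esub> vec7 j)"
    unfolding lin_comb_def std_ring_simps
    by (subst R.add.finprod_reindex) (auto simp: inj_on_def intro!: R.add.int_pow_closed vec7_carrier)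
  also have "\<dots> = (\<Oplus>\<^bsub>std_ring r\<^esub>j\<in>{..<7}. (\<lambda>i. c (vec7 j) * of_bool (i = j)))"
    by (intro R.finsum_cong') (auto simp: int vec7_carrier std_ring_simps(1) vec7_def)
  also have "(\<Oplus>\<^bsub>std_ring r\<^esub>j\<in>A. (\<lambda>i. c (vec7 j) * of_bool (i = j))) = (\<lambda>i. if i \<in> A then c (vec7 i) else 0)"
    if "finite A" "A \<subseteq> {..<7}" for A
    using that
  proof (induction A rule: finite_induct)
    case empty
    then show ?case by (simp add: std_ring_simps)
  next
    case (insert j A)
    have "(\<Oplus>\<^bsub>std_ring r\<^esub>j\<in>insert j A. (\<lambda>i. c (vec7 j) * of_bool (i = j)))
      = (\<lambda>i. c (vec7 j) * of_bool (i = j)) \<oplus>\<^bsub>std_ring r\<^esub> (\<Oplus>\<^bsub>std_ring r\<^esub>j\<in>A. (\<lambda>i. c (vec7 j) * of_bool (i = j)))"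
      by (rule R.finsum_insert) (use insert.hyps insert.prems in \<open>auto simp: std_ring_simps(1)\<close>)
    also have "(\<Oplus>\<^bsub>std_ring r\<^esub>j\<in>A. (\<lambda>i. c (vec7 j) * of_bool (i = j))) = (\<lambda>i. if i \<in> A then c (vec7 i) else 0)"
      using insert.prems by (intro insert.IH) simp
    also have "(\<lambda>i. c (vec7 j) * of_bool (i = j)) \<oplus>\<^bsub>std_ring r\<^esub> (\<lambda>i. if i \<in> A then c (vec7 i) else 0) = (\<lambda>i. if i \<in> insert j A then c (vec7 i) else 0)"
      using insert.hyps by (auto simp: std_ring_add fun_eq_iff)
    finally show ?case .
  qed
  from this[of "{..<7}"] have "(\<Oplus>\<^bsub>std_ring r\<^esub>j\<in>{..<7}. (\<lambda>i. c (vec7 j) * of_bool (i = j))) = (\<lambda>i. if i < 7 then c (vec7 i) else 0)"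
    by simp
  finally show ?thesis .
qed

text \<open>Existence and uniqueness at once: evaluating a combination at \<open>i\<close> returns
  its coefficient at \<open>vec7 i\<close>, and off the basis coordinates vanish by
  definition.\<close>

lemma is_coord_std:
  assumes x: "x \<in> carrier (std_ring r)"
  shows "is_coord (std_ring r) x c \<longleftrightarrow> c = (\<lambda>a. if a \<in> vec7 ` {..<7} then x (inv_into UNIV vec7 a) else 0)"
proof -
  have inj: "inj vec7" by (rule injI) simp
  have x0: "x i = 0" if "\<not> i < 7" for i using x that by (simp add: std_ring_simps)
  show ?thesis
  proof
    assume c: "is_coord (std_ring r) x c"
    then have eq: "x i = (if i < 7 then c (vec7 i) else 0)" for i by (simp add: is_coord_def lin_comb_std)
    show "c = (\<lambda>a. if a \<in> vec7 ` {..<7} then x (inv_into UNIV vec7 a) else 0)"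
    proof
      fix a
      show "c a = (if a \<in> vec7 ` {..<7} then x (inv_into UNIV vec7 a) else 0)"
        using c eq by (cases "a \<in> vec7 ` {..<7}") (auto simp: inv_into_f_f[OF inj UNIV_I] is_coord_def std_ring_simps)
    qed
  next
    assume c: "c = (\<lambda>a. if a \<in> vec7 ` {..<7} then x (inv_into UNIV vec7 a) else 0)"
    have "x i = (if i < 7 then c (vec7 i) else 0)" for i
      using x0 by (simp add: c inv_into_f_f[OF inj UNIV_I])
    then have "x = lin_comb (std_ring r) c" unfolding lin_comb_std by (rule ext)
    then show "is_coord (std_ring r) x c"
      unfolding is_coord_def by (simp add: c std_ring_simps)
  qed
qed

lemma coord_std: "x \<in> carrier (std_ring r) \<Longrightarrow> i < 7 \<Longrightarrow> coord (std_ring r) x (vec7 i) = x i"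
proof -
  assume x: "x \<in> carrier (std_ring r)" and i: "i < 7"
  have "coord (std_ring r) x = (\<lambda>a. if a \<in> vec7 ` {..<7} then x (inv_into UNIV vec7 a) else 0)"
    unfolding coord_def by (rule the_equality) (simp_all only: is_coord_std[OF x])
  then show ?thesis using i by (simp add: inv_into_f_f inj_def)
qed

lemma fusion_coeff_std:
  assumes "i < 7" "j < 7" "k < 7"
  shows "fusion_coeff (std_ring r) (vec7 i) (vec7 j) (vec7 k) = std_coeff r i j k"
proof -
  interpret R: ring "std_ring r" by (rule ring_std)
  have "(vec7 i \<otimes>\<^bsub>std_ring r\<^esub> vec7 j) k = std_coeff r i j k"
    using assms sum_of_bool_left[OF assms(2), of "\<lambda>j. std_coeff r i j k"] by (simp add: vec7_mult_left)
  then show ?thesis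
    unfolding fusion_coeff_def using assms by (subst coord_std) (auto intro!: R.m_closed vec7_carrier)
qed

lemma invol_vec7: "invol (std_ring r) (vec7 i) = vec7 (swap12 i)"
proof -
  have "swap12 k = i \<longleftrightarrow> k = swap12 i" for k by (metis swap12_swap12)
  then show ?thesis by (simp add: std_ring_invol fun_eq_iff)
qed

lemma fusion_ring_std: "fusion_ring (std_ring r)"
  unfolding fusion_ring_def
proof (intro conjI ballI ring_std)
  show "free_basis (std_ring r)"
    unfolding free_basis_def using is_coord_std by (auto simp: std_ring_simps(4) intro: vec7_carrier)
  show "\<one>\<^bsub>std_ring r\<^esub> \<in> basis (std_ring r)" by (auto simp: std_ring_simps)
next
  fix x y z assume "x \<in> basis (std_ring r)" "y \<in> basis (std_ring r)" "z \<in> basis (std_ring r)"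
  then show "0 \<le> fusion_coeff (std_ring r) x y z"
    by (auto simp: std_ring_simps(4) fusion_coeff_std coeff_facts)
next
  fix x assume "x \<in> basis (std_ring r)"
  then show "invol (std_ring r) x \<in> basis (std_ring r)" "invol (std_ring r) (invol (std_ring r) x) = x"
    by (auto simp: std_ring_simps(4) invol_vec7 swap12_less)
next
  fix x y assume "x \<in> basis (std_ring r)" "y \<in> basis (std_ring r)"
  then show "fusion_coeff (std_ring r) x (invol (std_ring r) y) \<one>\<^bsub>std_ring r\<^esub> = (if x = y then 1 else 0)"
    by (auto simp: std_ring_simps(2,4) invol_vec7 fusion_coeff_std swap12_less coeff_facts)
next
  let ?f = "invol (std_ring r)"
  have bij: "bij_betw swap12 {..<7} {..<7}"
    by (rule bij_betw_byWitness[where f' = swap12]) (auto simp: swap12_less)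
  have closed: "?f x \<in> carrier (std_ring r)" if "x \<in> carrier (std_ring r)" for x
    using that by (auto simp: std_ring_invol std_ring_simps(1) swap12_def)
  have inv: "?f (?f x) = x" for x by (simp add: std_ring_invol)
  have mult: "?f (x \<otimes>\<^bsub>std_ring r\<^esub> y) = ?f y \<otimes>\<^bsub>std_ring r\<^esub> ?f x" for x y
  proof
    fix k
    show "?f (x \<otimes>\<^bsub>std_ring r\<^esub> y) k = (?f y \<otimes>\<^bsub>std_ring r\<^esub> ?f x) k"
    proof (cases "k < 7")
      case k: True
      have "?f (x \<otimes>\<^bsub>std_ring r\<^esub> y) k = (\<Sum>i<7. \<Sum>j<7. x i * y j * std_coeff r i j (swap12 k))"
        using k by (simp add: std_ring_invol std_ring_mult swap12_less)
      also have "\<dots> = (\<Sum>i<7. \<Sum>j<7. x (swap12 i) * y j * std_coeff r (swap12 i) j (swap12 k))"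
        by (rule sum.reindex_bij_betw[OF bij, symmetric])
      also have "\<dots> = (\<Sum>i<7. \<Sum>j<7. x (swap12 i) * y (swap12 j) * std_coeff r (swap12 i) (swap12 j) (swap12 k))"
        by (intro sum.cong[OF refl] sum.reindex_bij_betw[OF bij, symmetric])
      also have "\<dots> = (\<Sum>i<7. \<Sum>j<7. x (swap12 i) * y (swap12 j) * std_coeff r j i k)"
        using k by (intro sum.cong[OF refl]) (simp add: coeff_facts)
      also have "\<dots> = (\<Sum>j<7. \<Sum>i<7. y (swap12 j) * x (swap12 i) * std_coeff r j i k)"
        by (subst sum.swap) (simp add: mult_ac)
      finally show ?thesis using k by (simp add: std_ring_invol std_ring_mult)
    next
      case False
      then have "\<not> swap12 k < 7" by (auto simp: swap12_def)
      then show ?thesis using False by (simp add: std_ring_invol std_ring_mult)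
    qed
  qed
  have "bij_betw ?f (carrier (std_ring r)) (carrier (std_ring r))"
    by (rule bij_betw_byWitness[where f' = ?f]) (auto simp: inv closed)
  moreover have "?f \<one>\<^bsub>std_ring r\<^esub> = \<one>\<^bsub>std_ring r\<^esub>" by (simp add: std_ring_simps(2) invol_vec7 swap12_def)
  ultimately have "anti_automorphism (std_ring r) ?f"
    unfolding anti_automorphism_def by (auto simp: mult) (simp add: std_ring_invol std_ring_add)
  then show "\<exists>f. anti_automorphism (std_ring r) f \<and> (\<forall>x\<in>basis (std_ring r). f x = ?f x)" by blast
qed

sublocale F: fusion_coords "std_ring r" enum7
proof
  show "fusion_ring (std_ring r)" by (rule fusion_ring_std)
  have "bij_betw vec7 {..<7} (basis (std_ring r))"
    unfolding std_ring_simps(4) by (intro bij_betw_imageI) (auto simp: inj_on_def)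
  then have "bij_betw (vec7 \<circ> idx) UNIV (basis (std_ring r))"
    by (rule bij_betw_trans[OF bij_idx])
  then show "bij_betw enum7 UNIV (basis (std_ring r))"
    by (simp add: enum7_def[abs_def] comp_def)
qed

lemma std_N: "F.N i j k = std_coeff r (idx i) (idx j) (idx k)"
  by (simp add: F.N_def enum7_def fusion_coeff_std)

lemma idx_dual: "idx (F.dual i) = swap12 (idx i)"
proof -
  have "enum7 (F.dual i) = vec7 (swap12 (idx i))"
    unfolding F.\<beta>_dual by (simp add: enum7_def invol_vec7)
  then show ?thesis by (simp add: enum7_def)
qed

lemma idx_unit: "idx F.unit = 0"
proof -
  have "enum7 F.unit = vec7 0" unfolding F.\<beta>_unit by (simp add: std_ring_simps)
  then show ?thesis by (simp add: enum7_def)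
qed

end

lemma std_of_data:
  assumes "(r, ts) \<in> set std_data"
  shows "std r" "character_check (r, ts)" "rep_check r"
proof -
  have "coeff_check r \<and> character_check (r, ts) \<and> rep_check r"
    using std_checks assms by (auto simp: list_all_iff)
  moreover have "assoc_check r" using assms assoc_check_std by (auto simp: std_data_def)
  ultimately show "std r" "character_check (r, ts)" "rep_check r" by (simp_all add: std_def)
qed

section \<open>Irreducibles and invariants of the models\<close>

context std
begin

definition fchar :: "int \<times> int \<Rightarrow> 7 \<Rightarrow> complex" where "fchar t i = of_int (std_char t (idx i))"
definition frep :: "7 \<Rightarrow> nat \<Rightarrow> nat \<Rightarrow> complex" where "frep b i j = of_int (std_rep (idx b) i j)"

text \<open>The degree-2 representation is zero on y and has codegree 3 for all three parameter
  choices; only the three characters differ.\<close>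

definition std_family :: "((int \<times> int) \<times> int) list \<Rightarrow> (nat \<times> (7 \<Rightarrow> nat \<Rightarrow> nat \<Rightarrow> complex) \<times> complex) list" where
  "std_family ts = (2, frep, 3) # map (\<lambda>(t, a). (1, F.rep_of (fchar t), of_int a)) ts"

lemma std_char_bool: "std_char t 0 = 1"
  by (simp add: std_char_def case_prod_unfold)

lemma sum_int_idx: "(\<Sum>i\<in>UNIV. complex_of_int (f (idx i))) = of_int (\<Sum>i<7. f i)"
  using sum_idx[of "\<lambda>i. complex_of_int (f i)"] by simp

lemma fchar_character:
  assumes "character_check (r, ts)" "(t, a) \<in> set ts"
  shows "F.character (fchar t)" "(\<Sum>b\<in>UNIV. fchar t b * fchar t (F.dual b)) = of_int a"
    "i < 2 \<Longrightarrow> j < 2 \<Longrightarrow> (\<Sum>b\<in>UNIV. frep b i j * fchar t (F.dual b)) = 0"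
proof -
  have c: "(\<forall>i<7. \<forall>j<7. std_char t i * std_char t j = (\<Sum>k<7. std_coeff r i j k * std_char t k)) \<and>
      (\<Sum>i<7. std_char t i * std_char t (swap12 i)) = a \<and>
      (\<forall>i\<in>{0, 1}. \<forall>j\<in>{0, 1}. (\<Sum>b<7. std_rep b i j * std_char t (swap12 b)) = 0)"
    using assms unfolding character_check_def by (auto simp: list_all_iff all7 sum7)
  show "F.character (fchar t)"
    unfolding F.character_def
  proof (intro conjI allI)
    show "fchar t F.unit = 1" by (simp add: fchar_def idx_unit std_char_bool)
    fix i j
    have "fchar t i * fchar t j = of_int (\<Sum>k<7. std_coeff r (idx i) (idx j) k * std_char t k)"
      using c by (simp add: fchar_def flip: of_int_mult)
    also have "\<dots> = (\<Sum>k\<in>UNIV. of_int (F.N i j k) * fchar t k)"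
      unfolding sum_int_idx[symmetric] by (simp add: std_N fchar_def)
    finally show "fchar t i * fchar t j = (\<Sum>k\<in>UNIV. of_int (F.N i j k) * fchar t k)" .
  qed
  have "(\<Sum>b\<in>UNIV. fchar t b * fchar t (F.dual b)) = of_int (\<Sum>i<7. std_char t i * std_char t (swap12 i))"
    unfolding sum_int_idx[symmetric] by (simp add: idx_dual fchar_def)
  then show "(\<Sum>b\<in>UNIV. fchar t b * fchar t (F.dual b)) = of_int a" using c by simp
  show "(\<Sum>b\<in>UNIV. frep b i j * fchar t (F.dual b)) = 0" if "i < 2" "j < 2"
  proof -
    have "(\<Sum>b\<in>UNIV. frep b i j * fchar t (F.dual b)) = of_int (\<Sum>b<7. std_rep b i j * std_char t (swap12 b))"
      unfolding sum_int_idx[symmetric] by (simp add: idx_dual fchar_def frep_def)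
    also have "(\<Sum>b<7. std_rep b i j * std_char t (swap12 b)) = 0"
    proof -
      have "i \<in> {0, 1}" "j \<in> {0, 1}" using that by auto
      then show ?thesis using c by blast
    qed
    finally show ?thesis by simp
  qed
qed

lemma frep_rep:
  assumes "rep_check r" shows "F.rep 2 frep" "F.biorth 2 frep 3"
proof -
  have c: "(\<forall>i\<in>{0, 1}. \<forall>j\<in>{0, 1}. (\<forall>a<7. \<forall>b<7. std_rep a i 0 * std_rep b 0 j + std_rep a i 1 * std_rep b 1 j
        = (\<Sum>c<7. std_coeff r a b c * std_rep c i j)) \<and>
      (\<forall>k\<in>{0, 1}. \<forall>l\<in>{0, 1}. (\<Sum>b<7. std_rep b i j * std_rep (swap12 b) k l) = (if i = l \<and> j = k then 3 else 0)))"
    using assms unfolding rep_check_def list_all_iff all7 sum7 by simp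
  show "F.rep 2 frep"
    unfolding F.rep_def
  proof (intro conjI allI impI)
    fix i j :: nat assume "i < 2" "j < 2"
    then show "frep F.unit i j = of_bool (i = j)"
      by (auto simp: frep_def idx_unit std_rep_def less_2_cases_iff)
  next
    fix a b and i j :: nat assume ij: "i < 2" "j < 2"
    have "(\<Sum>m<2. frep a i m * frep b m j) = of_int (std_rep (idx a) i 0 * std_rep (idx b) 0 j + std_rep (idx a) i 1 * std_rep (idx b) 1 j)"
      by (simp add: frep_def numeral_2_eq_2)
    also have "\<dots> = of_int (\<Sum>c<7. std_coeff r (idx a) (idx b) c * std_rep c i j)"
    proof -
      have "i \<in> {0, 1}" "j \<in> {0, 1}" using ij by auto
      then have "std_rep (idx a) i 0 * std_rep (idx b) 0 j + std_rep (idx a) i 1 * std_rep (idx b) 1 j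
        = (\<Sum>c<7. std_coeff r (idx a) (idx b) c * std_rep c i j)"
        using c idx_less by blast
      then show ?thesis by (simp only:)
    qed
    also have "\<dots> = (\<Sum>c\<in>UNIV. of_int (F.N a b c) * frep c i j)"
      unfolding sum_int_idx[symmetric] by (simp add: std_N frep_def)
    finally show "(\<Sum>m<2. frep a i m * frep b m j) = (\<Sum>c\<in>UNIV. of_int (F.N a b c) * frep c i j)" .
  qed
  show "F.biorth 2 frep 3"
    unfolding F.biorth_def
  proof (intro allI impI)
    fix i j k l :: nat assume "i < 2" "j < 2" "k < 2" "l < 2"
    then have "i \<in> {0, 1}" "j \<in> {0, 1}" "k \<in> {0, 1}" "l \<in> {0, 1}" by auto
    then have "(\<Sum>b<7. std_rep b i j * std_rep (swap12 b) k l) = (if i = l \<and> j = k then 3 else 0)"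
      using c by blast
    moreover have "(\<Sum>b\<in>UNIV. frep b i j * frep (F.dual b) k l) = of_int (\<Sum>b<7. std_rep b i j * std_rep (swap12 b) k l)"
      unfolding sum_int_idx[symmetric] by (simp add: idx_dual frep_def)
    ultimately show "(\<Sum>b\<in>UNIV. frep b i j * frep (F.dual b) k l) = (if i = l \<and> j = k then 3 else 0)"
      by simp
  qed
qed

lemma family_std:
  assumes cc: "character_check (r, ts)" and rc: "rep_check r" and nz: "\<And>t a. (t, a) \<in> set ts \<Longrightarrow> a \<noteq> 0"
  shows "F.family (std_family ts)"
  unfolding F.family_def
proof (intro conjI ballI)
  fix x assume "x \<in> set (std_family ts)"
  then consider "x = (2, frep, 3)" | t a where "(t, a) \<in> set ts" "x = (1, F.rep_of (fchar t), of_int a)"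
    by (auto simp: std_family_def)
  then show "case x of (n, \<rho>, g) \<Rightarrow> F.rep n \<rho> \<and> F.biorth n \<rho> g \<and> g \<noteq> 0"
  proof cases
    case 1
    then show ?thesis using frep_rep[OF rc] by simp
  next
    case 2
    then show ?thesis
      using fchar_character(1,2)[OF cc 2(1)] nz[OF 2(1)] by (simp add: F.rep_of_iff' F.biorth_def) (simp add: F.rep_of_def)
  qed
next
  have s: "sorted_wrt (\<lambda>(t, a) (t', a'). (\<Sum>i<7. std_char t i * std_char t' (swap12 i)) = 0) ts"
    using cc by (simp add: character_check_def sum7)
  have o: "F.orth 1 (F.rep_of (fchar t)) 1 (F.rep_of (fchar t'))" if "(\<Sum>i<7. std_char t i * std_char t' (swap12 i)) = 0" for t t'
  proof -
    have "(\<Sum>b\<in>UNIV. fchar t b * fchar t' (F.dual b)) = of_int (\<Sum>i<7. std_char t i * std_char t' (swap12 i))"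
      unfolding sum_int_idx[symmetric] by (simp add: idx_dual fchar_def)
    then show ?thesis using that by (simp add: F.orth_def F.rep_of_def)
  qed
  have "sorted_wrt (\<lambda>(t, a) (t', a'). F.orth 1 (F.rep_of (fchar t)) 1 (F.rep_of (fchar t'))) ts"
    by (rule sorted_wrt_mono_rel[OF _ s]) (use o in auto)
  moreover have "F.orth 2 frep 1 (F.rep_of (fchar t))" if "(t, a) \<in> set ts" for t a
    using fchar_character(3)[OF cc that] by (simp add: F.orth_def F.rep_of_def)
  ultimately show "sorted_wrt (\<lambda>(n, \<rho>, g) (m, \<sigma>, h). F.orth n \<rho> m \<sigma>) (std_family ts)"
    by (auto simp: std_family_def sorted_wrt_map case_prod_unfold)
qed

text \<open>Degrees 2, 1, 1, 1 give 4 + 1 + 1 + 1 = 7, so the family is complete and every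
  irreducible is equivalent to a member.\<close>

lemma std_codegrees:
  assumes cc: "character_check (r, ts)" and rc: "rep_check r" and nz: "\<And>t a. (t, a) \<in> set ts \<Longrightarrow> a \<noteq> 0"
    and len: "length ts = 3"
  shows "has_formal_codegrees (std_ring r) ((3, 2) # map (\<lambda>(t, a). (of_int a, 1)) ts)"
    and "irreducible_rep (std_ring r) n \<sigma> \<Longrightarrow> formal_codegree (std_ring r) n \<sigma> \<in> insert 3 ((\<lambda>(t, a). of_int a) ` set ts)"
proof -
  have card: "(\<Sum>(n, \<rho>, g)\<leftarrow>std_family ts. n\<^sup>2) = CARD(7)"
    using len by (simp add: std_family_def o_def case_prod_unfold sum_list_triv)
  have pos: "0 < n" if "(n, \<rho>, g) \<in> set (std_family ts)" for n \<rho> g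
    using that by (auto simp: std_family_def)
  have fam: "F.family (std_family ts)" by (rule family_std[OF cc rc]) (rule nz)
  show "has_formal_codegrees (std_ring r) ((3, 2) # map (\<lambda>(t, a). (of_int a, 1)) ts)"
    using F.has_formal_codegrees_family[OF fam card pos] by (simp add: std_family_def o_def case_prod_unfold)
  assume irr: "irreducible_rep (std_ring r) n \<sigma>"
  show "formal_codegree (std_ring r) n \<sigma> \<in> insert 3 ((\<lambda>(t, a). of_int a) ` set ts)"
  proof (rule F.irreducible_complete[OF fam card _ irr])
    fix m \<rho> g assume "(m, \<rho>, g) \<in> set (std_family ts)" "formal_codegree (std_ring r) n \<sigma> = g"
    then show ?thesis by (auto simp: std_family_def)
  qed (use pos in auto)
qed

definition std_dim :: "int \<times> int \<Rightarrow> (nat \<Rightarrow> int) \<Rightarrow> real" where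
  "std_dim t = restrict (\<lambda>x. \<Sum>i<7. of_int (x i) * of_int (std_char t i)) (carrier (std_ring r))"

lemma std_dim_vec7: "j < 7 \<Longrightarrow> std_dim t (vec7 j) = of_int (std_char t j)"
proof -
  assume j: "j < 7"
  have "(\<Sum>i<7. of_int (vec7 j i) * of_int (std_char t i)) = (\<Sum>i<7. if i = j then of_int (std_char t j) else (0 :: real))"
    by (intro sum.cong) auto
  then show ?thesis using j vec7_carrier[OF j] by (simp add: std_dim_def)
qed

lemma is_FPdim_std:
  assumes cc: "character_check (r, ts)" and t: "(t, a) \<in> set ts" and pos: "0 < fst t" "0 < snd t"
  shows "is_FPdim (std_ring r) (std_dim t)"
  unfolding is_FPdim_def
proof (intro conjI ballI)
  have c: "std_char t i * std_char t j = (\<Sum>k<7. std_coeff r i j k * std_char t k)" if "i < 7" "j < 7" for i j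
    using cc t that unfolding character_check_def by (auto simp: list_all_iff all7 sum7)
  show "std_dim t \<in> extensional (carrier (std_ring r))" by (simp add: std_dim_def)
  show "0 < std_dim t b" if "b \<in> basis (std_ring r)" for b
    using that pos by (auto simp: std_ring_simps(4) std_dim_vec7 std_char_def case_prod_unfold)
  show "std_dim t \<in> Ring.ring_hom (std_ring r) class_ring"
  proof (rule ring_hom_memI)
    fix x y assume x: "x \<in> carrier (std_ring r)" and y: "y \<in> carrier (std_ring r)"
    show "std_dim t x \<in> carrier class_ring" by (simp add: class_ring_simps)
    have "std_dim t (x \<otimes>\<^bsub>std_ring r\<^esub> y) = (\<Sum>k<7. of_int ((x \<otimes>\<^bsub>std_ring r\<^esub> y) k) * of_int (std_char t k))"
      unfolding std_dim_def using F.R.m_closed[OF x y] by simp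
    also have "\<dots> = (\<Sum>k<7. \<Sum>i<7. \<Sum>j<7. of_int (x i * y j) * of_int (std_coeff r i j k * std_char t k))"
      by (simp add: std_ring_mult sum_distrib_right sum_distrib_left mult_ac)
    also have "\<dots> = (\<Sum>i<7. \<Sum>k<7. \<Sum>j<7. of_int (x i * y j) * of_int (std_coeff r i j k * std_char t k))"
      by (rule sum.swap)
    also have "\<dots> = (\<Sum>i<7. \<Sum>j<7. \<Sum>k<7. of_int (x i * y j) * of_int (std_coeff r i j k * std_char t k))"
      by (rule sum.cong[OF refl]) (rule sum.swap)
    also have "\<dots> = (\<Sum>i<7. \<Sum>j<7. of_int (x i * y j) * of_int (std_char t i * std_char t j))"
      by (rule sum.cong[OF refl], rule sum.cong[OF refl]) (simp add: c del: of_int_mult flip: sum_distrib_left of_int_sum)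
    also have "\<dots> = std_dim t x * std_dim t y"
      using x y by (simp add: std_dim_def sum_product mult_ac)
    finally show "std_dim t (x \<otimes>\<^bsub>std_ring r\<^esub> y) = std_dim t x \<otimes>\<^bsub>class_ring\<^esub> std_dim t y"
      by (simp add: class_ring_simps)
    show "std_dim t (x \<oplus>\<^bsub>std_ring r\<^esub> y) = std_dim t x \<oplus>\<^bsub>class_ring\<^esub> std_dim t y"
      using x y by (simp add: std_dim_def class_ring_simps std_ring_simps(1) std_ring_add algebra_simps sum.distrib)
  next
    show "std_dim t \<one>\<^bsub>std_ring r\<^esub> = \<one>\<^bsub>class_ring\<^esub>"
      by (simp add: std_ring_simps(2) std_dim_vec7 std_char_bool class_ring_simps)
  qed
qed

lemma sum_std_basis: "(\<Sum>b\<in>basis (std_ring r). h b) = (\<Sum>i<7. h (vec7 i))"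
  unfolding std_ring_simps(4) by (subst sum.reindex) (auto simp: inj_on_def)

lemma rank_std: "rank (std_ring r) = 7"
  unfolding rank_def std_ring_simps(4) by (subst card_image) (auto simp: inj_on_def)

lemma noncommutative_std: "noncommutative (std_ring r)"
proof -
  \<comment> \<open>The product g s is the basis vector of index 4, whereas s g is that of index
    5.\<close>
  have "(vec7 1 \<otimes>\<^bsub>std_ring r\<^esub> vec7 3) 4 = std_coeff r 1 3 4" "(vec7 3 \<otimes>\<^bsub>std_ring r\<^esub> vec7 1) 4 = std_coeff r 3 1 4"
    using sum_of_bool_left[of 3 "\<lambda>j. std_coeff r 1 j 4"] sum_of_bool_left[of 1 "\<lambda>j. std_coeff r 3 j 4"]
    by (simp_all add: vec7_mult_left)
  moreover have "std_coeff r 1 3 4 = 1" "std_coeff r 3 1 4 = 0"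
    by (simp_all add: std_coeff_def case_prod_unfold left_index_def right_index_def)
  ultimately have "vec7 1 \<otimes>\<^bsub>std_ring r\<^esub> vec7 3 \<noteq> vec7 3 \<otimes>\<^bsub>std_ring r\<^esub> vec7 1" by (metis zero_neq_one)
  then show ?thesis unfolding noncommutative_def by (intro bexI[of _ "vec7 1"] bexI[of _ "vec7 3"]) (auto intro: vec7_carrier)
qed

lemma std_invariants:
  assumes cc: "character_check (r, ts)" and t: "(t, D) \<in> set ts" and pos: "0 < fst t" "0 < snd t"
  shows "FPdim (std_ring r) = std_dim t" "FPdim_ring (std_ring r) = of_int D"
    "integral_fusion_ring (std_ring r)"
    "fusion_type (std_ring r) = sort (map (\<lambda>i. of_int (std_char t i)) [0..<7])"
proof -
  show FP: "FPdim (std_ring r) = std_dim t" by (rule F.FPdim_eq[OF is_FPdim_std[OF assms]])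
  have "(\<Sum>i<7. std_char t i * std_char t (swap12 i)) = D"
    using cc t unfolding character_check_def by (auto simp: list_all_iff sum7)
  moreover have "std_char t (swap12 i) = std_char t i" for i
    by (simp add: std_char_def swap12_def case_prod_unfold)
  ultimately have D: "(\<Sum>i<7. std_char t i * std_char t i) = D" by simp
  have "FPdim_ring (std_ring r) = (\<Sum>i<7. of_int (std_char t i * std_char t i))"
    unfolding FPdim_ring_def sum_std_basis FP by (simp add: std_dim_vec7 power2_eq_square)
  then show "FPdim_ring (std_ring r) = of_int D" by (simp flip: D)
  show "integral_fusion_ring (std_ring r)"
    unfolding integral_fusion_ring_def
    using fusion_ring_std is_FPdim_std[OF assms] by (auto simp: std_ring_simps(4) std_dim_vec7 intro!: exI[of _ "std_dim t"])
  have "image_mset (FPdim (std_ring r)) (mset_set (basis (std_ring r))) = image_mset (\<lambda>i. std_dim t (vec7 i)) (mset_set {..<7})"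
    unfolding std_ring_simps(4) FP
    by (subst image_mset_mset_set[symmetric]) (auto simp: inj_on_def image_mset.compositionality o_def)
  also have "\<dots> = mset (map (\<lambda>i. of_int (std_char t i)) [0..<7])"
    by (simp add: lessThan_atLeast0 std_dim_vec7 flip: mset_set_set_mset_msubset) (auto intro!: image_mset_cong simp: std_dim_vec7)
  finally show "fusion_type (std_ring r) = sort (map (\<lambda>i. of_int (std_char t i)) [0..<7])"
    unfolding fusion_type_def by (simp only: sorted_list_of_multiset_mset)
qed

lemma Drinfeld_std:
  assumes cc: "character_check (r, ts)" and rc: "rep_check r" and len: "length ts = 3"
    and t: "(t, D) \<in> set ts" and pos: "0 < fst t" "0 < snd t"
    and dvd: "3 dvd D" "\<And>t a. (t, a) \<in> set ts \<Longrightarrow> a \<noteq> 0 \<and> a dvd D"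
  shows "Drinfeld_ring (std_ring r)"
  unfolding Drinfeld_ring_def
proof (intro conjI allI impI)
  show "integral_fusion_ring (std_ring r)" by (rule std_invariants(3)[OF cc t pos])
  fix n \<rho> assume "irreducible_rep (std_ring r) n \<rho>"
  then have "formal_codegree (std_ring r) n \<rho> \<in> insert 3 ((\<lambda>(t, a). of_int a) ` set ts)"
    using std_codegrees(2)[OF cc rc _ len] dvd(2) by blast
  then obtain f where "formal_codegree (std_ring r) n \<rho> = of_int f" "f dvd D"
    using dvd by (auto intro: that[of 3])
  then show "\<exists>f D :: int. formal_codegree (std_ring r) n \<rho> = of_int f \<and> FPdim_ring (std_ring r) = of_int D \<and> f dvd D"
    using std_invariants(2)[OF cc t pos] by blast
qed

text \<open>The list \<open>js\<close> enumerates the indices by nondecreasing dimension, and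
  \<open>L\<close> is the duality read off in that order.\<close>

lemma has_duality_std:
  assumes cc: "character_check (r, ts)" and t: "(t, D) \<in> set ts" and pos: "0 < fst t" "0 < snd t"
    and js: "distinct js" "set js = {..<7}" "js ! 0 = 0" "sorted (map (std_char t) js)"
    and L: "length L = 7" "\<forall>i<7. L ! i < 7 \<and> swap12 (js ! i) = js ! (L ! i)"
  shows "has_duality (std_ring r) L"
  unfolding has_duality_def
proof (intro exI[of _ "map vec7 js"] conjI allI impI)
  have len: "length js = 7" using js(1,2) distinct_card[of "js"] by simp
  show "distinct (map vec7 js)" using js(1) by (simp add: distinct_map inj_on_def)
  show "set (map vec7 js) = basis (std_ring r)" using js(2) by (simp add: std_ring_simps(4))
  show "map vec7 js ! 0 = \<one>\<^bsub>std_ring r\<^esub>" using len js(3) by (simp add: std_ring_simps(2))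
  have "map (FPdim (std_ring r)) (map vec7 js) = map real_of_int (map (std_char t) js)"
    unfolding std_invariants(1)[OF cc t pos] using js(2) by (auto simp: std_dim_vec7)
  then show "sorted (map (FPdim (std_ring r)) (map vec7 js))"
    using js(4) by (simp only:) (simp add: sorted_map)
  show "length L = length (map vec7 js)" using L(1) len by simp
  fix i assume i: "i < length (map vec7 js)"
  then show "L ! i < length (map vec7 js)" using L(2) len by simp
  show "invol (std_ring r) (map vec7 js ! i) = map vec7 js ! (L ! i)"
    using i L(2) len by (simp add: invol_vec7)
qed

end

section \<open>Classification\<close>

lemma (in fusion_data) family_swap:
  "family [x, y, (n, \<rho>, g), (m, \<sigma>, h)] \<Longrightarrow> family [x, y, (m, \<sigma>, h), (n, \<rho>, g)]"
  by (auto simp: family_def intro: orth_sym)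

context fusion_coords
begin

lemma Drinfeld_classification:
  assumes card: "CARD('n) = 7" and Dr: "Drinfeld_ring S" and nc: "noncommutative S"
  obtains e r where "bij_betw e {..<7} UNIV" "e 0 = unit" "r \<in> {(1, 0, 0, 2), (0, 0, 1, 5), (1, 1, 0, 2)}"
    "\<forall>i<7. \<forall>j<7. \<forall>k<7. N (e i) (e j) (e k) = std_coeff r i j k"
proof -
  obtain d0 where d0: "is_FPdim S d0" "\<And>b. b \<in> basis S \<Longrightarrow> d0 b \<in> \<int>"
    using Dr unfolding Drinfeld_ring_def integral_fusion_ring_def by blast
  define d where "d i = \<lfloor>d0 (\<beta> i)\<rfloor>" for i
  have d: "of_int (d i) = d0 (\<beta> i)" for i
    using d0(2)[OF \<beta>_basis, of i] by (auto simp: d_def elim: Ints_cases)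
  define \<delta> where "\<delta> i = complex_of_int (d i)" for i
  have "\<delta> = (\<lambda>i. of_real (d0 (\<beta> i)))" by (simp add: \<delta>_def fun_eq_iff flip: d)
  then have \<delta>: "character \<delta>" using FPdim_character(1)[OF d0(1)] by simp
  have "0 < real_of_int (d i)" for i unfolding d by (rule FPdim_character(2)[OF d0(1)])
  then have pos: "0 < d i" for i by simp
  define D where "D = (\<Sum>i\<in>UNIV. d i * d i)"
  have "FPdim_ring S = (\<Sum>i\<in>UNIV. (of_int (d i))\<^sup>2)"
    unfolding FPdim_ring_def sum_basis FPdim_eq[OF d0(1)] d ..
  then have FP: "FPdim_ring S = of_int D" by (simp add: D_def power2_eq_square)
  have "0 < D" unfolding D_def by (intro sum_pos) (auto simp: pos)
  have "\<delta> (dual i) = \<delta> i" for i using character_dual[OF \<delta>, of i] by (simp add: \<delta>_def)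
  then have "(\<Sum>b\<in>UNIV. \<delta> b * \<delta> (dual b)) = of_int D" by (simp add: D_def \<delta>_def)
  moreover have "complex_of_int D \<noteq> 0" using \<open>0 < D\<close> by simp
  moreover obtain p q r where "N p q r \<noteq> N q p r" using noncommutative_coeff[OF nc] by blast
  ultimately obtain \<rho> f' \<psi> a' \<phi> b' where fam:
    "family [(1, rep_of \<delta>, of_int D), (2, \<rho>, f'), (1, rep_of \<psi>, a'), (1, rep_of \<phi>, b')]"
    by (rule irreducible_family[OF card \<delta>])
  \<comment> \<open>The constants of the abstract family are formal codegrees of genuine irreducible
    representations, so the Drinfeld condition applies to them.\<close>
  have codegree: "\<exists>h :: int. g = of_int h \<and> h dvd D"
    if mem: "(n, \<sigma>, g) \<in> set [(1, rep_of \<delta>, of_int D), (2, \<rho>, f'), (1, rep_of \<psi>, a'), (1, rep_of \<phi>, b')]" for n :: nat and \<sigma> g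
  proof -
    have rep: "rep n \<sigma>" "biorth n \<sigma> g" "g \<noteq> 0" using fam mem unfolding family_def by blast+
    have n: "0 < n" using mem by auto
    have "formal_codegree S n (mrep n \<sigma>) = g"
      by (rule formal_codegree_eqI[where \<sigma> = "mrep n \<sigma>", OF n mrep_central[OF rep(1,2)]])
    moreover have "irreducible_rep S n (mrep n \<sigma>)" by (rule irreducible_mrep[OF n rep])
    ultimately obtain h D' :: int where "g = of_int h" "FPdim_ring S = of_int D'" "h dvd D'"
      using Dr unfolding Drinfeld_ring_def by metis
    then show ?thesis using FP by auto
  qed
  obtain f where f: "f' = of_int f" "f dvd D" using codegree[of 2 \<rho> f'] by auto
  obtain a where a: "a' = of_int a" "a dvd D" using codegree[of 1 "rep_of \<psi>" a'] by auto
  obtain b where b: "b' = of_int b" "b dvd D" using codegree[of 1 "rep_of \<phi>" b'] by auto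
  note fam = fam[unfolded f(1) a(1) b(1) \<delta>_def[abs_def]]
  \<comment> \<open>Both orders of the last two characters are interpreted; since their codegrees
    differ, one of the orders is increasing.\<close>
  interpret A: integral_decomposition N dual unit d \<rho> \<psi> \<phi> f a b D
    by unfold_locales (use card fam pos f a b noncommutative_coeff[OF nc] in auto)
  interpret B: integral_decomposition N dual unit d \<rho> \<phi> \<psi> f b a D
    by unfold_locales (use card family_swap[OF fam] pos f a b noncommutative_coeff[OF nc] in auto)
  show thesis
  proof (cases "a < b")
    case True
    then show thesis using A.classification that by blast
  next
    case False
    then have "b < a" using A.codegrees_distinct by simp
    then show thesis using B.classification that by blast
  qed
qed

lemma fusion_iso_std:
  assumes bij': "bij_betw e {..<7} UNIV" and e0: "e 0 = unit"
    and c: "\<forall>i<7. \<forall>j<7. \<forall>k<7. N (e i) (e j) (e k) = std_coeff r i j k"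
  shows "fusion_iso S (std_ring r)"
proof -
  define h where "h x i = (if i < 7 then cf x (e i) else 0)" for x and i :: nat
  have sum_e: "(\<Sum>i\<in>UNIV. g i) = (\<Sum>i<7. g (e i))" for g :: "'n \<Rightarrow> int"
    by (rule sum.reindex_bij_betw[OF bij', symmetric])
  have ex: "\<exists>i<7. e i = b" for b
  proof -
    have "b \<in> e ` {..<7}" using bij' by (simp add: bij_betw_def)
    then show ?thesis by auto
  qed
  have inj: "e i = e j \<longleftrightarrow> i = j" if "i < 7" "j < 7" for i j
    using bij' that by (auto simp: bij_betw_def inj_on_def)
  have h\<beta>: "h (\<beta> (e i)) = vec7 i" if "i < 7" for i
    using that by (auto simp: h_def cf_\<beta> inj fun_eq_iff)
  have "h \<in> ring_iso S (std_ring r)"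
  proof (rule ring_iso_memI)
    show "h x \<in> carrier (std_ring r)" for x by (simp add: h_def std_ring_simps)
    show "h (x \<otimes>\<^bsub>S\<^esub> y) = h x \<otimes>\<^bsub>std_ring r\<^esub> h y" if "x \<in> carrier S" "y \<in> carrier S" for x y
    proof
      fix k
      show "h (x \<otimes>\<^bsub>S\<^esub> y) k = (h x \<otimes>\<^bsub>std_ring r\<^esub> h y) k"
        using that c by (auto simp: h_def cf_mult sum_e std_ring_mult intro!: sum.cong)
    qed
    show "h (x \<oplus>\<^bsub>S\<^esub> y) = h x \<oplus>\<^bsub>std_ring r\<^esub> h y" if "x \<in> carrier S" "y \<in> carrier S" for x y
      using that by (simp add: h_def cf_add std_ring_add fun_eq_iff)
    show "h \<one>\<^bsub>S\<^esub> = \<one>\<^bsub>std_ring r\<^esub>" using h\<beta>[of 0] by (simp add: e0 \<beta>_unit std_ring_simps)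
    show "bij_betw h (carrier S) (carrier (std_ring r))"
    proof (rule bij_betwI')
      fix x y assume xy: "x \<in> carrier S" "y \<in> carrier S"
      show "h x = h y \<longleftrightarrow> x = y"
      proof
        assume eq: "h x = h y"
        have "cf x b = cf y b" for b
        proof -
          obtain i where "i < 7" "e i = b" using ex by blast
          then show ?thesis using fun_cong[OF eq, of i] by (simp add: h_def)
        qed
        then show "x = y" by (intro cf_inj xy ext)
      qed simp
    next
      fix y assume y: "y \<in> carrier (std_ring r)"
      define g where "g b = y (inv_into {..<7} e b)" for b
      have "inv_into {..<7} e (e i) = i" if "i < 7" for i
        using bij' that by (intro inv_into_f_f) (auto simp: bij_betw_def)
      then have "h (lc g) = y" using y by (auto simp: h_def g_def std_ring_simps fun_eq_iff)
      then show "\<exists>x\<in>carrier S. y = h x" by (intro bexI[of _ "lc g"]) auto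
    qed (simp add: h_def std_ring_simps)
  qed
  moreover have "h ` basis S = basis (std_ring r)"
  proof -
    have "basis S = \<beta> ` e ` {..<7}" using bij bij' by (simp add: bij_betw_def)
    then show ?thesis using h\<beta> by (auto simp: std_ring_simps image_iff)
  qed
  ultimately show ?thesis unfolding fusion_iso_def by blast
qed

text \<open>Pulling the dimension back along an isomorphism gives a dimension function, which is the
  only one; so the total dimension is an invariant that separates the three models.\<close>

lemma FPdim_ring_iso:
  assumes iso: "fusion_iso S S'" and d: "is_FPdim S' d"
  shows "FPdim_ring S = (\<Sum>b\<in>basis S'. (d b)\<^sup>2)"
proof -
  obtain h where h: "h \<in> ring_iso S S'" "h ` basis S = basis S'" using iso by (auto simp: fusion_iso_def)
  define d' where "d' = restrict (d \<circ> h) (carrier S)"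
  have dh: "d \<in> Ring.ring_hom S' class_ring" using d by (simp add: is_FPdim_def)
  have "is_FPdim S d'"
    unfolding is_FPdim_def
  proof (intro conjI ballI)
    show "d' \<in> extensional (carrier S)" by (simp add: d'_def)
    show "0 < d' b" if "b \<in> basis S" for b
      using that basis_carrier d h(2) by (auto simp: d'_def is_FPdim_def)
    show "d' \<in> Ring.ring_hom S class_ring"
    proof (rule ring_hom_memI)
      fix x y assume x: "x \<in> carrier S" and y: "y \<in> carrier S"
      note hm = ring_iso_memE(1)[OF h(1) x] ring_iso_memE(1)[OF h(1) y]
      show "d' x \<in> carrier class_ring" by (simp add: class_ring_simps)
      show "d' (x \<otimes>\<^bsub>S\<^esub> y) = d' x \<otimes>\<^bsub>class_ring\<^esub> d' y"
        using x y by (simp add: d'_def ring_iso_memE(2)[OF h(1) x y] ring_hom_mult[OF dh hm])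
      show "d' (x \<oplus>\<^bsub>S\<^esub> y) = d' x \<oplus>\<^bsub>class_ring\<^esub> d' y"
        using x y by (simp add: d'_def ring_iso_memE(3)[OF h(1) x y] ring_hom_add[OF dh hm])
    qed (simp add: d'_def ring_iso_memE(4)[OF h(1)] ring_hom_one[OF dh])
  qed
  then have "FPdim_ring S = (\<Sum>b\<in>basis S. (d (h b))\<^sup>2)"
    unfolding FPdim_ring_def FPdim_eq[OF \<open>is_FPdim S d'\<close>] using basis_carrier
    by (intro sum.cong) (auto simp: d'_def)
  also have "\<dots> = (\<Sum>b\<in>h ` basis S. (d b)\<^sup>2)"
    using ring_iso_memE(5)[OF h(1)] inj_on_subset[OF _ basis_carrier]
    by (subst sum.reindex) (auto simp: bij_betw_def)
  finally show ?thesis by (simp add: h(2))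
qed

end

lemma (in std) FPdim_ring_eq_of_iso:
  assumes "std r'" "fusion_iso (std_ring r) (std_ring r')"
    and "character_check (r', ts)" "(t, a) \<in> set ts" "0 < fst t" "0 < snd t"
  shows "FPdim_ring (std_ring r) = FPdim_ring (std_ring r')"
proof -
  interpret R': std r' by fact
  have d: "is_FPdim (std_ring r') (R'.std_dim t)" by (rule R'.is_FPdim_std) fact+
  show ?thesis
    using F.FPdim_ring_iso[OF assms(2) d] unfolding FPdim_ring_def[of "std_ring r'"] R'.F.FPdim_eq[OF d] .
qed

section \<open>Invariants of the individual models\<close>

lemma std_ring_properties:
  assumes mem: "(r, ts) \<in> set std_data" and t: "(t, D) \<in> set ts" and pos: "0 < fst t" "0 < snd t"
    and dvd: "3 dvd D" "\<forall>(t, a)\<in>set ts. a \<noteq> 0 \<and> a dvd D"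
    and js: "distinct js" "\<forall>i<7. i \<in> set js" "\<forall>i\<in>set js. i < 7" "js ! 0 = 0" "sorted (map (std_char t) js)"
    and L: "length L = 7" "\<forall>i<7. L ! i < 7 \<and> swap12 (js ! i) = js ! (L ! i)"
  shows "Drinfeld_ring (std_ring r) \<and> noncommutative (std_ring r) \<and> rank (std_ring r) = 7 \<and>
    FPdim_ring (std_ring r) = of_int D \<and>
    fusion_type (std_ring r) = sort (map (\<lambda>i. of_int (std_char t i)) [0..<7]) \<and>
    has_duality (std_ring r) L \<and>
    has_formal_codegrees (std_ring r) ((3, 2) # map (\<lambda>(t, a). (of_int a, 1)) ts)"
proof -
  note facts = std_of_data[OF mem]
  interpret std r by (rule facts(1))
  have len: "length ts = 3" using mem by (auto simp: std_data_def)
  have dvd': "a \<noteq> 0 \<and> a dvd D" if "(t, a) \<in> set ts" for t a using dvd(2) that by blast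
  have js': "set js = {..<7}" using js(2,3) by auto
  show ?thesis
    by (intro conjI Drinfeld_std[OF facts(2,3) len t pos dvd(1) dvd'] noncommutative_std rank_std
      std_invariants(2,4)[OF facts(2) t pos] has_duality_std[OF facts(2) t pos js(1) js' js(4,5) L]
      std_codegrees(1)[OF facts(2,3) _ len] conjunct1[OF dvd'])
qed

lemma std_not_iso:
  assumes "(r, ts) \<in> set std_data" "(r', ts') \<in> set std_data" "(t, a) \<in> set ts'" "0 < fst t" "0 < snd t"
    and "FPdim_ring (std_ring r) \<noteq> FPdim_ring (std_ring r')"
  shows "\<not> fusion_iso (std_ring r) (std_ring r')"
  using std.FPdim_ring_eq_of_iso[OF std_of_data(1)[OF assms(1)] std_of_data(1)[OF assms(2)] _ std_of_data(2)[OF assms(2)] assms(3-5)]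
    assms(6) by blast

lemma std_ring_1:
  "Drinfeld_ring (std_ring (1, 0, 0, 2)) \<and> noncommutative (std_ring (1, 0, 0, 2)) \<and> rank (std_ring (1, 0, 0, 2)) = 7 \<and>
    FPdim_ring (std_ring (1, 0, 0, 2)) = 24 \<and> fusion_type (std_ring (1, 0, 0, 2)) = [1, 1, 1, 2, 2, 2, 3] \<and>
    has_duality (std_ring (1, 0, 0, 2)) [0, 2, 1, 3, 4, 5, 6] \<and>
    has_formal_codegrees (std_ring (1, 0, 0, 2)) [(3, 2), (4, 1), (24, 1), (24, 1)]"
  using std_ring_properties[of "(1, 0, 0, 2)" "[((0, - 1), 4), ((- 2, 3), 24), ((2, 3), 24)]" "(2, 3)" 24
    "[0, 1, 2, 3, 4, 5, 6]" "[0, 2, 1, 3, 4, 5, 6]"]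
  by (simp add: std_data_def std_char_def all_less_7 swap12_def upt_rec)

text \<open>The first six basis elements form the symmetric group on three letters. Its involutions,
  at indices 3 to 5, are listed before \<open>g\<close> and its inverse to match the stated
  duality.\<close>

lemma std_ring_2:
  "Drinfeld_ring (std_ring (0, 0, 1, 5)) \<and> noncommutative (std_ring (0, 0, 1, 5)) \<and> rank (std_ring (0, 0, 1, 5)) = 7 \<and>
    FPdim_ring (std_ring (0, 0, 1, 5)) = 42 \<and> fusion_type (std_ring (0, 0, 1, 5)) = [1, 1, 1, 1, 1, 1, 6] \<and>
    has_duality (std_ring (0, 0, 1, 5)) [0, 1, 2, 3, 5, 4, 6] \<and>
    has_formal_codegrees (std_ring (0, 0, 1, 5)) [(3, 2), (6, 1), (7, 1), (42, 1)]"
  using std_ring_properties[of "(0, 0, 1, 5)" "[((- 1, 0), 6), ((1, - 1), 7), ((1, 6), 42)]" "(1, 6)" 42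
    "[0, 3, 4, 5, 1, 2, 6]" "[0, 1, 2, 3, 5, 4, 6]"]
  by (simp add: std_data_def std_char_def all_less_7 swap12_def upt_rec)

text \<open>Here y has dimension 3 and the \<open>g^i s\<close> have dimension 4, so index 6 moves
  ahead of indices 3 to 5.\<close>

lemma std_ring_3:
  "Drinfeld_ring (std_ring (1, 1, 0, 2)) \<and> noncommutative (std_ring (1, 1, 0, 2)) \<and> rank (std_ring (1, 1, 0, 2)) = 7 \<and>
    FPdim_ring (std_ring (1, 1, 0, 2)) = 60 \<and> fusion_type (std_ring (1, 1, 0, 2)) = [1, 1, 1, 3, 4, 4, 4] \<and>
    has_duality (std_ring (1, 1, 0, 2)) [0, 2, 1, 3, 4, 5, 6] \<and>
    has_formal_codegrees (std_ring (1, 1, 0, 2)) [(3, 2), (4, 1), (15, 1), (60, 1)]"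
  using std_ring_properties[of "(1, 1, 0, 2)" "[((0, - 1), 4), ((- 1, 3), 15), ((4, 3), 60)]" "(4, 3)" 60
    "[0, 1, 2, 6, 3, 4, 5]" "[0, 2, 1, 3, 4, 5, 6]"]
  by (simp add: std_data_def std_char_def all_less_7 swap12_def upt_rec)

lemma std_ring_not_iso:
  "\<not> fusion_iso (std_ring (1, 0, 0, 2)) (std_ring (0, 0, 1, 5))"
  "\<not> fusion_iso (std_ring (1, 0, 0, 2)) (std_ring (1, 1, 0, 2))"
  "\<not> fusion_iso (std_ring (0, 0, 1, 5)) (std_ring (1, 1, 0, 2))"
proof -
  let ?d1 = "[((0, - 1), 4), ((- 2, 3), 24), ((2, 3), 24)] :: ((int \<times> int) \<times> int) list"
  let ?d2 = "[((- 1, 0), 6), ((1, - 1), 7), ((1, 6), 42)] :: ((int \<times> int) \<times> int) list"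
  let ?d3 = "[((0, - 1), 4), ((- 1, 3), 15), ((4, 3), 60)] :: ((int \<times> int) \<times> int) list"
  have mem: "((1, 0, 0, 2), ?d1) \<in> set std_data" "((0, 0, 1, 5), ?d2) \<in> set std_data" "((1, 1, 0, 2), ?d3) \<in> set std_data"
    by (simp_all add: std_data_def)
  show "\<not> fusion_iso (std_ring (1, 0, 0, 2)) (std_ring (0, 0, 1, 5))"
    by (rule std_not_iso[OF mem(1,2), of "(1, 6)" 42]) (simp_all add: std_ring_1 std_ring_2)
  show "\<not> fusion_iso (std_ring (1, 0, 0, 2)) (std_ring (1, 1, 0, 2))"
    by (rule std_not_iso[OF mem(1,3), of "(4, 3)" 60]) (simp_all add: std_ring_1 std_ring_3)
  show "\<not> fusion_iso (std_ring (0, 0, 1, 5)) (std_ring (1, 1, 0, 2))"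
    by (rule std_not_iso[OF mem(2,3), of "(4, 3)" 60]) (simp_all add: std_ring_2 std_ring_3)
qed

lemma Drinfeld_rank_7:
  assumes S: "Drinfeld_ring S" "noncommutative S" "rank S = 7"
  obtains r where "r \<in> {(1, 0, 0, 2), (0, 0, 1, 5), (1, 1, 0, 2)}" "fusion_iso S (std_ring r)"
proof -
  have fus: "fusion_ring S" using S(1) by (simp add: Drinfeld_ring_def integral_fusion_ring_def)
  then have "finite (basis S)" by (simp add: fusion_ring_def free_basis_def)
  then obtain \<beta> :: "7 \<Rightarrow> _" where "bij_betw \<beta> UNIV (basis S)"
    using finite_same_card_bij[of "UNIV :: 7 set" "basis S"] S(3) by (auto simp: rank_def)
  with fus interpret fusion_coords S \<beta> by unfold_locales
  obtain e r where e: "bij_betw e {..<7} UNIV" "e 0 = unit" "r \<in> {(1, 0, 0, 2), (0, 0, 1, 5), (1, 1, 0, 2)}"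
    "\<forall>i<7. \<forall>j<7. \<forall>k<7. N (e i) (e j) (e k) = std_coeff r i j k"
    by (rule Drinfeld_classification[OF _ S(1,2)]) simp
  show thesis by (rule that[OF e(3) fusion_iso_std[OF e(1,2,4)]])
qed

theorem proposition9p8:
  "\<exists>(R1 :: (nat \<Rightarrow> int) based_ring) (R2 :: (nat \<Rightarrow> int) based_ring) (R3 :: (nat \<Rightarrow> int) based_ring).
     (Drinfeld_ring R1 \<and> noncommutative R1 \<and> rank R1 = 7 \<and>
      FPdim_ring R1 = 24 \<and> fusion_type R1 = [1, 1, 1, 2, 2, 2, 3] \<and>
      has_duality R1 [0, 2, 1, 3, 4, 5, 6] \<and>
      has_formal_codegrees R1 [(3, 2), (4, 1), (24, 1), (24, 1)]) \<and>
     (Drinfeld_ring R2 \<and> noncommutative R2 \<and> rank R2 = 7 \<and>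
      FPdim_ring R2 = 42 \<and> fusion_type R2 = [1, 1, 1, 1, 1, 1, 6] \<and>
      has_duality R2 [0, 1, 2, 3, 5, 4, 6] \<and>
      has_formal_codegrees R2 [(3, 2), (6, 1), (7, 1), (42, 1)]) \<and>
     (Drinfeld_ring R3 \<and> noncommutative R3 \<and> rank R3 = 7 \<and>
      FPdim_ring R3 = 60 \<and> fusion_type R3 = [1, 1, 1, 3, 4, 4, 4] \<and>
      has_duality R3 [0, 2, 1, 3, 4, 5, 6] \<and>
      has_formal_codegrees R3 [(3, 2), (4, 1), (15, 1), (60, 1)]) \<and>
     \<not> fusion_iso R1 R2 \<and> \<not> fusion_iso R1 R3 \<and> \<not> fusion_iso R2 R3 \<and>
     (\<forall>S :: 'a based_ring.
        Drinfeld_ring S \<and> noncommutative S \<and> rank S = 7 \<longrightarrow>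
        fusion_iso S R1 \<or> fusion_iso S R2 \<or> fusion_iso S R3)"
proof (intro exI conjI allI impI)
  fix S :: "'a based_ring" assume "Drinfeld_ring S \<and> noncommutative S \<and> rank S = 7"
  then obtain r where "r \<in> {(1, 0, 0, 2), (0, 0, 1, 5), (1, 1, 0, 2)}" "fusion_iso S (std_ring r)"
    using Drinfeld_rank_7[of S] by blast
  then show "fusion_iso S (std_ring (1, 0, 0, 2)) \<or> fusion_iso S (std_ring (0, 0, 1, 5)) \<or> fusion_iso S (std_ring (1, 1, 0, 2))"
    by blast
qed (simp_all only: std_ring_1 std_ring_2 std_ring_3 std_ring_not_iso not_False_eq_True)

end
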